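(* Let $k$ be an algebraically closed field of prime characteristic $p$, let $S$ be a commutative Noetherian graded $k$-algebra and let $G$ be a finite group acting on $S$ by graded $k$-algebra automorphisms. Let $P$ be a Sylow $p$-subgroup of $G$. Then both $S^{\oplus G}$ and $S^{[G]}$ have spectra homeomorphic to $\operatorname{Spec}(S)^P/N_G(P)$. In particular, they both have (Krull) dimension $\dim\operatorname{Spec}(S)^P$.
   Context: $S^{[G]}$ (the Brauer quotient) is the ring $S^G/\sum_{H} \operatorname{tr}_H^G(S^H)$, where the sum is over subgroups $H\le G$ with $p\mid |G:H|$ and $\operatorname{tr}_H^G(x)=\sum_{g\in G/H}gx$ is the transfer. $S^{\oplus G}:=\operatorname{Hom}_{kG}(k,S)/J_G(k,S)$, where $k$ is the trivial module and $J_G(k,S)$ is the subspace of homomorphisms $k\to S$ of $kG$-modules that are not split injective. Identifying $\operatorname{Hom}_{kG}(k,S)$ with $S^G$, $J_G(k,S)$ is an ideal of $S^G$, so $S^{\oplus G}$ is a ring. $\operatorname{Spec}(S)^P$ is the set of prime ideals $J$ of $S$ that are fixed as sets by $P$ and such that $P$ acts trivially on $S/J$, with the subspace topology from $\operatorname{Spec}(S)$; $N_G(P)$ acts on it and $\operatorname{Spec}(S)^P/N_G(P)$ is the quotient space. *)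

theory Defs
  imports
    "HOL-Algebra.Algebra"
    "HOL-Algebra.Group_Action"
    "HOL-Algebra.Left_Coset"
    "HOL-Algebra.Algebraic_Closure"
    "HOL-Computational_Algebra.Primes"
    "HOL-Library.Extended_Real"
    "HOL-Analysis.Abstract_Topology"
begin

section \<open>Graded algebras with a group action\<close>

definition ring_char :: "('a, 'm) ring_scheme \<Rightarrow> nat"
  where "ring_char R =
    (if \<exists>n::nat. 0 < n \<and> add_pow R n \<one>\<^bsub>R\<^esub> = \<zero>\<^bsub>R\<^esub>
     then LEAST n::nat. 0 < n \<and> add_pow R n \<one>\<^bsub>R\<^esub> = \<zero>\<^bsub>R\<^esub> else 0)"

text \<open>Gradings are indexed by the integers; an algebra graded by the naturals is the case in which
  the components of negative degree are zero.\<close>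

locale graded_algebra = algebra k S
  for k :: "('k, 'm) ring_scheme" (structure) and S :: "('k, 's, 'n) module_scheme" (structure) +
  fixes gr :: "int \<Rightarrow> 's set"
  assumes gr_submodule: "submodule (gr i) k S"
    and gr_mult: "\<lbrakk>x \<in> gr i; y \<in> gr j\<rbrakk> \<Longrightarrow> x \<otimes>\<^bsub>S\<^esub> y \<in> gr (i + j)"
    and gr_direct_sum: "x \<in> carrier S \<Longrightarrow>
      \<exists>!f. (\<forall>i. f i \<in> gr i) \<and> finite {i. f i \<noteq> \<zero>\<^bsub>S\<^esub>} \<and>
           x = (\<Oplus>\<^bsub>S\<^esub>i\<in>{i. f i \<noteq> \<zero>\<^bsub>S\<^esub>}. f i)"

locale graded_algebra_action = graded_algebra k S gr + group_action G "carrier S" \<phi>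
  for k :: "('k, 'm) ring_scheme" (structure) and S :: "('k, 's, 'n) module_scheme" (structure)
    and gr :: "int \<Rightarrow> 's set" and G :: "('g, 'l) monoid_scheme" (structure)
    and \<phi> :: "'g \<Rightarrow> 's \<Rightarrow> 's" +
  assumes act_ring_hom: "g \<in> carrier G \<Longrightarrow> \<phi> g \<in> ring_hom S S"
    and act_smult: "\<lbrakk>g \<in> carrier G; a \<in> carrier k; x \<in> carrier S\<rbrakk>
      \<Longrightarrow> \<phi> g (a \<odot>\<^bsub>S\<^esub> x) = a \<odot>\<^bsub>S\<^esub> \<phi> g x"
    and act_graded: "g \<in> carrier G \<Longrightarrow> \<phi> g ` gr i = gr i"

definition sylow_subgroup :: "nat \<Rightarrow> 'g set \<Rightarrow> ('g, 'l) monoid_scheme \<Rightarrow> bool"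
  where "sylow_subgroup p P G \<longleftrightarrow> subgroup P G \<and> card P = p ^ multiplicity p (order G)"

section \<open>Invariants and the Brauer quotient\<close>

definition fixed_points :: "('s, 'n) ring_scheme \<Rightarrow> ('g \<Rightarrow> 's \<Rightarrow> 's) \<Rightarrow> 'g set \<Rightarrow> 's set"
  where "fixed_points S \<phi> H = {x \<in> carrier S. \<forall>g\<in>H. \<phi> g x = x}"

definition invariant_ring ::
    "('s, 'n) ring_scheme \<Rightarrow> ('g \<Rightarrow> 's \<Rightarrow> 's) \<Rightarrow> 'g set \<Rightarrow> ('s, 'n) ring_scheme"
  where "invariant_ring S \<phi> H = S\<lparr>carrier := fixed_points S \<phi> H\<rparr>"

text \<open>Only applied to \<open>H\<close>-invariant elements \<open>x\<close>, for which the choice of coset representatives is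
  irrelevant.\<close>

definition transfer ::
    "('s, 'n) ring_scheme \<Rightarrow> ('g, 'l) monoid_scheme \<Rightarrow> ('g \<Rightarrow> 's \<Rightarrow> 's) \<Rightarrow> 'g set \<Rightarrow> 's \<Rightarrow> 's"
  where "transfer S G \<phi> H x = (\<Oplus>\<^bsub>S\<^esub>C\<in>lcosets\<^bsub>G\<^esub> H. \<phi> (SOME g. g \<in> C) x)"

definition p_index_subgroups :: "nat \<Rightarrow> ('g, 'l) monoid_scheme \<Rightarrow> 'g set set"
  where "p_index_subgroups p G = {H. subgroup H G \<and> p dvd card (lcosets\<^bsub>G\<^esub> H)}"

definition brauer_ideal ::
    "nat \<Rightarrow> ('s, 'n) ring_scheme \<Rightarrow> ('g, 'l) monoid_scheme \<Rightarrow> ('g \<Rightarrow> 's \<Rightarrow> 's) \<Rightarrow> 's set"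
  where "brauer_ideal p S G \<phi> =
    {(\<Oplus>\<^bsub>S\<^esub>H\<in>p_index_subgroups p G. transfer S G \<phi> H (x H)) | x.
       \<forall>H\<in>p_index_subgroups p G. x H \<in> fixed_points S \<phi> H}"

definition brauer_quotient ::
    "nat \<Rightarrow> ('s, 'n) ring_scheme \<Rightarrow> ('g, 'l) monoid_scheme \<Rightarrow> ('g \<Rightarrow> 's \<Rightarrow> 's) \<Rightarrow> 's set ring"
  where "brauer_quotient p S G \<phi> =
    invariant_ring S \<phi> (carrier G) Quot brauer_ideal p S G \<phi>"

section \<open>The quotient by the homomorphisms that are not split injective\<close>

text \<open>A \<open>kG\<close>-module is given by a \<open>k\<close>-module together with an action of \<open>G\<close> on it.\<close>

definition kG_hom ::
    "('k, 'm) ring_scheme \<Rightarrow> ('g, 'l) monoid_scheme \<Rightarrow>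
     ('k, 'a, 'n) module_scheme \<Rightarrow> ('g \<Rightarrow> 'a \<Rightarrow> 'a) \<Rightarrow>
     ('k, 'b, 'o) module_scheme \<Rightarrow> ('g \<Rightarrow> 'b \<Rightarrow> 'b) \<Rightarrow> ('a \<Rightarrow> 'b) set"
  where "kG_hom k G M \<alpha> N \<beta> = {h \<in> carrier M \<rightarrow> carrier N.
     (\<forall>x\<in>carrier M. \<forall>y\<in>carrier M. h (x \<oplus>\<^bsub>M\<^esub> y) = h x \<oplus>\<^bsub>N\<^esub> h y) \<and>
     (\<forall>a\<in>carrier k. \<forall>x\<in>carrier M. h (a \<odot>\<^bsub>M\<^esub> x) = a \<odot>\<^bsub>N\<^esub> h x) \<and>
     (\<forall>g\<in>carrier G. \<forall>x\<in>carrier M. h (\<alpha> g x) = \<beta> g (h x))}"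

definition split_injective ::
    "('k, 'm) ring_scheme \<Rightarrow> ('g, 'l) monoid_scheme \<Rightarrow>
     ('k, 'a, 'n) module_scheme \<Rightarrow> ('g \<Rightarrow> 'a \<Rightarrow> 'a) \<Rightarrow>
     ('k, 'b, 'o) module_scheme \<Rightarrow> ('g \<Rightarrow> 'b \<Rightarrow> 'b) \<Rightarrow> ('a \<Rightarrow> 'b) \<Rightarrow> bool"
  where "split_injective k G M \<alpha> N \<beta> h \<longleftrightarrow>
    h \<in> kG_hom k G M \<alpha> N \<beta> \<and> (\<exists>r\<in>kG_hom k G N \<beta> M \<alpha>. \<forall>x\<in>carrier M. r (h x) = x)"

definition regular_module :: "('k, 'm) ring_scheme \<Rightarrow> ('k, 'k) module"
  where "regular_module k = \<lparr>carrier = carrier k, monoid.mult = monoid.mult k, one = \<one>\<^bsub>k\<^esub>,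
    ring.zero = \<zero>\<^bsub>k\<^esub>, add = add k, smult = monoid.mult k\<rparr>"

abbreviation trivial_action :: "'g \<Rightarrow> 'a \<Rightarrow> 'a"
  where "trivial_action \<equiv> \<lambda>g x. x"

text \<open>A homomorphism \<open>h\<close> from the trivial module \<open>k\<close> to \<open>S\<close> is identified with the invariant
  element \<open>h 1\<close> of \<open>S\<close>.\<close>

definition nonsplit_ideal ::
    "('k, 'm) ring_scheme \<Rightarrow> ('k, 's, 'n) module_scheme \<Rightarrow> ('g, 'l) monoid_scheme \<Rightarrow>
     ('g \<Rightarrow> 's \<Rightarrow> 's) \<Rightarrow> 's set"
  where "nonsplit_ideal k S G \<phi> =
    {h \<one>\<^bsub>k\<^esub> | h. h \<in> kG_hom k G (regular_module k) trivial_action S \<phi> \<and>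
       \<not> split_injective k G (regular_module k) trivial_action S \<phi> h}"

definition trivial_summand_ring ::
    "('k, 'm) ring_scheme \<Rightarrow> ('k, 's, 'n) module_scheme \<Rightarrow> ('g, 'l) monoid_scheme \<Rightarrow>
     ('g \<Rightarrow> 's \<Rightarrow> 's) \<Rightarrow> 's set ring"
  where "trivial_summand_ring k S G \<phi> =
    invariant_ring S \<phi> (carrier G) Quot nonsplit_ideal k S G \<phi>"

section \<open>Spectra and their fixed points\<close>

definition prime_spectrum :: "('a, 'm) ring_scheme \<Rightarrow> 'a set set"
  where "prime_spectrum R = {J. primeideal J R}"

definition zariski :: "('a, 'm) ring_scheme \<Rightarrow> 'a set topology"
  where "zariski R =
    topology (\<lambda>U. \<exists>A\<subseteq>carrier R. U = {J \<in> prime_spectrum R. \<not> A \<subseteq> J})"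

lemma openin_zariski:
  "openin (zariski R) U \<longleftrightarrow> (\<exists>A\<subseteq>carrier R. U = {J \<in> prime_spectrum R. \<not> A \<subseteq> J})"
proof -
  let ?D = "\<lambda>A. {J \<in> prime_spectrum R. \<not> A \<subseteq> J}"
  have "istopology (\<lambda>U. \<exists>A\<subseteq>carrier R. U = ?D A)"
    unfolding istopology_def
  proof (intro conjI allI impI)
    fix U V assume "\<exists>A\<subseteq>carrier R. U = ?D A" "\<exists>A\<subseteq>carrier R. V = ?D A"
    then obtain A B where A: "A \<subseteq> carrier R" "U = ?D A" and B: "B \<subseteq> carrier R" "V = ?D B"
      by blast
    let ?AB = "{a \<otimes>\<^bsub>R\<^esub> b | a b. a \<in> A \<and> b \<in> B} \<inter> carrier R"
    have AB_iff: "?AB \<subseteq> J \<longleftrightarrow> A \<subseteq> J \<or> B \<subseteq> J" if "primeideal J R" for J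
    proof -
      interpret primeideal J R by fact
      show ?thesis
      proof
        assume AB: "?AB \<subseteq> J"
        have "a \<in> J \<or> b \<in> J" if "a \<in> A" "b \<in> B" for a b
        proof -
          have ab: "a \<in> carrier R" "b \<in> carrier R" using that A(1) B(1) by auto
          then have "a \<otimes>\<^bsub>R\<^esub> b \<in> ?AB" using that by auto
          with AB have "a \<otimes>\<^bsub>R\<^esub> b \<in> J" by (rule subsetD)
          then show ?thesis using I_prime ab by simp
        qed
        then show "A \<subseteq> J \<or> B \<subseteq> J" by (meson subsetI)
      next
        assume AB: "A \<subseteq> J \<or> B \<subseteq> J"
        show "?AB \<subseteq> J"
        proof
          fix x assume "x \<in> ?AB"
          then obtain a b where x: "x = a \<otimes>\<^bsub>R\<^esub> b" "a \<in> A" "b \<in> B" by auto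
          then have "a \<in> carrier R" "b \<in> carrier R" using A(1) B(1) by auto
          moreover have "a \<in> J \<or> b \<in> J" using AB x by auto
          ultimately show "x \<in> J" using I_l_closed I_r_closed x(1) by auto
        qed
      qed
    qed
    have "U \<inter> V = ?D ?AB"
    proof (rule Set.set_eqI)
      fix J
      show "J \<in> U \<inter> V \<longleftrightarrow> J \<in> ?D ?AB"
        unfolding A(2) B(2) prime_spectrum_def Int_iff mem_Collect_eq
        using AB_iff[of J] by argo
    qed
    then show "\<exists>A\<subseteq>carrier R. U \<inter> V = ?D A" by blast
  next
    fix \<U> assume "\<forall>U\<in>\<U>. \<exists>A\<subseteq>carrier R. U = ?D A"
    then obtain f where f: "\<And>U. U \<in> \<U> \<Longrightarrow> f U \<subseteq> carrier R \<and> U = ?D (f U)"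
      by metis
    have "\<Union>\<U> = ?D (\<Union>U\<in>\<U>. f U)"
    proof (intro Set.set_eqI iffI)
      fix J assume "J \<in> \<Union>\<U>"
      then obtain U where "U \<in> \<U>" "J \<in> U" by blast
      then show "J \<in> ?D (\<Union>U\<in>\<U>. f U)" using f[of U] by blast
    next
      fix J assume "J \<in> ?D (\<Union>U\<in>\<U>. f U)"
      then obtain U where "U \<in> \<U>" "J \<in> ?D (f U)" by blast
      then show "J \<in> \<Union>\<U>" using f[of U] by blast
    qed
    moreover have "(\<Union>U\<in>\<U>. f U) \<subseteq> carrier R" using f by blast
    ultimately show "\<exists>A\<subseteq>carrier R. \<Union>\<U> = ?D A" by blast
  qed
  then show ?thesis
    unfolding zariski_def by (simp add: topology_inverse')
qed

definition fixed_primes :: "('s, 'n) ring_scheme \<Rightarrow> ('g \<Rightarrow> 's \<Rightarrow> 's) \<Rightarrow> 'g set \<Rightarrow> 's set set"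
  where "fixed_primes S \<phi> P = {J \<in> prime_spectrum S.
     (\<forall>g\<in>P. \<phi> g ` J = J) \<and>
     (\<forall>g\<in>P. \<forall>s\<in>carrier S. J +>\<^bsub>S\<^esub> \<phi> g s = J +>\<^bsub>S\<^esub> s)}"

definition fixed_spectrum :: "('s, 'n) ring_scheme \<Rightarrow> ('g \<Rightarrow> 's \<Rightarrow> 's) \<Rightarrow> 'g set \<Rightarrow> 's set topology"
  where "fixed_spectrum S \<phi> P = subtopology (zariski S) (fixed_primes S \<phi> P)"

definition orbit_space :: "'a topology \<Rightarrow> ('g, 'l) monoid_scheme \<Rightarrow> ('g \<Rightarrow> 'a \<Rightarrow> 'a) \<Rightarrow> 'a set topology"
  where "orbit_space T G \<alpha> = topology (\<lambda>U. U \<subseteq> orbits G (topspace T) \<alpha> \<and>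
     openin T {x \<in> topspace T. orbit G \<alpha> x \<in> U})"

lemma openin_orbit_space:
  "openin (orbit_space T G \<alpha>) U \<longleftrightarrow>
     U \<subseteq> orbits G (topspace T) \<alpha> \<and> openin T {x \<in> topspace T. orbit G \<alpha> x \<in> U}"
proof -
  have "istopology (\<lambda>U. U \<subseteq> orbits G (topspace T) \<alpha> \<and>
     openin T {x \<in> topspace T. orbit G \<alpha> x \<in> U})"
    unfolding istopology_def
  proof (intro conjI allI impI)
    fix U V
    assume U: "U \<subseteq> orbits G (topspace T) \<alpha> \<and> openin T {x \<in> topspace T. orbit G \<alpha> x \<in> U}"
      and V: "V \<subseteq> orbits G (topspace T) \<alpha> \<and> openin T {x \<in> topspace T. orbit G \<alpha> x \<in> V}"
    then show "U \<inter> V \<subseteq> orbits G (topspace T) \<alpha>" by blast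
    have "openin T ({x \<in> topspace T. orbit G \<alpha> x \<in> U} \<inter> {x \<in> topspace T. orbit G \<alpha> x \<in> V})"
      using U V by (simp add: openin_Int)
    then show "openin T {x \<in> topspace T. orbit G \<alpha> x \<in> U \<inter> V}"
      by (rule back_subst[where P = "openin T"]) blast
  next
    fix \<U>
    assume U: "\<forall>U\<in>\<U>. U \<subseteq> orbits G (topspace T) \<alpha> \<and>
      openin T {x \<in> topspace T. orbit G \<alpha> x \<in> U}"
    then show "\<Union>\<U> \<subseteq> orbits G (topspace T) \<alpha>" by blast
    have "openin T (\<Union>U\<in>\<U>. {x \<in> topspace T. orbit G \<alpha> x \<in> U})"
      using U by blast
    then show "openin T {x \<in> topspace T. orbit G \<alpha> x \<in> \<Union>\<U>}"
      by (rule back_subst[where P = "openin T"]) blast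
  qed
  then show ?thesis
    unfolding orbit_space_def by (simp add: topology_inverse')
qed

lemma topspace_orbit_space: "topspace (orbit_space T G \<alpha>) = orbits G (topspace T) \<alpha>"
proof -
  have "{x \<in> topspace T. orbit G \<alpha> x \<in> orbits G (topspace T) \<alpha>} = topspace T"
    by (auto simp: orbits_def)
  then have "openin (orbit_space T G \<alpha>) (orbits G (topspace T) \<alpha>)"
    by (simp add: openin_orbit_space)
  then show ?thesis
    by (meson openin_orbit_space openin_subset openin_topspace subset_antisym)
qed

lemma quotient_map_orbit_space: "quotient_map T (orbit_space T G \<alpha>) (orbit G \<alpha>)"
  unfolding quotient_map_def topspace_orbit_space openin_orbit_space
  by (auto simp: orbits_def)

definition fixed_spectrum_mod_normalizer ::
    "('s, 'n) ring_scheme \<Rightarrow> ('g, 'l) monoid_scheme \<Rightarrow> ('g \<Rightarrow> 's \<Rightarrow> 's) \<Rightarrow> 'g set \<Rightarrow> 's set set topology"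
  where "fixed_spectrum_mod_normalizer S G \<phi> P =
    orbit_space (fixed_spectrum S \<phi> P) (G\<lparr>carrier := normalizer G P\<rparr>) (\<lambda>g J. \<phi> g ` J)"

section \<open>Dimension\<close>

text \<open>The value is \<open>\<infinity>\<close> if there are arbitrarily long chains, and \<open>-\<infinity>\<close> (the supremum of the empty
  set) if there is no chain at all, i.e. for the zero ring and the empty space.\<close>

definition chain_dim :: "'a set set \<Rightarrow> ereal"
  where "chain_dim \<C> =
    (SUP n\<in>{n::nat. \<exists>c. (\<forall>i\<le>n. c i \<in> \<C>) \<and> (\<forall>i<n. c i \<subset> c (Suc i))}. ereal (real n))"

definition krull_dim :: "('a, 'm) ring_scheme \<Rightarrow> ereal"
  where "krull_dim R = chain_dim (prime_spectrum R)"

definition irreducible_closedin :: "'a topology \<Rightarrow> 'a set \<Rightarrow> bool"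
  where "irreducible_closedin T C \<longleftrightarrow> closedin T C \<and> C \<noteq> {} \<and>
    (\<forall>A B. closedin T A \<and> closedin T B \<and> C = A \<union> B \<longrightarrow> C = A \<or> C = B)"

definition topological_dim :: "'a topology \<Rightarrow> ereal"
  where "topological_dim T = chain_dim {C. irreducible_closedin T C}"

end

theory Submission
  imports Defs
begin

text \<open>
Let \<open>R = S\<^sup>G\<close>, let \<open>X = Spec(S)\<^sup>P\<close>, and for a prime \<open>Q\<close> of \<open>S\<close> let
\<open>D(Q) = {g. gs - s \<in> Q for all s}\<close> be its inertia group, so that \<open>Q \<in> X\<close> exactly when
\<open>P \<subseteq> D(Q)\<close>. Both rings of the theorem are quotients \<open>R/I\<close>, where \<open>I\<close> is the Brauer ideal \<open>B\<close> or
the ideal \<open>J\<close> of invariants \<open>x\<close> for which \<open>k \<rightarrow> S\<close>, \<open>1 \<mapsto> x\<close>, does not split. An invariant lies in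
\<open>J\<close> exactly when all \<open>G\<close>-invariant linear functionals \<open>S \<rightarrow> k\<close> vanish on it. On the transfer of \<open>y\<close>
from \<open>H\<close> such a functional takes \<open>|G:H|\<close> times its value at \<open>y\<close>, which is zero if \<open>p\<close> divides
\<open>|G:H|\<close>; hence \<open>B \<subseteq> J\<close>. The heart of the proof is that the
contraction \<open>Q \<mapsto> Q \<inter> R\<close> maps \<open>X\<close> onto the closed set of \<open>Spec(R)\<close> defined by \<open>B\<close>, and onto
the one defined by \<open>J\<close>. As \<open>B \<subseteq> J\<close>, two statements suffice.

\<^item> If \<open>Q \<in> X\<close> then \<open>J \<subseteq> Q\<close> (\<open>nonsplit_subset_prime\<close>). Given an invariant \<open>x \<notin> Q\<close>, choose a linear
functional on \<open>S\<close> that vanishes on \<open>Q\<close> and is \<open>1\<close> at \<open>x\<close>. It is \<open>P\<close>-invariant because \<open>P\<close> acts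
trivially on \<open>S/Q\<close>. Its sum over the cosets of \<open>P\<close> is a \<open>G\<close>-invariant functional with value
\<open>|G:P| \<noteq> 0\<close> at \<open>x\<close>, so \<open>x \<notin> J\<close>.

\<^item> If \<open>B \<subseteq> Q\<close> then \<open>p\<close> does not divide \<open>|G:D(Q)|\<close> (\<open>brauer_ideal_imp_inertia_index\<close>), so that by
Sylow's theorem \<open>D(Q)\<close> contains a conjugate of \<open>P\<close> and some translate of \<open>Q\<close> is in \<open>X\<close>. Suppose that
\<open>p\<close> divides the index and let \<open>H\<close> be a Sylow \<open>p\<close>-subgroup of \<open>D(Q)\<close>. Choose \<open>a\<close> outside \<open>Q\<close> but
in every other translate of \<open>Q\<close>. For \<open>b \<in> S\<close> the norm of \<open>ab\<close> over \<open>H\<close> is fixed by \<open>H\<close>, and modulo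
\<open>Q\<close> its transfer to \<open>G\<close> is the sum of \<open>g(ab)\<close> to the power \<open>|H|\<close>, taken over the cosets of \<open>H\<close>.
This is a combination of multiplicative characters of \<open>b\<close>. Because \<open>|H|\<close> is a power of \<open>p\<close>, the
characters that equal the one of the trivial coset are those with \<open>g \<in> D(Q)\<close>; the sum of their
coefficients is \<open>|D(Q):H|\<close> times a power of \<open>a\<close>, which is not in \<open>Q\<close>. By Dedekind's independence of
characters some transfer is not in \<open>Q\<close>.

The rest is the theory of integral extensions for \<open>R \<subseteq> S\<close>. Lying over and going up
(\<open>exists_prime_over\<close>) show that \<open>X \<rightarrow> Spec(R/I)\<close> is a continuous closed surjection, hence a quotient
map (\<open>contract_quotient_map\<close>). Two points of a fibre are conjugate under \<open>G\<close> by prime avoidance, and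
then under \<open>N\<^sub>G(P)\<close> by Sylow's theorem in the inertia group (\<open>normalizer_conjugates_fixed_primes\<close>);
hence \<open>Spec(R/I)\<close> and \<open>X/N\<^sub>G(P)\<close> are quotients of \<open>X\<close> with the same fibres. For the dimension,
chains of primes in \<open>X\<close> contract to strict chains, chains in \<open>Spec(R/I)\<close> lift by going up, and
irreducible closed subsets of \<open>X\<close> have generic points.
\<close>

section \<open>Finite p-groups and Sylow subgroups\<close>

text \<open>Orbits have \<open>p\<close>-power length, so if there were no fixed point then \<open>p\<close> would divide \<open>card E\<close>.\<close>

lemma (in group_action) p_group_fixed_point:
  assumes fin: "finite E" and p: "normalization_semidom_class.prime p"
    and ord: "order G = p ^ n" and nd: "\<not> p dvd card E"
  shows "\<exists>x\<in>E. \<forall>g\<in>carrier G. \<phi> g x = x"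
proof (rule ccontr)
  assume no_fixed: "\<not> ?thesis"
  have "p dvd card orb" if orb: "orb \<in> orbits G E \<phi>" for orb
  proof -
    obtain x where x: "x \<in> E" "orb = orbit G \<phi> x"
      using orb by (auto simp: orbits_def)
    have "card orb dvd p ^ n"
      using orbit_stabilizer_theorem[OF x(1)] x(2) ord by (metis dvd_triv_left)
    moreover have "card orb \<noteq> 1"
    proof
      assume "card orb = 1"
      then obtain y where y: "orb = {y}" by (auto simp: card_1_singleton_iff)
      have "x \<in> orb" using orbit_refl[OF x(1)] x(2) by simp
      with y have "orb = {x}" by simp
      then have "\<forall>g\<in>carrier G. \<phi> g x = x" using x(2) by (auto simp: orbit_def)
      with no_fixed x(1) show False by blast
    qed
    ultimately show ?thesis
      using p by (metis divides_primepow_nat dvd_power not_gr0 power_0)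
  qed
  then have "p dvd (\<Sum>orb\<in>orbits G E \<phi>. card orb)"
    by (rule dvd_sum)
  moreover have "(\<Sum>orb\<in>orbits G E \<phi>. card orb) = card E"
    using disjoint_sum[OF fin, of "\<lambda>_. 1::nat"] by simp
  ultimately show False using nd by simp
qed

lemma (in group) l_coset_mem:
  "\<lbrakk>subgroup H G; a \<in> carrier G; x \<in> carrier G\<rbrakk> \<Longrightarrow> x \<in> a <# H \<longleftrightarrow> inv a \<otimes> x \<in> H"
  using subgroup.lcos_module_imp[OF _ is_group] subgroup.lcos_module_rev[OF _ is_group] by blast

lemma (in group) translation_of_lcosets:
  assumes H: "subgroup H G" and x: "x \<in> carrier G"
  shows "bij_betw (\<lambda>C. x <# C) (lcosets H) (lcosets H)"
proof -
  have sub: "C \<subseteq> carrier G" if "C \<in> lcosets H" for C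
    using subgroup.lcosets_carrier[OF H is_group that] .
  have img: "y <# C \<in> lcosets H" if C: "C \<in> lcosets H" and y: "y \<in> carrier G" for C y
  proof -
    obtain a where "a \<in> carrier G" "C = a <# H" using C by (auto simp: LCOSETS_def)
    then have "y <# C = (y \<otimes> a) <# H" "y \<otimes> a \<in> carrier G"
      using y subgroup.subset[OF H] by (simp_all add: lcos_m_assoc)
    then show ?thesis by (auto simp: LCOSETS_def)
  qed
  show ?thesis
  proof (rule bij_betwI[where g = "\<lambda>C. inv x <# C"])
    show "(\<lambda>C. x <# C) \<in> lcosets H \<rightarrow> lcosets H" "(\<lambda>C. inv x <# C) \<in> lcosets H \<rightarrow> lcosets H"
      using img x by auto
    show "inv x <# (x <# C) = C" "x <# (inv x <# C) = C" if "C \<in> lcosets H" for C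
      using sub[OF that] x by (simp_all add: lcos_m_assoc lcos_mult_one)
  qed
qed

text \<open>The general form of Sylow's second theorem: \<open>H\<close> permutes the cosets of \<open>K\<close> by left multiplication,
and a fixed coset \<open>gK\<close> is one with \<open>g\<^sup>-\<^sup>1Hg \<subseteq> K\<close>. It is used for \<open>K\<close> an inertia group and for
\<open>K\<close> a second Sylow subgroup.\<close>

lemma (in group) p_subgroup_conjugate_into:
  assumes fin: "finite (carrier G)" and p: "normalization_semidom_class.prime p"
    and H: "subgroup H G" and cH: "card H = p ^ n"
    and K: "subgroup K G" and nd: "\<not> p dvd card (lcosets K)"
  shows "\<exists>g\<in>carrier G. \<forall>h\<in>H. inv g \<otimes> h \<otimes> g \<in> K"
proof -
  let ?E = "lcosets K" and ?H = "G\<lparr>carrier := H\<rparr>"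
  let ?\<psi> = "\<lambda>h. restrict (\<lambda>C. h <# C) ?E"
  have Hc: "h \<in> carrier G" if "h \<in> H" for h using subgroup.mem_carrier[OF H that] .
  have sub: "C \<subseteq> carrier G" if "C \<in> ?E" for C
    using subgroup.lcosets_carrier[OF K is_group that] .
  have bij: "?\<psi> h \<in> Bij ?E" if "h \<in> H" for h
    using translation_of_lcosets[OF K Hc[OF that]] by (auto simp: Bij_def)
  have "?\<psi> (h1 \<otimes> h2) = compose ?E (?\<psi> h1) (?\<psi> h2)" if "h1 \<in> H" "h2 \<in> H" for h1 h2
  proof
    fix C
    show "?\<psi> (h1 \<otimes> h2) C = compose ?E (?\<psi> h1) (?\<psi> h2) C"
      using that Hc sub[of C] translation_of_lcosets[OF K Hc[OF that(2)]]
      by (auto simp: compose_def lcos_m_assoc bij_betw_def)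
  qed
  then have "?\<psi> \<in> hom ?H (BijGroup ?E)"
    using bij by (auto simp: hom_def BijGroup_def)
  then have "group_action ?H ?E ?\<psi>"
    using subgroup.subgroup_is_group[OF H is_group] group_BijGroup
    by (auto simp: group_action_def group_hom_def group_hom_axioms_def)
  then interpret act: group_action ?H ?E ?\<psi> .
  have "finite ?E"
    using fin by (auto simp: LCOSETS_def)
  then obtain C where C: "C \<in> ?E" "\<forall>h\<in>H. ?\<psi> h C = C"
    using act.p_group_fixed_point[of p n] p cH nd by (auto simp: order_def)
  obtain g where g: "g \<in> carrier G" "C = g <# K" using C(1) by (auto simp: LCOSETS_def)
  have "inv g \<otimes> h \<otimes> g \<in> K" if h: "h \<in> H" for h
  proof -
    have "h <# (g <# K) = g <# K" using C g h by auto
    then have "(h \<otimes> g) <# K = g <# K"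
      using g Hc[OF h] subgroup.subset[OF K] by (simp add: lcos_m_assoc)
    then have "h \<otimes> g \<in> g <# K"
      using lcos_self[of "h \<otimes> g" K] K g Hc[OF h] by auto
    then show ?thesis
      using l_coset_mem[OF K g(1), of "h \<otimes> g"] g Hc[OF h] by (simp add: m_assoc)
  qed
  with g(1) show ?thesis by blast
qed

lemma (in group) card_lcosets_subgroup:
  assumes fin: "finite (carrier G)" and H: "subgroup H G" and K: "subgroup K G" and HK: "H \<subseteq> K"
  shows "card (lcosets H) = card (lcosets K) * (card K div card H)" "card H dvd card K"
proof -
  interpret K: group "G\<lparr>carrier := K\<rparr>" using subgroup.subgroup_is_group[OF K is_group] .
  have finK: "finite K" using fin subgroup.subset[OF K] finite_subset by blast
  have "subgroup H (G\<lparr>carrier := K\<rparr>)" using subgroup_incl[OF H K HK] .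
  from K.lagrange_finite[OF _ this] finK have dv: "card (rcosets\<^bsub>G\<lparr>carrier := K\<rparr>\<^esub> H) * card H = card K"
    by (simp add: order_def)
  then show "card H dvd card K" by (metis dvd_triv_right)
  have pos: "card H > 0" using subgroup.finite_imp_card_positive[OF H fin] .
  have "card (lcosets H) * card H = card (lcosets K) * card K"
    using l_lagrange[OF fin H] l_lagrange[OF fin K] by simp
  also have "\<dots> = card (lcosets K) * (card K div card H) * card H"
    using \<open>card H dvd card K\<close> by (simp add: mult.assoc)
  finally show "card (lcosets H) = card (lcosets K) * (card K div card H)"
    using pos by simp
qed

lemma (in group) exists_sylow_subgroup:
  assumes fin: "finite (carrier G)" and p: "normalization_semidom_class.prime p" and K: "subgroup K G"
  obtains H n where "subgroup H G" "H \<subseteq> K" "card H = p ^ n" "\<not> p dvd card K div card H"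
proof -
  interpret K: group "G\<lparr>carrier := K\<rparr>" using subgroup.subgroup_is_group[OF K is_group] .
  have finK: "finite K" using fin subgroup.subset[OF K] finite_subset by blast
  have pos: "card K \<noteq> 0" using subgroup.finite_imp_card_positive[OF K fin] by simp
  define n where "n = multiplicity p (card K)"
  have npu: "\<not> is_unit p" using p by auto
  obtain m where m: "card K = p ^ n * m" "\<not> p dvd m"
    using multiplicity_decompose'[OF pos npu] n_def by metis
  obtain H where H: "subgroup H (G\<lparr>carrier := K\<rparr>)" "card H = p ^ n"
    using sylow_thm[of p "G\<lparr>carrier := K\<rparr>" n m] p K.is_group m finK by (auto simp: order_def)
  have "subgroup H G" using incl_subgroup[OF K H(1)] .
  moreover have "H \<subseteq> K" using subgroup.subset[OF H(1)] by simp
  moreover have "card K div card H = m" using m H(2) p by (simp add: prime_gt_0_nat)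
  ultimately show ?thesis using that H(2) m(2) by blast
qed

section \<open>Sums over cosets\<close>

lemma (in group) lcoset_some_carrier:
  assumes H: "subgroup H G" and C: "C \<in> lcosets H"
  shows "(SOME g. g \<in> C) \<in> C" "(SOME g. g \<in> C) \<in> carrier G"
proof -
  obtain a where "a \<in> carrier G" "C = a <# H" using C by (auto simp: LCOSETS_def)
  then have "a \<in> C" using lcos_self H by blast
  then show "(SOME g. g \<in> C) \<in> C" by (rule someI)
  then show "(SOME g. g \<in> C) \<in> carrier G" using subgroup.lcosets_carrier[OF H is_group C] by blast
qed

lemma (in group) lcoset_representative:
  assumes H: "subgroup H G" and f: "\<And>g h. \<lbrakk>g \<in> carrier G; h \<in> H\<rbrakk> \<Longrightarrow> f (g \<otimes> h) = f g"
    and C: "C \<in> lcosets H" and g: "g \<in> C"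
  shows "f (SOME g. g \<in> C) = f g"
proof -
  obtain a where a: "a \<in> carrier G" "C = a <# H" using C by (auto simp: LCOSETS_def)
  have "f x = f a" if "x \<in> C" for x
    using that a f by (auto simp: l_coset_def)
  then show ?thesis using g by (metis someI)
qed

text \<open>The cosets of \<open>H\<close> that lie in \<open>D\<close> are the cosets of \<open>H\<close> in the group \<open>D\<close>.\<close>

lemma (in group) card_representatives_in:
  assumes fin: "finite (carrier G)" and H: "subgroup H G" and D: "subgroup D G" and HD: "H \<subseteq> D"
  shows "card {C \<in> lcosets H. (SOME g. g \<in> C) \<in> D} = card D div card H"
proof -
  let ?D = "G\<lparr>carrier := D\<rparr>"
  have gD: "group ?D" using subgroup.subgroup_is_group[OF D is_group] .
  have Hs: "subgroup H ?D" using subgroup_incl[OF H D HD] .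
  have Dc: "D \<subseteq> carrier G" using subgroup.subset[OF D] .
  have finD: "finite D" using finite_subset[OF Dc fin] .
  have "{C \<in> lcosets H. (SOME g. g \<in> C) \<in> D} = lcosets\<^bsub>?D\<^esub> H"
  proof (rule Set.set_eqI)
    fix C
    have sub: "a <# H \<subseteq> D" if "a \<in> D" for a
      using that HD subgroup.m_closed[OF D] by (auto simp: l_coset_def)
    show "C \<in> {C \<in> lcosets H. (SOME g. g \<in> C) \<in> D} \<longleftrightarrow> C \<in> lcosets\<^bsub>?D\<^esub> H"
    proof
      assume "C \<in> {C \<in> lcosets H. (SOME g. g \<in> C) \<in> D}"
      then have C: "C \<in> lcosets H" and s: "(SOME g. g \<in> C) \<in> D" by auto
      obtain a where a: "a \<in> carrier G" "C = a <# H" using C by (auto simp: LCOSETS_def)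
      have "C = (SOME g. g \<in> C) <# H"
        using l_repr_independence[OF _ a(1) H] lcoset_some_carrier(1)[OF H C] a(2) by simp
      then show "C \<in> lcosets\<^bsub>?D\<^esub> H" using s by (auto simp: LCOSETS_def l_coset_def)
    next
      assume "C \<in> lcosets\<^bsub>?D\<^esub> H"
      then obtain a where a: "a \<in> D" "C = a <# H" by (auto simp: LCOSETS_def l_coset_def)
      then have C: "C \<in> lcosets H" using Dc by (auto simp: LCOSETS_def)
      then show "C \<in> {C \<in> lcosets H. (SOME g. g \<in> C) \<in> D}"
        using lcoset_some_carrier(1)[OF H C] sub[OF a(1)] a(2) by auto
    qed
  qed
  moreover have "card (lcosets\<^bsub>?D\<^esub> H) * card H = card D"
    using group.l_lagrange[OF gD _ Hs] finD by (simp add: order_def)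
  moreover have "card H > 0" using subgroup.finite_imp_card_positive[OF H fin] .
  ultimately show ?thesis by (metis nonzero_mult_div_cancel_right not_gr0)
qed

text \<open>A function that is constant on the cosets of \<open>H\<close> has a well-defined product over them, and left
translation only permutes the factors. In additive notation this makes transfers and averaged
functionals \<open>G\<close>-invariant.\<close>

lemma (in comm_monoid) finprod_lcosets_translate:
  assumes K: "group K" and H: "subgroup H K" and x: "x \<in> carrier K"
    and f: "\<And>g h. \<lbrakk>g \<in> carrier K; h \<in> H\<rbrakk> \<Longrightarrow> f (g \<otimes>\<^bsub>K\<^esub> h) = f g"
    and fc: "f \<in> carrier K \<rightarrow> carrier G"
  shows "(\<Otimes>C\<in>lcosets\<^bsub>K\<^esub> H. f (x \<otimes>\<^bsub>K\<^esub> (SOME g. g \<in> C))) = (\<Otimes>C\<in>lcosets\<^bsub>K\<^esub> H. f (SOME g. g \<in> C))"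
proof -
  interpret K: group K by fact
  let ?L = "lcosets\<^bsub>K\<^esub> H" and ?F = "\<lambda>C. f (SOME g. g \<in> C)"
  note some = K.lcoset_some_carrier(1)[OF H] and some_c = K.lcoset_some_carrier(2)[OF H]
  have bij: "bij_betw (\<lambda>C. x <#\<^bsub>K\<^esub> C) ?L ?L" using K.translation_of_lcosets[OF H x] .
  have F: "?F \<in> ?L \<rightarrow> carrier G" using some_c fc by blast
  have "f (x \<otimes>\<^bsub>K\<^esub> (SOME g. g \<in> C)) = ?F (x <#\<^bsub>K\<^esub> C)" if C: "C \<in> ?L" for C
  proof -
    have "x \<otimes>\<^bsub>K\<^esub> (SOME g. g \<in> C) \<in> x <#\<^bsub>K\<^esub> C" using some[OF C] by (auto simp: l_coset_def)
    moreover have "x <#\<^bsub>K\<^esub> C \<in> ?L" using bij C by (auto simp: bij_betw_def)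
    ultimately show ?thesis using K.lcoset_representative[of H f, OF H f] by metis
  qed
  then have "(\<Otimes>C\<in>?L. f (x \<otimes>\<^bsub>K\<^esub> (SOME g. g \<in> C))) = (\<Otimes>C\<in>?L. ?F (x <#\<^bsub>K\<^esub> C))"
    using F bij by (intro finprod_cong') (auto simp: bij_betw_def)
  also have "\<dots> = finprod G ?F ((\<lambda>C. x <#\<^bsub>K\<^esub> C) ` ?L)"
    using F bij by (intro finprod_reindex[symmetric]) (auto simp: bij_betw_def)
  also have "\<dots> = finprod G ?F ?L" using bij by (simp add: bij_betw_def)
  finally show ?thesis .
qed

lemma finprod_hom:
  assumes M: "comm_monoid M" and N: "comm_monoid N" and f: "f \<in> A \<rightarrow> carrier M"
    and cl: "h \<in> carrier M \<rightarrow> carrier N" and one: "h \<one>\<^bsub>M\<^esub> = \<one>\<^bsub>N\<^esub>"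
    and mult: "\<And>x y. \<lbrakk>x \<in> carrier M; y \<in> carrier M\<rbrakk> \<Longrightarrow> h (x \<otimes>\<^bsub>M\<^esub> y) = h x \<otimes>\<^bsub>N\<^esub> h y"
  shows "h (finprod M f A) = finprod N (\<lambda>i. h (f i)) A"
proof -
  interpret M: comm_monoid M by fact
  interpret N: comm_monoid N by fact
  show ?thesis using f
  proof (induct A rule: infinite_finite_induct)
    case (insert x F)
    then have "f \<in> F \<rightarrow> carrier M" "f x \<in> carrier M" "(\<lambda>i. h (f i)) \<in> F \<rightarrow> carrier N" "h (f x) \<in> carrier N"
      using cl by auto
    with insert mult show ?case by simp
  qed (simp_all add: one)
qed

lemma (in comm_monoid) finprod_group_translate:
  assumes K: "group K" and x: "x \<in> carrier K" and f: "f \<in> carrier K \<rightarrow> carrier G"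
  shows "(\<Otimes>g\<in>carrier K. f (x \<otimes>\<^bsub>K\<^esub> g)) = (\<Otimes>g\<in>carrier K. f g)"
proof -
  interpret K: group K by fact
  have "inj_on (\<lambda>g. x \<otimes>\<^bsub>K\<^esub> g) (carrier K)" using x by (intro inj_onI) simp
  moreover have "(\<lambda>g. x \<otimes>\<^bsub>K\<^esub> g) ` carrier K = carrier K"
    using x K.surj_const_mult by blast
  ultimately show ?thesis using finprod_reindex[of f "\<lambda>g. x \<otimes>\<^bsub>K\<^esub> g" "carrier K"] f by auto
qed

section \<open>Prime ideals in commutative rings\<close>

lemma (in cring) binomial_formula:
  assumes [simp]: "a \<in> carrier R" "b \<in> carrier R"
  shows "(a \<oplus> b) [^] (n::nat) = (\<Oplus>i\<in>{..n}. [(n choose i)] \<cdot> (a [^] i \<otimes> b [^] (n - i)))"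
proof (induction n)
  case (Suc n)
  define t where "t m i = [(m choose i)] \<cdot> (a [^] i \<otimes> b [^] (m - i))" for m i
  have tc [simp]: "t m i \<in> carrier R" for m i by (simp add: t_def)
  have left: "(\<Oplus>i\<in>{..n}. a \<otimes> t n i) = (\<Oplus>i\<in>{..n}. [(n choose i)] \<cdot> (a [^] Suc i \<otimes> b [^] (n - i)))"
    by (intro finsum_cong') (auto simp: t_def add_pow_rdistr nat_pow_Suc m_ac)
  have "b \<otimes> t n i = [(n choose i)] \<cdot> (a [^] i \<otimes> b [^] (Suc n - i))" if "i \<le> n" for i
    using that by (simp add: t_def add_pow_rdistr Suc_diff_le m_ac)
  then have right: "(\<Oplus>i\<in>{..n}. b \<otimes> t n i) = (\<Oplus>i\<in>{..n}. [(n choose i)] \<cdot> (a [^] i \<otimes> b [^] (Suc n - i)))"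
    by (intro finsum_cong') auto
  also have "\<dots> = (\<Oplus>i\<in>{..Suc n}. [(n choose i)] \<cdot> (a [^] i \<otimes> b [^] (Suc n - i)))"
    by (subst finsum_Suc) (auto simp: binomial_eq_0)
  also have "\<dots> = (\<Oplus>i\<in>{..n}. [(n choose Suc i)] \<cdot> (a [^] Suc i \<otimes> b [^] (n - i))) \<oplus> b [^] Suc n"
    by (subst finsum_Suc2) auto
  finally have right: "(\<Oplus>i\<in>{..n}. b \<otimes> t n i) =
    (\<Oplus>i\<in>{..n}. [(n choose Suc i)] \<cdot> (a [^] Suc i \<otimes> b [^] (n - i))) \<oplus> b [^] Suc n" .
  have "(a \<oplus> b) [^] Suc n = (a \<oplus> b) \<otimes> (\<Oplus>i\<in>{..n}. t n i)"
    using Suc.IH by (simp add: t_def m_comm)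
  also have "\<dots> = (\<Oplus>i\<in>{..n}. a \<otimes> t n i) \<oplus> (\<Oplus>i\<in>{..n}. b \<otimes> t n i)"
    by (simp add: l_distr finsum_rdistr)
  also have "\<dots> = (\<Oplus>i\<in>{..n}. [(n choose i)] \<cdot> (a [^] Suc i \<otimes> b [^] (n - i))) \<oplus>
      ((\<Oplus>i\<in>{..n}. [(n choose Suc i)] \<cdot> (a [^] Suc i \<otimes> b [^] (n - i))) \<oplus> b [^] Suc n)"
    by (simp only: left right)
  also have "\<dots> = (\<Oplus>i\<in>{..n}. [(n choose i)] \<cdot> (a [^] Suc i \<otimes> b [^] (n - i)) \<oplus>
      [(n choose Suc i)] \<cdot> (a [^] Suc i \<otimes> b [^] (n - i))) \<oplus> b [^] Suc n"
    by (subst finsum_addf) (auto simp: a_assoc simp del: nat_pow_Suc)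
  also have "\<dots> = (\<Oplus>i\<in>{..n}. t (Suc n) (Suc i)) \<oplus> t (Suc n) 0"
    by (auto simp: t_def add.nat_pow_mult simp del: nat_pow_Suc intro!: arg_cong2[where f = "(\<oplus>)"] finsum_cong')
  also have "\<dots> = (\<Oplus>i\<in>{..Suc n}. t (Suc n) i)"
    by (subst finsum_Suc2) auto
  finally show ?case by (simp only: t_def)
qed simp

text \<open>The binomial coefficients strictly between the ends are divisible by \<open>p\<close>.\<close>

lemma (in cring) freshmans_dream:
  fixes p :: nat
  assumes p: "normalization_semidom_class.prime p" and char: "[p] \<cdot> \<one> = \<zero>"
    and [simp]: "a \<in> carrier R" "b \<in> carrier R"
  shows "(a \<oplus> b) [^] (p ^ n) = a [^] (p ^ n) \<oplus> b [^] (p ^ n)"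
proof (induction n)
  case (Suc n)
  have dream: "(u \<oplus> v) [^] p = u [^] p \<oplus> v [^] p" if [simp]: "u \<in> carrier R" "v \<in> carrier R" for u v
  proof -
    define t where "t i = [(p choose i)] \<cdot> (u [^] i \<otimes> v [^] (p - i))" for i
    have [simp]: "t i \<in> carrier R" for i by (simp add: t_def)
    have zero: "[m] \<cdot> x = \<zero>" if "p dvd m" "x \<in> carrier R" for m x
    proof -
      from \<open>p dvd m\<close> obtain c where c: "m = p * c" by blast
      have "[m] \<cdot> x = [m] \<cdot> (\<one> \<otimes> x)" using that by simp
      also have "\<dots> = ([m] \<cdot> \<one>) \<otimes> x" using that by (subst add_pow_ldistr) auto
      also have "[m] \<cdot> \<one> = [c] \<cdot> ([p] \<cdot> \<one>)" by (simp add: c add.nat_pow_pow mult.commute)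
      finally show ?thesis using that char by simp
    qed
    have "t i = \<zero>" if "0 < i" "i < p" for i
      unfolding t_def using that p by (intro zero dvd_choose_prime) auto
    then have "(\<Oplus>i\<in>{..p}. t i) = (\<Oplus>i\<in>{0,p}. t i)"
      by (intro add.finprod_mono_neutral_cong_right) (auto simp: order.order_iff_strict)
    also have "\<dots> = t 0 \<oplus> t p"
    proof -
      have "p \<noteq> 0" using p by (metis not_prime_0)
      then show ?thesis using finsum_insert[of "{p}" 0 t] by simp
    qed
    finally show ?thesis
      by (simp add: binomial_formula flip: t_def) (simp add: t_def a_comm)
  qed
  show ?case
    using Suc.IH by (simp add: dream mult.commute[of p] flip: nat_pow_pow)
qed simp

context primeideal
begin

lemma pow_mem_imp: "x \<in> carrier R \<Longrightarrow> x [^] (n::nat) \<in> I \<Longrightarrow> x \<in> I"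
proof (induction n)
  case 0
  then show ?case using I_notcarr one_imp_carrier by simp
next
  case (Suc n)
  then show ?case using I_prime[of "x [^] n" x] by auto
qed

lemma finprod_mem_imp:
  assumes "finite A" "f \<in> A \<rightarrow> carrier R" "finprod R f A \<in> I"
  shows "\<exists>i\<in>A. f i \<in> I"
  using assms
proof (induction A rule: finite_induct)
  case empty
  then show ?case using I_notcarr one_imp_carrier by simp
next
  case (insert x F)
  then have "f x \<in> carrier R" "f \<in> F \<rightarrow> carrier R" by auto
  with insert show ?case using I_prime[of "f x" "finprod R f F"] by auto
qed

text \<open>The Frobenius map is injective on the domain \<open>R/I\<close>. This separates the characters
\<open>b \<mapsto> g(b)\<close> to the power \<open>p\<^sup>n\<close> as soon as the maps \<open>g\<close> differ modulo \<open>I\<close>.\<close>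

lemma diff_frobenius_mem_imp:
  fixes p :: nat
  assumes p: "normalization_semidom_class.prime p" and char: "[p] \<cdot> \<one> = \<zero>"
    and uv: "u \<in> carrier R" "v \<in> carrier R" and mem: "u [^] (p ^ n) \<ominus> v [^] (p ^ n) \<in> I"
  shows "u \<ominus> v \<in> I"
proof -
  have "u = (u \<ominus> v) \<oplus> v" using uv by algebra
  then have "u [^] (p ^ n) = (u \<ominus> v) [^] (p ^ n) \<oplus> v [^] (p ^ n)"
    using freshmans_dream[OF p char, of "u \<ominus> v" v n] uv by simp
  then have "u [^] (p ^ n) \<ominus> v [^] (p ^ n) = ((u \<ominus> v) [^] (p ^ n) \<oplus> v [^] (p ^ n)) \<ominus> v [^] (p ^ n)" by simp
  also have "\<dots> = (u \<ominus> v) [^] (p ^ n)"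
    using uv by (simp add: minus_eq a_assoc r_neg)
  finally show ?thesis using mem pow_mem_imp[of "u \<ominus> v" "p ^ n"] uv by simp
qed

text \<open>A product of elements that witness \<open>\<not> J \<subseteq> I\<close> and \<open>\<not> A \<subseteq> I\<close> stays outside the prime \<open>I\<close>.\<close>

lemma exists_in_finite_intersection:
  assumes "finite F" and "\<And>J. J \<in> F \<Longrightarrow> ideal J R \<and> \<not> J \<subseteq> I" and "ideal A R" "\<not> A \<subseteq> I"
  shows "\<exists>y\<in>A. y \<notin> I \<and> (\<forall>J\<in>F. y \<in> J)"
  using assms
proof (induction F rule: finite_induct)
  case empty
  then show ?case by auto
next
  case (insert J F)
  then obtain y where y: "y \<in> A" "y \<notin> I" "\<forall>J\<in>F. y \<in> J" by auto
  obtain z where z: "z \<in> J" "z \<notin> I" using insert.prems(1)[of J] by auto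
  have J: "ideal J R" using insert.prems(1) by auto
  have yz: "y \<in> carrier R" "z \<in> carrier R"
    using y z ideal.Icarr[OF J] ideal.Icarr[OF \<open>ideal A R\<close>] by auto
  have "y \<otimes> z \<in> A" using ideal.I_r_closed[OF \<open>ideal A R\<close>] y yz by auto
  moreover have "y \<otimes> z \<in> J" using ideal.I_l_closed[OF J] z yz by auto
  moreover have "y \<otimes> z \<in> K" if "K \<in> F" for K
    using ideal.I_r_closed[of K R y z] insert.prems(1)[of K] that y yz by auto
  moreover have "y \<otimes> z \<notin> I" using I_prime yz y z by auto
  ultimately show ?case by blast
qed

end

lemma (in ideal) finsum_mem:
  "(\<And>i. i \<in> A \<Longrightarrow> f i \<in> I) \<Longrightarrow> (\<Oplus>i\<in>A. f i) \<in> I"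
proof (induction A rule: infinite_finite_induct)
  case (insert x F)
  then have "f \<in> F \<rightarrow> carrier R" "f x \<in> carrier R" using Icarr by auto
  with insert show ?case by simp
qed simp_all

lemma (in ideal) finsum_diff_mem:
  assumes f: "f \<in> A \<rightarrow> carrier R" and g: "g \<in> A \<rightarrow> carrier R"
    and d: "\<And>i. i \<in> A \<Longrightarrow> f i \<ominus> g i \<in> I"
  shows "(\<Oplus>i\<in>A. f i) \<ominus> (\<Oplus>i\<in>A. g i) \<in> I"
proof -
  have "(\<Oplus>i\<in>A. f i) = (\<Oplus>i\<in>A. (f i \<ominus> g i) \<oplus> g i)"
    using f g by (intro finsum_cong') (auto simp: Pi_def minus_eq a_assoc l_neg)
  also have "\<dots> = (\<Oplus>i\<in>A. f i \<ominus> g i) \<oplus> (\<Oplus>i\<in>A. g i)"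
    using f g by (intro finsum_addf) (auto simp: Pi_def)
  finally have eq: "(\<Oplus>i\<in>A. f i) = (\<Oplus>i\<in>A. f i \<ominus> g i) \<oplus> (\<Oplus>i\<in>A. g i)" .
  have "(u \<oplus> v) \<ominus> v = u" if "u \<in> carrier R" "v \<in> carrier R" for u v
    using that by (simp add: minus_eq a_assoc r_neg)
  moreover have "(\<Oplus>i\<in>A. f i \<ominus> g i) \<in> I" using finsum_mem[OF d] .
  ultimately show ?thesis unfolding eq using g Icarr by simp
qed

lemma (in cring) mult_diff_mem:
  assumes I: "ideal I R" and c: "a \<in> carrier R" "b \<in> carrier R" "u \<in> carrier R" "v \<in> carrier R"
    and d: "a \<ominus> b \<in> I" "u \<ominus> v \<in> I"
  shows "a \<otimes> u \<ominus> b \<otimes> v \<in> I"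
proof -
  have "a \<otimes> u \<ominus> b \<otimes> v = a \<otimes> (u \<ominus> v) \<oplus> (a \<ominus> b) \<otimes> v" using c by algebra
  then show ?thesis
    using ideal.I_l_closed[OF I d(2)] ideal.I_r_closed[OF I d(1)] c
      additive_subgroup.a_closed[OF ideal.axioms(1)[OF I]] by simp
qed

lemma (in cring) finprod_diff_mem:
  assumes I: "ideal I R" and f: "f \<in> A \<rightarrow> carrier R" and g: "g \<in> A \<rightarrow> carrier R"
    and d: "\<And>i. i \<in> A \<Longrightarrow> f i \<ominus> g i \<in> I"
  shows "(\<Otimes>i\<in>A. f i) \<ominus> (\<Otimes>i\<in>A. g i) \<in> I"
  using f g d
proof (induction A rule: infinite_finite_induct)
  case (insert x F)
  then have "f \<in> F \<rightarrow> carrier R" "f x \<in> carrier R" "g \<in> F \<rightarrow> carrier R" "g x \<in> carrier R" by auto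
  with insert mult_diff_mem[OF I, of "f x" "g x"] show ?case by simp
qed (simp_all add: minus_eq r_neg additive_subgroup.zero_closed[OF ideal.axioms(1)[OF I]])

lemma (in cring) pow_diff_mem:
  assumes I: "ideal I R" and "u \<in> carrier R" "v \<in> carrier R" "u \<ominus> v \<in> I"
  shows "u [^] (n::nat) \<ominus> v [^] n \<in> I"
  using assms finprod_diff_mem[OF I, of "\<lambda>_. u" "{..<n}" "\<lambda>_. v"] by (simp add: finprod_const)

lemma (in ideal) mem_diff_imp:
  assumes "x \<in> carrier R" "y \<in> I" "x \<ominus> y \<in> I"
  shows "x \<in> I"
proof -
  have "x = (x \<ominus> y) \<oplus> y" using assms Icarr by (simp add: minus_eq a_assoc l_neg)
  then show ?thesis using assms a_closed additive_subgroup.a_closed[OF additive_subgroup_axioms] by metis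
qed

lemma (in ideal) diff_sym_mem:
  assumes "x \<in> carrier R" "y \<in> carrier R" "x \<ominus> y \<in> I"
  shows "y \<ominus> x \<in> I"
proof -
  have "y \<ominus> x = \<ominus> (x \<ominus> y)" using assms by (simp add: minus_eq minus_add a_comm)
  then show ?thesis using assms by simp
qed

text \<open>Dedekind's independence of characters, modulo a prime and with repeated characters: in a relation
\<open>\<Sum> a\<^sub>i \<tau>\<^sub>i \<equiv> 0\<close> the coefficients of the characters that equal \<open>\<rho>\<close> already sum to zero. The set \<open>E\<close>
indexes the characters equal to \<open>\<rho>\<close> and \<open>B\<close> the others. As in the classical proof, a character \<open>\<tau>\<^sub>j\<close>
is eliminated by subtracting \<open>\<tau>\<^sub>j(y)\<close> times the relation from the relation at \<open>yx\<close>; this multiplies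
the sum over \<open>E\<close> by \<open>\<rho>(y) - \<tau>\<^sub>j(y)\<close>, which is not in the prime for a suitable \<open>y\<close>.\<close>

lemma (in primeideal) equal_characters_coeff_sum:
  assumes "finite B" and "finite E" and "E \<inter> B = {}"
    and \<tau>: "\<And>i y. \<lbrakk>i \<in> E \<union> B; y \<in> carrier R\<rbrakk> \<Longrightarrow> \<tau> i y \<in> carrier R"
      "\<And>i. i \<in> E \<union> B \<Longrightarrow> \<tau> i \<one> = \<one>"
      "\<And>i x y. \<lbrakk>i \<in> E \<union> B; x \<in> carrier R; y \<in> carrier R\<rbrakk> \<Longrightarrow> \<tau> i (x \<otimes> y) = \<tau> i x \<otimes> \<tau> i y"
    and \<rho>: "\<And>y. y \<in> carrier R \<Longrightarrow> \<rho> y \<in> carrier R"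
    and E: "\<And>i y. \<lbrakk>i \<in> E; y \<in> carrier R\<rbrakk> \<Longrightarrow> \<tau> i y \<ominus> \<rho> y \<in> I"
    and B: "\<And>j. j \<in> B \<Longrightarrow> \<exists>y\<in>carrier R. \<rho> y \<ominus> \<tau> j y \<notin> I"
    and a: "a \<in> E \<union> B \<rightarrow> carrier R"
    and dep: "\<And>y. y \<in> carrier R \<Longrightarrow> (\<Oplus>i\<in>E \<union> B. a i \<otimes> \<tau> i y) \<in> I"
  shows "(\<Oplus>i\<in>E. a i) \<in> I"
  using assms
proof (induction B arbitrary: a rule: finite_induct)
  case empty
  have "(\<Oplus>i\<in>E. a i) = (\<Oplus>i\<in>E \<union> {}. a i \<otimes> \<tau> i \<one>)"
    using empty.prems by (intro finsum_cong') (auto simp: Pi_def)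
  then show ?case using empty.prems by simp
next
  case (insert j B)
  let ?A = "E \<union> B"
  have jA: "j \<notin> ?A" "finite ?A" using insert.hyps insert.prems by auto
  have ins: "E \<union> insert j B = insert j ?A" by auto
  have t: "\<tau> i y \<in> carrier R" if "i \<in> insert j ?A" "y \<in> carrier R" for i y
    using insert.prems(3) that by auto
  have ac: "a j \<in> carrier R" "a \<in> ?A \<rightarrow> carrier R" "a \<in> E \<rightarrow> carrier R" using insert.prems by auto
  have terms: "(\<lambda>i. a i \<otimes> \<tau> i y) \<in> ?A \<rightarrow> carrier R" if "y \<in> carrier R" for y
    using that t ac by (auto simp: Pi_def)
  have id1: "s \<oplus> \<ominus> v \<otimes> t = (c \<otimes> (v \<otimes> w) \<oplus> s) \<ominus> v \<otimes> (c \<otimes> w \<oplus> t)"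
    if "s \<in> carrier R" "t \<in> carrier R" "v \<in> carrier R" "w \<in> carrier R" "c \<in> carrier R" for s t v w c
    using that by algebra
  have id2: "c \<otimes> (u \<otimes> w) \<oplus> \<ominus> v \<otimes> (c \<otimes> w) = c \<otimes> (u \<ominus> v) \<otimes> w"
    if "u \<in> carrier R" "v \<in> carrier R" "w \<in> carrier R" "c \<in> carrier R" for u v w c
    using that by algebra
  have id3: "c \<otimes> (u \<ominus> v) \<ominus> c \<otimes> (u' \<ominus> v) = c \<otimes> (u \<ominus> u')"
    if "u \<in> carrier R" "u' \<in> carrier R" "v \<in> carrier R" "c \<in> carrier R" for u u' v c
    using that by algebra
  obtain y where y: "y \<in> carrier R" "\<rho> y \<ominus> \<tau> j y \<notin> I"
    using insert.prems(8)[of j] by auto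
  have ty: "\<tau> j y \<in> carrier R" "\<rho> y \<in> carrier R" using t y insert.prems(6) by auto
  define b where "b i = a i \<otimes> (\<tau> i y \<ominus> \<tau> j y)" for i
  have b: "b \<in> ?A \<rightarrow> carrier R" using ac t y by (auto simp: b_def Pi_def)
  have dep': "(\<Oplus>i\<in>?A. b i \<otimes> \<tau> i x) \<in> I" if x: "x \<in> carrier R" for x
  proof -
    let ?s = "\<Oplus>i\<in>?A. a i \<otimes> \<tau> i (y \<otimes> x)" and ?t = "\<Oplus>i\<in>?A. a i \<otimes> \<tau> i x"
    have st: "?s \<in> carrier R" "?t \<in> carrier R" using terms x y by auto
    have split: "a j \<otimes> \<tau> j z \<oplus> (\<Oplus>i\<in>?A. a i \<otimes> \<tau> i z) \<in> I" if z: "z \<in> carrier R" for z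
      using insert.prems(10)[OF z] jA terms[OF z] ac t z unfolding ins by (subst (asm) finsum_insert) auto
    have "(\<Oplus>i\<in>?A. b i \<otimes> \<tau> i x) = (\<Oplus>i\<in>?A. a i \<otimes> \<tau> i (y \<otimes> x) \<oplus> \<ominus> \<tau> j y \<otimes> (a i \<otimes> \<tau> i x))"
    proof (rule finsum_cong'[OF refl])
      show "(\<lambda>i. a i \<otimes> \<tau> i (y \<otimes> x) \<oplus> \<ominus> \<tau> j y \<otimes> (a i \<otimes> \<tau> i x)) \<in> ?A \<rightarrow> carrier R"
        using terms[of "y \<otimes> x"] terms[of x] x y ty by (auto simp: Pi_def)
      show "b i \<otimes> \<tau> i x = a i \<otimes> \<tau> i (y \<otimes> x) \<oplus> \<ominus> \<tau> j y \<otimes> (a i \<otimes> \<tau> i x)" if i: "i \<in> ?A" for i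
      proof -
        have "\<tau> i (y \<otimes> x) = \<tau> i y \<otimes> \<tau> i x" using insert.prems(5)[of i y x] x y i by auto
        moreover have "a i \<in> carrier R" using ac i by auto
        ultimately show ?thesis unfolding b_def using id2[of "\<tau> i y" "\<tau> j y" "\<tau> i x" "a i"] t i x y ty by simp
      qed
    qed
    also have "\<dots> = ?s \<oplus> (\<Oplus>i\<in>?A. \<ominus> \<tau> j y \<otimes> (a i \<otimes> \<tau> i x))"
      using terms[of "y \<otimes> x"] terms[of x] x y ty by (intro finsum_addf) (auto simp: Pi_def)
    also have "\<dots> = ?s \<oplus> \<ominus> \<tau> j y \<otimes> ?t"
      using terms[of x] x y ty jA by (subst finsum_rdistr) auto
    also have "\<dots> = (a j \<otimes> \<tau> j (y \<otimes> x) \<oplus> ?s) \<ominus> \<tau> j y \<otimes> (a j \<otimes> \<tau> j x \<oplus> ?t)"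
      using id1[of ?s ?t "\<tau> j y" "\<tau> j x" "a j"] st ac t x y insert.prems(5)[of j y x] by simp
    also have "\<dots> \<in> I"
      using split[of "y \<otimes> x"] split[of x] I_l_closed ty x y by (simp add: minus_eq)
    finally show ?thesis .
  qed
  have bE: "(\<Oplus>i\<in>E. b i) \<in> I"
    using insert.prems(1-8) by (intro insert.IH[of b] b dep') auto
  have "(\<Oplus>i\<in>E. a i \<otimes> (\<rho> y \<ominus> \<tau> j y)) \<ominus> (\<Oplus>i\<in>E. b i) \<in> I"
  proof (rule finsum_diff_mem)
    show "(\<lambda>i. a i \<otimes> (\<rho> y \<ominus> \<tau> j y)) \<in> E \<rightarrow> carrier R" using ac ty by (auto simp: Pi_def)
    show "b \<in> E \<rightarrow> carrier R" using b by auto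
    show "a i \<otimes> (\<rho> y \<ominus> \<tau> j y) \<ominus> b i \<in> I" if i: "i \<in> E" for i
    proof -
      have c: "a i \<in> carrier R" "\<tau> i y \<in> carrier R" using ac i t y by auto
      have "\<rho> y \<ominus> \<tau> i y \<in> I" using diff_sym_mem insert.prems(7)[OF i y(1)] c ty by blast
      then show ?thesis unfolding b_def using id3[of "\<rho> y" "\<tau> i y" "\<tau> j y" "a i"] c ty I_l_closed by simp
    qed
  qed
  moreover have "(\<Oplus>i\<in>E. a i \<otimes> (\<rho> y \<ominus> \<tau> j y)) \<in> carrier R"
    using ac ty by (intro finsum_closed) (auto simp: Pi_def)
  ultimately have "(\<Oplus>i\<in>E. a i \<otimes> (\<rho> y \<ominus> \<tau> j y)) \<in> I"
    using mem_diff_imp[OF _ bE] by simp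
  then have "(\<Oplus>i\<in>E. a i) \<otimes> (\<rho> y \<ominus> \<tau> j y) \<in> I"
    using finsum_ldistr[of E "\<rho> y \<ominus> \<tau> j y" a] ac ty insert.prems(1) by simp
  then show ?case using I_prime[of "\<Oplus>i\<in>E. a i" "\<rho> y \<ominus> \<tau> j y"] ac ty y by auto
qed

text \<open>Incomparability allows a direct induction: if \<open>x\<close> avoids all primes but \<open>Q\<close>, add to it an element of
\<open>A\<close> that lies in all of them and not in \<open>Q\<close>. The translates of one prime under a finite group are
incomparable, and only these occur below.\<close>

lemma (in cring) prime_avoidance:
  assumes "finite F" and "\<And>Q. Q \<in> F \<Longrightarrow> primeideal Q R"
    and "\<And>Q Q'. \<lbrakk>Q \<in> F; Q' \<in> F; Q \<subseteq> Q'\<rbrakk> \<Longrightarrow> Q = Q'"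
    and A: "ideal A R" and "\<And>Q. Q \<in> F \<Longrightarrow> \<not> A \<subseteq> Q"
  shows "\<exists>x\<in>A. \<forall>Q\<in>F. x \<notin> Q"
  using assms(1,2,3,5)
proof (induction F rule: finite_induct)
  case empty
  then show ?case using additive_subgroup.zero_closed[OF ideal.axioms(1)[OF A]] by auto
next
  case (insert Q F)
  then obtain x where x: "x \<in> A" "\<forall>Q\<in>F. x \<notin> Q" by auto
  interpret Q: primeideal Q R using insert.prems by auto
  interpret A: ideal A R by fact
  show ?case
  proof (cases "x \<in> Q")
    case True
    have "\<exists>y\<in>A. y \<notin> Q \<and> (\<forall>J\<in>F. y \<in> J)"
    proof (rule Q.exists_in_finite_intersection[OF insert.hyps(1) _ A])
      show "ideal J R \<and> \<not> J \<subseteq> Q" if "J \<in> F" for J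
        using that insert.prems(1)[of J] insert.prems(2)[of J Q] insert.hyps(2) by (auto simp: primeideal_def)
    qed (use insert.prems in auto)
    then obtain y where y: "y \<in> A" "y \<notin> Q" "\<forall>J\<in>F. y \<in> J" by blast
    have xy: "x \<in> carrier R" "y \<in> carrier R" using x y A.Icarr by auto
    have diff: "u \<oplus> v \<in> J \<Longrightarrow> u \<in> J \<Longrightarrow> v \<in> J"
      if "ideal J R" "u \<in> carrier R" "v \<in> carrier R" for J u v
    proof -
      interpret J: ideal J R by fact
      assume "u \<oplus> v \<in> J" "u \<in> J"
      then have "\<ominus> u \<oplus> (u \<oplus> v) \<in> J" by simp
      then show "v \<in> J" using that by (simp add: r_neg1)
    qed
    have "x \<oplus> y \<notin> Q" using diff[of Q x y] xy True y Q.is_ideal by auto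
    moreover have "x \<oplus> y \<notin> J" if "J \<in> F" for J
      using diff[of J y x] xy x y that insert.prems(1)[of J] a_comm[of x y] by (auto simp: primeideal_def)
    ultimately show ?thesis using x y by blast
  qed (use x in auto)
qed

text \<open>An ideal that is maximal among those disjoint from a multiplicative set is prime. The maximality
itself is part of the conclusion, because lying over needs it once more.\<close>

lemma (in cring) maximal_ideal_avoiding:
  assumes A: "ideal A R" and W: "\<one> \<in> W" "W \<subseteq> carrier R" "\<And>u v. \<lbrakk>u \<in> W; v \<in> W\<rbrakk> \<Longrightarrow> u \<otimes> v \<in> W"
    and disj: "A \<inter> W = {}"
  obtains Q where "primeideal Q R" "A \<subseteq> Q" "Q \<inter> W = {}"
    "\<And>x. \<lbrakk>x \<in> carrier R; x \<notin> Q\<rbrakk> \<Longrightarrow> \<exists>a\<in>Q. \<exists>s\<in>carrier R. a \<oplus> x \<otimes> s \<in> W"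
proof -
  let ?C = "{J. ideal J R \<and> A \<subseteq> J \<and> J \<inter> W = {}}"
  have "\<exists>M\<in>?C. \<forall>Y\<in>?C. M \<subseteq> Y \<longrightarrow> Y = M"
  proof (rule subset_Zorn_nonempty)
    show "?C \<noteq> {}" using A disj by auto
    fix \<C> assume ne: "\<C> \<noteq> {}" and ch: "subset.chain ?C \<C>"
    have "subset.chain {I. ideal I R} \<C>" using ch by (auto simp: pred_on.chain_def)
    from chain_Union_is_ideal[OF this] ne have "ideal (\<Union>\<C>) R" by simp
    then show "\<Union>\<C> \<in> ?C" using ch ne by (auto simp: pred_on.chain_def)
  qed
  then obtain Q where QC: "Q \<in> ?C" and maxC: "\<forall>Y\<in>?C. Q \<subseteq> Y \<longrightarrow> Y = Q" by (elim bexE)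
  have Q: "ideal Q R" "A \<subseteq> Q" "Q \<inter> W = {}" using QC by auto
  have max: "Y = Q" if "ideal Y R" "A \<subseteq> Y" "Y \<inter> W = {}" "Q \<subseteq> Y" for Y
    using maxC that by simp
  interpret Q: ideal Q R by fact
  have ext: "\<exists>a\<in>Q. \<exists>s\<in>carrier R. a \<oplus> x \<otimes> s \<in> W" if x: "x \<in> carrier R" "x \<notin> Q" for x
  proof -
    let ?Y = "Q <+>\<^bsub>R\<^esub> PIdl x"
    have id: "ideal ?Y R" using add_ideals[OF Q(1) cgenideal_ideal[OF x(1)]] .
    have Qsub: "Q \<subseteq> ?Y"
    proof
      fix a assume a: "a \<in> Q"
      have "\<zero> \<in> PIdl x" using additive_subgroup.zero_closed[OF ideal.axioms(1)[OF cgenideal_ideal[OF x(1)]]] .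
      then show "a \<in> ?Y" using a Q.Icarr unfolding set_add_def' by force
    qed
    have "\<zero> \<oplus> x \<in> ?Y" unfolding set_add_def' using cgenideal_self[OF x(1)] Q.zero_closed by blast
    then have "?Y \<noteq> Q" using x by auto
    then have "?Y \<inter> W \<noteq> {}" using max[OF id] Qsub Q(2) by blast
    then obtain a s where "a \<in> Q" "s \<in> carrier R" "a \<oplus> s \<otimes> x \<in> W"
      unfolding set_add_def' cgenideal_def by blast
    then show ?thesis using x m_comm[of s x] by auto
  qed
  have "primeideal Q R"
  proof (rule primeidealI[OF Q(1) cring_axioms])
    show "carrier R \<noteq> Q" using W(1,2) Q(3) by blast
    fix x y assume xy: "x \<in> carrier R" "y \<in> carrier R" "x \<otimes> y \<in> Q"
    show "x \<in> Q \<or> y \<in> Q"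
    proof (rule ccontr)
      assume "\<not> ?thesis"
      then obtain a s b t where w: "a \<in> Q" "s \<in> carrier R" "a \<oplus> x \<otimes> s \<in> W"
        "b \<in> Q" "t \<in> carrier R" "b \<oplus> y \<otimes> t \<in> W"
        using ext xy by meson
      have c: "a \<in> carrier R" "b \<in> carrier R" using w Q.Icarr by auto
      have "(a \<oplus> x \<otimes> s) \<otimes> (b \<oplus> y \<otimes> t) = a \<otimes> (b \<oplus> y \<otimes> t) \<oplus> (x \<otimes> s \<otimes> b \<oplus> (x \<otimes> y) \<otimes> (s \<otimes> t))"
        using c w xy by algebra
      also have "\<dots> \<in> Q"
        using c w xy by (intro Q.a_closed Q.I_r_closed[OF w(1)] Q.I_l_closed[OF w(4)] Q.I_r_closed[OF xy(3)]) auto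
      finally show False using W(3)[OF w(3,6)] Q(3) by blast
    qed
  qed
  then show ?thesis using that Q ext by blast
qed

section \<open>Finite groups acting on commutative rings\<close>

locale finite_ring_action = cring S + group_action G "carrier S" \<phi>
  for S :: "('s, 'n) ring_scheme" (structure) and G :: "('g, 'l) monoid_scheme" (structure)
    and \<phi> :: "'g \<Rightarrow> 's \<Rightarrow> 's" +
  assumes finite_group: "finite (carrier G)"
    and act_hom: "g \<in> carrier G \<Longrightarrow> \<phi> g \<in> ring_hom S S"

sublocale finite_ring_action \<subseteq> G: group G
  using group_hom group_hom.axioms(1) by blast

context finite_ring_action
begin

lemma act_closed [simp]: "\<lbrakk>g \<in> carrier G; x \<in> carrier S\<rbrakk> \<Longrightarrow> \<phi> g x \<in> carrier S"
  using act_hom ring_hom_closed by metis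

lemma act_mult: "\<lbrakk>g \<in> carrier G; x \<in> carrier S; y \<in> carrier S\<rbrakk> \<Longrightarrow> \<phi> g (x \<otimes> y) = \<phi> g x \<otimes> \<phi> g y"
  using act_hom ring_hom_mult by metis

lemma act_add: "\<lbrakk>g \<in> carrier G; x \<in> carrier S; y \<in> carrier S\<rbrakk> \<Longrightarrow> \<phi> g (x \<oplus> y) = \<phi> g x \<oplus> \<phi> g y"
  using act_hom ring_hom_add by metis

lemma act_one [simp]: "g \<in> carrier G \<Longrightarrow> \<phi> g \<one> = \<one>"
  using act_hom ring_hom_one by metis

lemma act_ring_hom_cring: "g \<in> carrier G \<Longrightarrow> ring_hom_cring S S (\<phi> g)"
  using act_hom by (simp add: ring_hom_cring_def ring_hom_cring_axioms_def is_cring)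

lemma act_zero [simp]: "g \<in> carrier G \<Longrightarrow> \<phi> g \<zero> = \<zero>"
  using ring_hom_cring.hom_zero[OF act_ring_hom_cring] by blast

lemma act_uminus: "\<lbrakk>g \<in> carrier G; x \<in> carrier S\<rbrakk> \<Longrightarrow> \<phi> g (\<ominus> x) = \<ominus> \<phi> g x"
  using ring_hom_cring.hom_a_inv[OF act_ring_hom_cring] by blast

lemma act_minus: "\<lbrakk>g \<in> carrier G; x \<in> carrier S; y \<in> carrier S\<rbrakk> \<Longrightarrow> \<phi> g (x \<ominus> y) = \<phi> g x \<ominus> \<phi> g y"
  by (simp add: minus_eq act_add act_uminus)

lemma act_finsum: "\<lbrakk>g \<in> carrier G; f \<in> A \<rightarrow> carrier S\<rbrakk> \<Longrightarrow> \<phi> g (\<Oplus>i\<in>A. f i) = (\<Oplus>i\<in>A. \<phi> g (f i))"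
  using ring_hom_cring.hom_finsum[OF act_ring_hom_cring] by (simp add: comp_def)

lemma act_finprod: "\<lbrakk>g \<in> carrier G; f \<in> A \<rightarrow> carrier S\<rbrakk> \<Longrightarrow> \<phi> g (\<Otimes>i\<in>A. f i) = (\<Otimes>i\<in>A. \<phi> g (f i))"
  using ring_hom_cring.hom_finprod[OF act_ring_hom_cring] by (simp add: comp_def)

lemma act_id [simp]: "x \<in> carrier S \<Longrightarrow> \<phi> \<one>\<^bsub>G\<^esub> x = x"
  using id_eq_one by (metis restrict_apply')

lemma act_comp: "\<lbrakk>g \<in> carrier G; h \<in> carrier G; x \<in> carrier S\<rbrakk> \<Longrightarrow> \<phi> (g \<otimes>\<^bsub>G\<^esub> h) x = \<phi> g (\<phi> h x)"
  using composition_rule by blast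

lemma act_inv [simp]:
  assumes "g \<in> carrier G" "x \<in> carrier S"
  shows "\<phi> (inv\<^bsub>G\<^esub> g) (\<phi> g x) = x" "\<phi> g (\<phi> (inv\<^bsub>G\<^esub> g) x) = x"
  using assms by (simp_all flip: act_comp)

abbreviation invariants_set :: "'s set"
  where "invariants_set \<equiv> fixed_points S \<phi> (carrier G)"

abbreviation inv_ring :: "('s, 'n) ring_scheme"
  where "inv_ring \<equiv> invariant_ring S \<phi> (carrier G)"

lemma fixedI: "\<lbrakk>x \<in> carrier S; \<And>g. g \<in> H \<Longrightarrow> \<phi> g x = x\<rbrakk> \<Longrightarrow> x \<in> fixed_points S \<phi> H"
  by (simp add: fixed_points_def)

lemma fixedD: "x \<in> fixed_points S \<phi> H \<Longrightarrow> x \<in> carrier S" "\<lbrakk>x \<in> fixed_points S \<phi> H; g \<in> H\<rbrakk> \<Longrightarrow> \<phi> g x = x"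
  by (simp_all add: fixed_points_def)

lemma fixed_closed:
  assumes "H \<subseteq> carrier G"
  shows "\<zero> \<in> fixed_points S \<phi> H" "\<one> \<in> fixed_points S \<phi> H"
    "\<lbrakk>x \<in> fixed_points S \<phi> H; y \<in> fixed_points S \<phi> H\<rbrakk> \<Longrightarrow> x \<oplus> y \<in> fixed_points S \<phi> H"
    "\<lbrakk>x \<in> fixed_points S \<phi> H; y \<in> fixed_points S \<phi> H\<rbrakk> \<Longrightarrow> x \<otimes> y \<in> fixed_points S \<phi> H"
    "\<lbrakk>x \<in> fixed_points S \<phi> H; y \<in> fixed_points S \<phi> H\<rbrakk> \<Longrightarrow> x \<ominus> y \<in> fixed_points S \<phi> H"
    "x \<in> fixed_points S \<phi> H \<Longrightarrow> \<ominus> x \<in> fixed_points S \<phi> H"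
  using assms by (auto simp: fixed_points_def act_add act_mult act_minus act_uminus subset_iff)

lemma invariant_ring_simps [simp]:
  "carrier (invariant_ring S \<phi> H) = fixed_points S \<phi> H"
  "x \<otimes>\<^bsub>invariant_ring S \<phi> H\<^esub> y = x \<otimes> y" "x \<oplus>\<^bsub>invariant_ring S \<phi> H\<^esub> y = x \<oplus> y"
  "\<zero>\<^bsub>invariant_ring S \<phi> H\<^esub> = \<zero>" "\<one>\<^bsub>invariant_ring S \<phi> H\<^esub> = \<one>"
  by (simp_all add: invariant_ring_def)

lemma inv_ring_cring: "cring inv_ring"
proof -
  have "subcring invariants_set S"
  proof (rule subcringI')
    show "subring invariants_set S"
      using fixed_closed[of "carrier G"] by (intro subringI) (auto simp: fixed_points_def)
  qed
  then show ?thesis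
    unfolding invariant_ring_def by (subst subcring_iff[symmetric]) (auto simp: fixed_points_def)
qed

lemma inv_ring_idealI:
  assumes sub: "J \<subseteq> invariants_set" and zero: "\<zero> \<in> J"
    and add: "\<And>y z. \<lbrakk>y \<in> J; z \<in> J\<rbrakk> \<Longrightarrow> y \<oplus> z \<in> J"
    and mult: "\<And>r y. \<lbrakk>r \<in> invariants_set; y \<in> J\<rbrakk> \<Longrightarrow> r \<otimes> y \<in> J"
  shows "ideal J inv_ring"
proof -
  interpret R: cring inv_ring by (rule inv_ring_cring)
  have inv: "y \<in> invariants_set" if "y \<in> J" for y using sub that by blast
  show ?thesis
  proof (rule idealI[OF R.ring_axioms])
    show "subgroup J (add_monoid inv_ring)"
    proof (rule R.add.subgroupI)
      show "\<ominus>\<^bsub>inv_ring\<^esub> y \<in> J" if y: "y \<in> J" for y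
      proof -
        have "\<ominus>\<^bsub>inv_ring\<^esub> y = (\<ominus>\<^bsub>inv_ring\<^esub> \<one>) \<otimes> y"
          using R.l_minus[of \<one> y] inv[OF y] R.one_closed R.l_one[of y] by simp
        then show ?thesis using mult[OF _ y] R.a_inv_closed[OF R.one_closed] by simp
      qed
    qed (use zero add inv in auto)
    show "r \<otimes>\<^bsub>inv_ring\<^esub> y \<in> J" "y \<otimes>\<^bsub>inv_ring\<^esub> r \<in> J" if "y \<in> J" "r \<in> carrier inv_ring" for y r
      using that mult[of r y] m_comm[OF fixedD(1)[OF inv[of y]] fixedD(1)[of r "carrier G"]] by simp_all
  qed
qed

lemma inv_ring_pow: "x [^]\<^bsub>inv_ring\<^esub> (n::nat) = x [^] n"
  by (simp add: invariant_ring_def nat_pow_def)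

subsection \<open>Translates of prime ideals\<close>

lemma translate_mem:
  assumes "g \<in> carrier G" "Q \<subseteq> carrier S" "x \<in> carrier S"
  shows "x \<in> \<phi> g ` Q \<longleftrightarrow> \<phi> (inv\<^bsub>G\<^esub> g) x \<in> Q"
proof
  assume "x \<in> \<phi> g ` Q"
  then show "\<phi> (inv\<^bsub>G\<^esub> g) x \<in> Q" using assms by auto
next
  assume "\<phi> (inv\<^bsub>G\<^esub> g) x \<in> Q"
  then show "x \<in> \<phi> g ` Q" using assms by (intro image_eqI[where x = "\<phi> (inv\<^bsub>G\<^esub> g) x"]) auto
qed

lemma translate_comp:
  assumes "g \<in> carrier G" "h \<in> carrier G" "Q \<subseteq> carrier S"
  shows "\<phi> g ` \<phi> h ` Q = \<phi> (g \<otimes>\<^bsub>G\<^esub> h) ` Q"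
  using assms by (auto simp: image_image act_comp subset_iff intro!: image_cong)

lemma translate_id: "Q \<subseteq> carrier S \<Longrightarrow> \<phi> \<one>\<^bsub>G\<^esub> ` Q = Q"
  by (force simp: subset_iff)

lemma prime_carrier: "primeideal Q S \<Longrightarrow> Q \<subseteq> carrier S"
  by (meson ideal.Icarr primeideal.axioms(1) subsetI)

lemma translate_prime:
  assumes g: "g \<in> carrier G" and Q: "primeideal Q S"
  shows "primeideal (\<phi> g ` Q) S"
proof -
  interpret Q: primeideal Q S by fact
  define J where "J = \<phi> g ` Q"
  have mem: "x \<in> J \<longleftrightarrow> x \<in> carrier S \<and> \<phi> (inv\<^bsub>G\<^esub> g) x \<in> Q" for x
    using translate_mem[OF g prime_carrier[OF Q], of x] g Q.Icarr unfolding J_def by auto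
  have g': "inv\<^bsub>G\<^esub> g \<in> carrier G" using g by simp
  have "ideal J S"
  proof (rule idealI[OF ring_axioms])
    show "subgroup J (add_monoid S)"
    proof (rule add.subgroupI)
      show "J \<noteq> {}" using mem[of \<zero>] act_zero[OF g'] Q.additive_subgroup_axioms
        by (auto dest: additive_subgroup.zero_closed)
      show "J \<subseteq> carrier S" using mem by blast
      show "\<ominus> a \<in> J" if "a \<in> J" for a
        using that by (simp add: mem act_uminus[OF g'])
      show "a \<oplus> b \<in> J" if "a \<in> J" "b \<in> J" for a b
        using that additive_subgroup.a_closed[OF Q.additive_subgroup_axioms]
        by (simp add: mem act_add[OF g'])
    qed
    show "x \<otimes> a \<in> J" "a \<otimes> x \<in> J" if "a \<in> J" "x \<in> carrier S" for a x
      using that g' by (simp_all add: mem act_mult[OF g'] Q.I_l_closed Q.I_r_closed)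
  qed
  moreover have "carrier S \<noteq> J"
    using mem[of \<one>] act_one[OF g'] Q.one_imp_carrier Q.I_notcarr by auto
  moreover have "a \<in> J \<or> b \<in> J" if "a \<in> carrier S" "b \<in> carrier S" "a \<otimes> b \<in> J" for a b
    using that g' Q.I_prime[of "\<phi> (inv\<^bsub>G\<^esub> g) a" "\<phi> (inv\<^bsub>G\<^esub> g) b"] by (simp add: mem act_mult[OF g'])
  ultimately show ?thesis
    unfolding J_def[symmetric] by (intro primeidealI is_cring)
qed

text \<open>Iterating \<open>Q \<subseteq> gQ\<close> up to the order of the group gives \<open>gQ \<subseteq> Q\<close>.\<close>

lemma translate_subset_imp_eq:
  assumes g: "g \<in> carrier G" and Q: "Q \<subseteq> carrier S" and sub: "Q \<subseteq> \<phi> g ` Q"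
  shows "\<phi> g ` Q = Q"
proof -
  have iter: "Q \<subseteq> \<phi> (g [^]\<^bsub>G\<^esub> m) ` Q" for m :: nat
  proof (induction m)
    case 0
    then show ?case using translate_id[OF Q] by simp
  next
    case (Suc m)
    have "\<phi> (g [^]\<^bsub>G\<^esub> m) ` Q \<subseteq> \<phi> (g [^]\<^bsub>G\<^esub> m) ` \<phi> g ` Q" using sub by (rule image_mono)
    with Suc show ?case using translate_comp[OF _ g Q, of "g [^]\<^bsub>G\<^esub> m"] g by simp
  qed
  obtain n where n: "order G = Suc n"
    using G.order_gt_0_iff_finite finite_group by (metis gr0_implies_Suc)
  have "\<phi> g ` Q \<subseteq> \<phi> g ` \<phi> (g [^]\<^bsub>G\<^esub> n) ` Q" using iter by (rule image_mono)
  also have "\<dots> = \<phi> (g [^]\<^bsub>G\<^esub> Suc n) ` Q"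
    using translate_comp[OF g _ Q, of "g [^]\<^bsub>G\<^esub> n"] g G.nat_pow_Suc2 by simp
  also have "\<dots> = Q" using G.pow_order_eq_1[OF g] n translate_id[OF Q] by simp
  finally show ?thesis using sub by blast
qed

lemma translates_incomparable:
  assumes g: "g \<in> carrier G" "h \<in> carrier G" and Q: "Q \<subseteq> carrier S" and sub: "\<phi> g ` Q \<subseteq> \<phi> h ` Q"
  shows "\<phi> g ` Q = \<phi> h ` Q"
proof -
  have "\<phi> (inv\<^bsub>G\<^esub> g) ` \<phi> g ` Q \<subseteq> \<phi> (inv\<^bsub>G\<^esub> g) ` \<phi> h ` Q" using sub by (rule image_mono)
  then have "Q \<subseteq> \<phi> (inv\<^bsub>G\<^esub> g \<otimes>\<^bsub>G\<^esub> h) ` Q" using g Q by (simp add: translate_comp translate_id)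
  then have "\<phi> (inv\<^bsub>G\<^esub> g \<otimes>\<^bsub>G\<^esub> h) ` Q = Q" using translate_subset_imp_eq g Q by simp
  then have "\<phi> g ` \<phi> (inv\<^bsub>G\<^esub> g \<otimes>\<^bsub>G\<^esub> h) ` Q = \<phi> g ` Q" by simp
  then show ?thesis using g Q by (simp add: translate_comp flip: G.m_assoc)
qed

lemma translate_contraction:
  assumes "g \<in> carrier G" "Q \<subseteq> carrier S"
  shows "\<phi> g ` Q \<inter> invariants_set = Q \<inter> invariants_set"
proof -
  have "x \<in> \<phi> g ` Q \<longleftrightarrow> x \<in> Q" if "x \<in> invariants_set" for x
    using translate_mem[OF assms fixedD(1)[OF that]] fixedD(2)[OF that, of "inv\<^bsub>G\<^esub> g"] assms(1) by simp
  then show ?thesis by blast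
qed

subsection \<open>Norms\<close>

definition norm_over :: "'g set \<Rightarrow> 's \<Rightarrow> 's"
  where "norm_over H x = (\<Otimes>h\<in>H. \<phi> h x)"

lemma norm_fixed:
  assumes H: "subgroup H G" and x: "x \<in> carrier S"
  shows "norm_over H x \<in> fixed_points S \<phi> H"
proof (rule fixedI)
  have Hc: "H \<subseteq> carrier G" using subgroup.subset[OF H] .
  have fc: "(\<lambda>h. \<phi> h x) \<in> H \<rightarrow> carrier S" using Hc x by auto
  then show "norm_over H x \<in> carrier S" by (simp add: norm_over_def)
  fix g assume g: "g \<in> H"
  have K: "group (G\<lparr>carrier := H\<rparr>)" using subgroup.subgroup_is_group[OF H G.is_group] .
  have "\<phi> g (norm_over H x) = (\<Otimes>h\<in>H. \<phi> g (\<phi> h x))"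
    using g Hc fc by (simp add: norm_over_def act_finprod subset_iff)
  also have "\<dots> = (\<Otimes>h\<in>H. \<phi> (g \<otimes>\<^bsub>G\<^esub> h) x)"
    using g Hc x by (intro finprod_cong') (auto simp: act_comp subset_iff)
  also have "\<dots> = norm_over H x"
    using finprod_group_translate[OF K, of g "\<lambda>h. \<phi> h x"] g fc by (simp add: norm_over_def)
  finally show "\<phi> g (norm_over H x) = norm_over H x" .
qed

lemma norm_mem_ideal:
  assumes I: "ideal I S" and H: "subgroup H G" and x: "x \<in> I"
  shows "norm_over H x \<in> I"
proof -
  interpret I: ideal I S by fact
  have Hc: "H \<subseteq> carrier G" using subgroup.subset[OF H] .
  have fin: "finite H" using finite_subset[OF Hc finite_group] .
  have one: "\<one>\<^bsub>G\<^esub> \<in> H" using subgroup.one_closed[OF H] .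
  have xc: "x \<in> carrier S" using I.Icarr[OF x] .
  have fc: "(\<lambda>h. \<phi> h x) \<in> H \<rightarrow> carrier S" using Hc xc by auto
  have "norm_over H x = finprod S (\<lambda>h. \<phi> h x) (insert \<one>\<^bsub>G\<^esub> (H - {\<one>\<^bsub>G\<^esub>}))"
    using one by (simp add: norm_over_def insert_absorb)
  also have "\<dots> = x \<otimes> finprod S (\<lambda>h. \<phi> h x) (H - {\<one>\<^bsub>G\<^esub>})"
    using fin fc xc by (subst finprod_insert) auto
  also have "\<dots> \<in> I" using x fc by (intro I.I_r_closed finprod_closed) auto
  finally show ?thesis .
qed

end

text \<open>The multiplicative monoid of \<open>R[T]/(T\<^sup>2 + xT)\<close>, the pair \<open>(a, c)\<close> standing for \<open>a + cT\<close>. The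
substitution \<open>T = -x\<close> is a ring homomorphism to \<open>R\<close> that maps \<open>(a, c)\<close> to \<open>a - xc\<close>.\<close>

definition pencil_monoid :: "('a, 'm) ring_scheme \<Rightarrow> 'a \<Rightarrow> ('a \<times> 'a) monoid"
  where "pencil_monoid R x = \<lparr>carrier = carrier R \<times> carrier R,
    monoid.mult = (\<lambda>u v. (fst u \<otimes>\<^bsub>R\<^esub> fst v,
      (fst u \<otimes>\<^bsub>R\<^esub> snd v \<oplus>\<^bsub>R\<^esub> fst v \<otimes>\<^bsub>R\<^esub> snd u) \<ominus>\<^bsub>R\<^esub> x \<otimes>\<^bsub>R\<^esub> (snd u \<otimes>\<^bsub>R\<^esub> snd v))),
    one = (\<one>\<^bsub>R\<^esub>, \<zero>\<^bsub>R\<^esub>)\<rparr>"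

lemma (in cring) pencil_comm_monoid:
  assumes x: "x \<in> carrier R"
  shows "comm_monoid (pencil_monoid R x)"
proof (rule comm_monoidI)
  have assoc: "a \<otimes> b \<otimes> c = a \<otimes> (b \<otimes> c)"
    "(a \<otimes> b \<otimes> c' \<oplus> c \<otimes> (a \<otimes> b' \<oplus> b \<otimes> a' \<ominus> x \<otimes> (a' \<otimes> b'))) \<ominus> x \<otimes> ((a \<otimes> b' \<oplus> b \<otimes> a' \<ominus> x \<otimes> (a' \<otimes> b')) \<otimes> c')
      = (a \<otimes> (b \<otimes> c' \<oplus> c \<otimes> b' \<ominus> x \<otimes> (b' \<otimes> c')) \<oplus> b \<otimes> c \<otimes> a') \<ominus> x \<otimes> (a' \<otimes> (b \<otimes> c' \<oplus> c \<otimes> b' \<ominus> x \<otimes> (b' \<otimes> c')))"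
    if "a \<in> carrier R" "b \<in> carrier R" "c \<in> carrier R" "a' \<in> carrier R" "b' \<in> carrier R" "c' \<in> carrier R"
    for a b c a' b' c'
    using that x by algebra+
  show "u \<otimes>\<^bsub>pencil_monoid R x\<^esub> v \<otimes>\<^bsub>pencil_monoid R x\<^esub> w = u \<otimes>\<^bsub>pencil_monoid R x\<^esub> (v \<otimes>\<^bsub>pencil_monoid R x\<^esub> w)"
    if "u \<in> carrier (pencil_monoid R x)" "v \<in> carrier (pencil_monoid R x)" "w \<in> carrier (pencil_monoid R x)" for u v w
    using that assoc[of "fst u" "fst v" "fst w" "snd u" "snd v" "snd w"]
    by (auto simp: pencil_monoid_def mem_Times_iff)
  show "\<one>\<^bsub>pencil_monoid R x\<^esub> \<otimes>\<^bsub>pencil_monoid R x\<^esub> u = u" if "u \<in> carrier (pencil_monoid R x)" for u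
    using that x by (cases u) (auto simp: pencil_monoid_def minus_eq)
  show "u \<otimes>\<^bsub>pencil_monoid R x\<^esub> v = v \<otimes>\<^bsub>pencil_monoid R x\<^esub> u"
    if "u \<in> carrier (pencil_monoid R x)" "v \<in> carrier (pencil_monoid R x)" for u v
    using that x by (cases u; cases v) (auto simp: pencil_monoid_def m_comm a_comm)
qed (use x in \<open>auto simp: pencil_monoid_def\<close>)

context finite_ring_action
begin

text \<open>Expanding the product of the \<open>w - x g(s)\<close> gives \<open>w\<^sup>n - xc\<close>; the point is that \<open>c\<close> can be chosen
\<open>G\<close>-invariant although \<open>x\<close> may be a zero divisor, so that \<open>c\<close> is not determined by the product. Hence the
product is formed in the monoid of pairs, on which \<open>G\<close> acts: there it is invariant, with second
component \<open>c\<close>.\<close>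

lemma norm_of_pencil:
  assumes w: "w \<in> invariants_set" and x: "x \<in> invariants_set" and s: "s \<in> carrier S"
  obtains c where "c \<in> invariants_set" "norm_over (carrier G) (w \<ominus> x \<otimes> s) = w [^] order G \<ominus> x \<otimes> c"
proof -
  have xc: "x \<in> carrier S" and wc: "w \<in> carrier S" using w x fixedD by auto
  interpret M: comm_monoid "pencil_monoid S x" using pencil_comm_monoid[OF xc] .
  let ?M = "pencil_monoid S x"
  define f where "f g = (w, \<phi> g s)" for g
  have fM: "f \<in> carrier G \<rightarrow> carrier ?M" using s wc by (auto simp: f_def pencil_monoid_def)
  define u where "u = finprod ?M f (carrier G)"
  have uc: "u \<in> carrier ?M" using fM by (simp add: u_def)
  have "fst u = (\<Otimes>g\<in>carrier G. w)"
    unfolding u_def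
    by (subst finprod_hom[OF M.comm_monoid_axioms comm_monoid_axioms fM, of fst])
      (auto simp: pencil_monoid_def f_def)
  then have u1: "fst u = w [^] order G" using finprod_const[OF wc] by (simp add: order_def)
  define ev where "ev v = fst v \<ominus> x \<otimes> snd v" for v
  have alg: "a \<otimes> b \<ominus> x \<otimes> (a \<otimes> b' \<oplus> b \<otimes> a' \<ominus> x \<otimes> (a' \<otimes> b')) = (a \<ominus> x \<otimes> a') \<otimes> (b \<ominus> x \<otimes> b')"
    if "a \<in> carrier S" "b \<in> carrier S" "a' \<in> carrier S" "b' \<in> carrier S" for a b a' b'
    using that xc by algebra
  have "ev u = (\<Otimes>g\<in>carrier G. ev (f g))"
    unfolding u_def
    using xc by (intro finprod_hom[OF M.comm_monoid_axioms comm_monoid_axioms fM])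
      (auto simp: ev_def pencil_monoid_def alg minus_eq[of \<one> \<zero>])
  also have "\<dots> = norm_over (carrier G) (w \<ominus> x \<otimes> s)"
    unfolding norm_over_def using s wc xc fixedD(2)[OF w] fixedD(2)[OF x]
    by (intro finprod_cong') (auto simp: ev_def f_def act_minus act_mult)
  finally have u2: "norm_over (carrier G) (w \<ominus> x \<otimes> s) = fst u \<ominus> x \<otimes> snd u" by (simp add: ev_def)
  have "snd u \<in> invariants_set"
  proof (rule fixedI)
    show "snd u \<in> carrier S" using uc by (auto simp: pencil_monoid_def)
    fix g assume g: "g \<in> carrier G"
    define h where "h v = (\<phi> g (fst v), \<phi> g (snd v))" for v
    have "h u = finprod ?M (\<lambda>i. h (f i)) (carrier G)"
      unfolding u_def using fixedD(2)[OF x g] xc g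
      by (intro finprod_hom[OF M.comm_monoid_axioms M.comm_monoid_axioms fM])
        (auto simp: h_def pencil_monoid_def act_mult act_add act_minus)
    also have "\<dots> = finprod ?M (\<lambda>i. f (g \<otimes>\<^bsub>G\<^esub> i)) (carrier G)"
      using fM g s fixedD(2)[OF w g] by (intro M.finprod_cong') (auto simp: h_def f_def act_comp Pi_def)
    also have "\<dots> = u"
      unfolding u_def using M.finprod_group_translate[OF G.is_group g fM] .
    finally show "\<phi> g (snd u) = snd u" by (metis h_def snd_conv)
  qed
  then show ?thesis using that u1 u2 by simp
qed

subsection \<open>Primes over primes of the invariant ring\<close>

text \<open>Lying over and going up, for an ideal \<open>A\<close> whose invariants lie in \<open>q\<close>. Let \<open>Q \<supseteq> A\<close> be maximal among
the ideals with \<open>Q \<inter> R \<subseteq> q\<close>. If some \<open>x \<in> q\<close> were not in \<open>Q\<close>, then by maximality an invariant \<open>w \<notin> q\<close>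
would be of the form \<open>a + xs\<close> with \<open>a \<in> Q\<close>. The norm of \<open>a = w - xs\<close> is an invariant in \<open>Q\<close>, hence
in \<open>q\<close>, and it equals \<open>w\<^sup>n - xc\<close> with \<open>c\<close> invariant; this forces \<open>w \<in> q\<close>.\<close>

lemma exists_prime_over:
  assumes q: "primeideal q inv_ring" and A: "ideal A S" and Aq: "A \<inter> invariants_set \<subseteq> q"
  obtains Q where "primeideal Q S" "A \<subseteq> Q" "Q \<inter> invariants_set = q"
proof -
  interpret q: primeideal q inv_ring by fact
  have qc: "x \<in> invariants_set" if "x \<in> q" for x using q.Icarr[OF that] by simp
  have sub: "invariants_set \<subseteq> carrier S" by (auto simp: fixed_points_def)
  let ?W = "invariants_set - q"
  have W1: "\<one> \<in> ?W"
    using q.one_imp_carrier q.I_notcarr fixed_closed(2)[of "carrier G"] by auto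
  have W2: "u \<otimes> v \<in> ?W" if "u \<in> ?W" "v \<in> ?W" for u v
    using that q.I_prime[of u v] fixed_closed(4)[of "carrier G"] by auto
  obtain Q where Q: "primeideal Q S" "A \<subseteq> Q" "Q \<inter> ?W = {}"
    and max: "\<And>x. \<lbrakk>x \<in> carrier S; x \<notin> Q\<rbrakk> \<Longrightarrow> \<exists>a\<in>Q. \<exists>s\<in>carrier S. a \<oplus> x \<otimes> s \<in> ?W"
    using maximal_ideal_avoiding[OF A W1 _ W2] sub Aq by blast
  interpret Q: primeideal Q S by fact
  have "x \<in> Q" if x: "x \<in> q" for x
  proof (rule ccontr)
    assume "x \<notin> Q"
    then obtain a s where as: "a \<in> Q" "s \<in> carrier S" "a \<oplus> x \<otimes> s \<in> ?W"
      using max qc[OF x] sub by blast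
    define w where "w = a \<oplus> x \<otimes> s"
    have c: "a \<in> carrier S" "x \<in> carrier S" using as Q.Icarr qc[OF x] sub by auto
    have "a = w \<ominus> x \<otimes> s" unfolding w_def using c as(2) by algebra
    moreover obtain c where c: "c \<in> invariants_set" "norm_over (carrier G) (w \<ominus> x \<otimes> s) = w [^] order G \<ominus> x \<otimes> c"
      using norm_of_pencil[of w x s] as qc[OF x] unfolding w_def by auto
    ultimately have N: "norm_over (carrier G) a = w [^] order G \<ominus> x \<otimes> c" by simp
    have "norm_over (carrier G) a \<in> Q" using norm_mem_ideal[OF Q.is_ideal G.subgroup_self as(1)] .
    moreover have "norm_over (carrier G) a \<in> invariants_set"
      using norm_fixed[OF G.subgroup_self] as(1) Q.Icarr by blast
    ultimately have "norm_over (carrier G) a \<in> q" using Q(3) by blast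
    moreover have "x \<otimes> c \<in> q" using q.I_r_closed[OF x] c by simp
    ultimately have "norm_over (carrier G) a \<oplus> x \<otimes> c \<in> q" using additive_subgroup.a_closed[OF q.additive_subgroup_axioms] by simp
    moreover have "norm_over (carrier G) a \<oplus> x \<otimes> c = w [^] order G"
    proof -
      have "w [^] order G \<in> carrier S" "x \<in> carrier S" "c \<in> carrier S"
        using as sub qc[OF x] c unfolding w_def by auto
      then show ?thesis unfolding N by algebra
    qed
    ultimately have "w [^]\<^bsub>inv_ring\<^esub> order G \<in> q" by (simp add: inv_ring_pow)
    then show False using q.pow_mem_imp[of w] as(3) unfolding w_def by simp
  qed
  then have "Q \<inter> invariants_set = q" using Q(3) qc by blast
  with Q show ?thesis using that by blast
qed

lemma contraction_prime:
  assumes Q: "primeideal Q S"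
  shows "primeideal (Q \<inter> invariants_set) inv_ring"
proof -
  interpret Q: primeideal Q S by fact
  have "ideal (Q \<inter> invariants_set) inv_ring"
    using additive_subgroup.zero_closed[OF Q.additive_subgroup_axioms]
      additive_subgroup.a_closed[OF Q.additive_subgroup_axioms]
    by (intro inv_ring_idealI) (auto simp: fixed_closed fixedD(1) intro: Q.I_l_closed)
  moreover have "carrier inv_ring \<noteq> Q \<inter> invariants_set"
    using fixed_closed(2)[of "carrier G"] Q.one_imp_carrier Q.I_notcarr by auto
  ultimately show ?thesis
    using Q.I_prime fixedD(1) by (intro primeidealI inv_ring_cring) auto
qed

text \<open>If \<open>Q\<close> were contained in no translate of \<open>Q'\<close>, prime avoidance would give an element of \<open>Q\<close> outside
all of them; its norm is an invariant in \<open>Q\<close> but not in \<open>Q'\<close>.\<close>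

lemma contraction_subset_imp:
  assumes Q: "primeideal Q S" and Q': "primeideal Q' S" and sub: "Q \<inter> invariants_set \<subseteq> Q'"
  shows "\<exists>g\<in>carrier G. Q \<subseteq> \<phi> g ` Q'"
proof (rule ccontr)
  assume no: "\<not> ?thesis"
  interpret Q: primeideal Q S by fact
  interpret Q': primeideal Q' S by fact
  let ?F = "(\<lambda>g. \<phi> g ` Q') ` carrier G"
  have "\<exists>x\<in>Q. \<forall>J\<in>?F. x \<notin> J"
  proof (rule prime_avoidance[OF _ _ _ Q.is_ideal])
    show "finite ?F" using finite_group by blast
    show "primeideal J S" if "J \<in> ?F" for J using that translate_prime Q' by auto
    show "J = J'" if "J \<in> ?F" "J' \<in> ?F" "J \<subseteq> J'" for J J'
      using that translates_incomparable[OF _ _ prime_carrier[OF Q']] by (elim imageE) simp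
    show "\<not> Q \<subseteq> J" if "J \<in> ?F" for J using that no by blast
  qed
  then obtain x where x1: "x \<in> Q" "\<forall>J\<in>?F. x \<notin> J" by (elim bexE)
  then have x: "x \<in> Q" "\<And>g. g \<in> carrier G \<Longrightarrow> x \<notin> \<phi> g ` Q'" by simp_all
  have xc: "x \<in> carrier S" using x Q.Icarr by blast
  have "norm_over (carrier G) x \<in> Q'"
    using norm_mem_ideal[OF Q.is_ideal G.subgroup_self x(1)] norm_fixed[OF G.subgroup_self xc] sub by blast
  then obtain g where g: "g \<in> carrier G" "\<phi> g x \<in> Q'"
    using Q'.finprod_mem_imp[OF finite_group, of "\<lambda>g. \<phi> g x"] xc unfolding norm_over_def by auto
  then show False
    using x(2)[of "inv\<^bsub>G\<^esub> g"] translate_mem[OF _ prime_carrier[OF Q'] xc, of "inv\<^bsub>G\<^esub> g"] by simp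
qed

lemma same_contraction_imp_conjugate:
  assumes Q: "primeideal Q S" and Q': "primeideal Q' S" and eq: "Q \<inter> invariants_set = Q' \<inter> invariants_set"
  shows "\<exists>g\<in>carrier G. Q = \<phi> g ` Q'"
proof -
  obtain g where g: "g \<in> carrier G" "Q \<subseteq> \<phi> g ` Q'" using contraction_subset_imp[OF Q Q'] eq by blast
  obtain h where h: "h \<in> carrier G" "Q' \<subseteq> \<phi> h ` Q" using contraction_subset_imp[OF Q' Q] eq by blast
  have gh: "\<phi> g ` Q' \<subseteq> \<phi> (g \<otimes>\<^bsub>G\<^esub> h) ` Q"
    using image_mono[OF h(2), of "\<phi> g"] translate_comp[OF g(1) h(1) prime_carrier[OF Q]] by simp
  then have "\<phi> (g \<otimes>\<^bsub>G\<^esub> h) ` Q = Q"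
    using translate_subset_imp_eq[OF _ prime_carrier[OF Q], of "g \<otimes>\<^bsub>G\<^esub> h"] g h by blast
  then show ?thesis using g gh by blast
qed

lemma contraction_incomparable:
  assumes Q: "primeideal Q S" and Q': "primeideal Q' S" and sub: "Q \<subseteq> Q'"
    and eq: "Q' \<inter> invariants_set \<subseteq> Q"
  shows "Q = Q'"
proof -
  obtain g where g: "g \<in> carrier G" "Q' \<subseteq> \<phi> g ` Q" using contraction_subset_imp[OF Q' Q eq] by blast
  then have "\<phi> g ` Q = Q" using translate_subset_imp_eq[OF _ prime_carrier[OF Q]] sub by blast
  then show ?thesis using g sub by blast
qed

section \<open>Inertia groups\<close>

definition inertia :: "'s set \<Rightarrow> 'g set"
  where "inertia Q = {g \<in> carrier G. \<forall>s\<in>carrier S. \<phi> g s \<ominus> s \<in> Q}"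

lemma inertia_carrier: "inertia Q \<subseteq> carrier G"
  by (auto simp: inertia_def)

lemma inertia_translate:
  assumes g: "g \<in> inertia Q" and Q: "ideal Q S"
  shows "\<phi> g ` Q = Q"
proof -
  interpret Q: ideal Q S by fact
  have gc: "g \<in> carrier G" using g by (simp add: inertia_def)
  have "\<phi> g x \<in> Q \<longleftrightarrow> x \<in> Q" if x: "x \<in> carrier S" for x
  proof -
    have d: "\<phi> g x \<ominus> x \<in> Q" using g x by (simp add: inertia_def)
    then show ?thesis
      using Q.mem_diff_imp[of "\<phi> g x" x] Q.mem_diff_imp[of x "\<phi> g x"] Q.diff_sym_mem[of "\<phi> g x" x] x gc by auto
  qed
  then show ?thesis
    using gc Q.Icarr translate_mem[OF gc, of Q] by (metis act_closed act_inv(2) image_subset_iff subsetI subset_antisym G.inv_closed)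
qed

lemma inertia_subgroup:
  assumes Q: "ideal Q S"
  shows "subgroup (inertia Q) G"
proof -
  interpret Q: ideal Q S by fact
  show ?thesis
  proof (rule G.subgroupI)
    have "\<one>\<^bsub>G\<^esub> \<in> inertia Q" by (simp add: inertia_def minus_eq r_neg)
    then show "inertia Q \<noteq> {}" by blast
    show "inv\<^bsub>G\<^esub> g \<in> inertia Q" if g: "g \<in> inertia Q" for g
    proof -
      have gc: "g \<in> carrier G" using g by (simp add: inertia_def)
      have "\<phi> (inv\<^bsub>G\<^esub> g) s \<ominus> s \<in> Q" if s: "s \<in> carrier S" for s
      proof -
        have "\<phi> g t \<ominus> t \<in> Q" if "t \<in> carrier S" for t using g that by (simp add: inertia_def)
        from this[of "\<phi> (inv\<^bsub>G\<^esub> g) s"] have "s \<ominus> \<phi> (inv\<^bsub>G\<^esub> g) s \<in> Q" using gc s by simp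
        then show ?thesis using Q.diff_sym_mem[of s] gc s by simp
      qed
      then show ?thesis using gc by (simp add: inertia_def)
    qed
    show "g \<otimes>\<^bsub>G\<^esub> h \<in> inertia Q" if gh: "g \<in> inertia Q" "h \<in> inertia Q" for g h
    proof -
      have c: "g \<in> carrier G" "h \<in> carrier G" using gh by (simp_all add: inertia_def)
      have "\<phi> (g \<otimes>\<^bsub>G\<^esub> h) s \<ominus> s \<in> Q" if s: "s \<in> carrier S" for s
      proof -
        have "(\<phi> g (\<phi> h s) \<ominus> \<phi> h s) \<oplus> (\<phi> h s \<ominus> s) \<in> Q"
          using gh c s additive_subgroup.a_closed[OF Q.additive_subgroup_axioms] by (simp add: inertia_def)
        moreover have "(u \<ominus> v) \<oplus> (v \<ominus> s) = u \<ominus> s" if "u \<in> carrier S" "v \<in> carrier S" for u v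
          using that s by algebra
        ultimately show ?thesis using c s by (simp add: act_comp)
      qed
      then show ?thesis using c by (simp add: inertia_def)
    qed
  qed (rule inertia_carrier)
qed

text \<open>Inertia groups of translates are conjugate: \<open>gD(Q)g\<^sup>-\<^sup>1 \<subseteq> D(gQ)\<close>.\<close>

lemma inertia_of_translate:
  assumes g: "g \<in> carrier G" and Q: "Q \<subseteq> carrier S" and h: "h \<in> carrier G"
    and mem: "inv\<^bsub>G\<^esub> g \<otimes>\<^bsub>G\<^esub> h \<otimes>\<^bsub>G\<^esub> g \<in> inertia Q"
  shows "h \<in> inertia (\<phi> g ` Q)"
proof -
  have "\<phi> h s \<ominus> s \<in> \<phi> g ` Q" if s: "s \<in> carrier S" for s
  proof -
    have "\<phi> (inv\<^bsub>G\<^esub> g \<otimes>\<^bsub>G\<^esub> h \<otimes>\<^bsub>G\<^esub> g) (\<phi> (inv\<^bsub>G\<^esub> g) s) \<ominus> \<phi> (inv\<^bsub>G\<^esub> g) s \<in> Q"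
      using mem g s by (simp add: inertia_def)
    then have "\<phi> (inv\<^bsub>G\<^esub> g) (\<phi> h s \<ominus> s) \<in> Q"
      using g h s by (simp add: act_comp act_minus)
    then show ?thesis using g h s Q by (simp add: translate_mem)
  qed
  then show ?thesis using h by (simp add: inertia_def)
qed

section \<open>Transfers and the Brauer ideal\<close>

lemma transfer_term:
  assumes x: "x \<in> fixed_points S \<phi> H" and g: "g \<in> carrier G" and h: "h \<in> H" and H: "subgroup H G"
  shows "\<phi> (g \<otimes>\<^bsub>G\<^esub> h) x = \<phi> g x"
  using fixedD[OF x] g h subgroup.mem_carrier[OF H h] by (simp add: act_comp)

lemma transfer_fixed:
  assumes H: "subgroup H G" and x: "x \<in> fixed_points S \<phi> H"
  shows "transfer S G \<phi> H x \<in> invariants_set"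
proof (rule fixedI)
  have xc: "x \<in> carrier S" using fixedD[OF x] by blast
  have F: "(\<lambda>C. \<phi> (SOME g. g \<in> C) x) \<in> lcosets\<^bsub>G\<^esub> H \<rightarrow> carrier S"
    using G.lcoset_some_carrier[OF H] xc by auto
  then show "transfer S G \<phi> H x \<in> carrier S" by (simp add: transfer_def)
  fix g assume g: "g \<in> carrier G"
  have "\<phi> g (transfer S G \<phi> H x) = (\<Oplus>C\<in>lcosets\<^bsub>G\<^esub> H. \<phi> g (\<phi> (SOME g. g \<in> C) x))"
    using g F by (simp add: transfer_def act_finsum)
  also have "\<dots> = (\<Oplus>C\<in>lcosets\<^bsub>G\<^esub> H. \<phi> (g \<otimes>\<^bsub>G\<^esub> (SOME g. g \<in> C)) x)"
    using g xc G.lcoset_some_carrier[OF H] by (intro finsum_cong') (auto simp: act_comp)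
  also have "\<dots> = transfer S G \<phi> H x"
    unfolding transfer_def
    using add.finprod_lcosets_translate[OF G.is_group H g, of "\<lambda>g. \<phi> g x"] transfer_term[OF x _ _ H] xc
    by (auto simp: finsum_def)
  finally show "\<phi> g (transfer S G \<phi> H x) = transfer S G \<phi> H x" .
qed

lemma transfer_add:
  assumes H: "subgroup H G" and x: "x \<in> carrier S" "y \<in> carrier S"
  shows "transfer S G \<phi> H (x \<oplus> y) = transfer S G \<phi> H x \<oplus> transfer S G \<phi> H y"
proof -
  have "transfer S G \<phi> H (x \<oplus> y) = (\<Oplus>C\<in>lcosets\<^bsub>G\<^esub> H. \<phi> (SOME g. g \<in> C) x \<oplus> \<phi> (SOME g. g \<in> C) y)"
    unfolding transfer_def using x G.lcoset_some_carrier[OF H] by (intro finsum_cong') (auto simp: act_add)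
  also have "\<dots> = transfer S G \<phi> H x \<oplus> transfer S G \<phi> H y"
    unfolding transfer_def using x G.lcoset_some_carrier[OF H] by (intro finsum_addf) auto
  finally show ?thesis .
qed

lemma transfer_mult:
  assumes H: "subgroup H G" and x: "x \<in> carrier S" and r: "r \<in> invariants_set"
  shows "transfer S G \<phi> H (r \<otimes> x) = r \<otimes> transfer S G \<phi> H x"
proof -
  have rc: "r \<in> carrier S" using fixedD[OF r] by blast
  have fin: "finite (lcosets\<^bsub>G\<^esub> H)" using finite_group by (auto simp: LCOSETS_def)
  have "transfer S G \<phi> H (r \<otimes> x) = (\<Oplus>C\<in>lcosets\<^bsub>G\<^esub> H. r \<otimes> \<phi> (SOME g. g \<in> C) x)"
    unfolding transfer_def using x rc G.lcoset_some_carrier[OF H] fixedD(2)[OF r]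
    by (intro finsum_cong') (auto simp: act_mult)
  also have "\<dots> = r \<otimes> transfer S G \<phi> H x"
    unfolding transfer_def using x rc fin G.lcoset_some_carrier[OF H] by (intro finsum_rdistr[symmetric]) auto
  finally show ?thesis .
qed

lemma transfer_zero: "subgroup H G \<Longrightarrow> transfer S G \<phi> H \<zero> = \<zero>"
  unfolding transfer_def using G.lcoset_some_carrier by (intro add.finprod_one_eqI) (auto simp: finsum_def)

lemma finite_p_index_subgroups: "finite (p_index_subgroups p G)"
proof -
  have "p_index_subgroups p G \<subseteq> Pow (carrier G)"
    using subgroup.subset by (force simp: p_index_subgroups_def)
  then show ?thesis using finite_group finite_subset by blast
qed

lemma brauer_idealE:
  assumes "y \<in> brauer_ideal p S G \<phi>"
  obtains x where "\<forall>H\<in>p_index_subgroups p G. x H \<in> fixed_points S \<phi> H"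
    "y = (\<Oplus>H\<in>p_index_subgroups p G. transfer S G \<phi> H (x H))"
  using assms unfolding brauer_ideal_def by blast

lemma brauer_idealI:
  assumes "\<forall>H\<in>p_index_subgroups p G. x H \<in> fixed_points S \<phi> H"
  shows "(\<Oplus>H\<in>p_index_subgroups p G. transfer S G \<phi> H (x H)) \<in> brauer_ideal p S G \<phi>"
  using assms unfolding brauer_ideal_def by blast

lemma brauer_transfer_closed:
  assumes "\<forall>H\<in>p_index_subgroups p G. x H \<in> fixed_points S \<phi> H" "H \<in> p_index_subgroups p G"
  shows "subgroup H G" "x H \<in> carrier S" "transfer S G \<phi> H (x H) \<in> invariants_set" "transfer S G \<phi> H (x H) \<in> carrier S"
proof -
  show H: "subgroup H G" using assms(2) by (simp add: p_index_subgroups_def)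
  show "x H \<in> carrier S" using assms fixedD(1) by blast
  show "transfer S G \<phi> H (x H) \<in> invariants_set" using transfer_fixed[OF H] assms by blast
  then show "transfer S G \<phi> H (x H) \<in> carrier S" using fixedD(1) by blast
qed

lemma brauer_ideal_is_ideal: "ideal (brauer_ideal p S G \<phi>) inv_ring"
proof -
  let ?B = "brauer_ideal p S G \<phi>" and ?P = "p_index_subgroups p G"
  have mult: "r \<otimes> y \<in> ?B" if r: "r \<in> invariants_set" and y: "y \<in> ?B" for r y
  proof -
    obtain x where x: "\<forall>H\<in>?P. x H \<in> fixed_points S \<phi> H"
      and yx: "y = (\<Oplus>H\<in>?P. transfer S G \<phi> H (x H))" using y brauer_idealE by blast
    note c = brauer_transfer_closed[OF x]
    have rc: "r \<in> carrier S" using fixedD[OF r] by blast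
    have "r \<otimes> y = (\<Oplus>H\<in>?P. r \<otimes> transfer S G \<phi> H (x H))"
      unfolding yx using rc c by (intro finsum_rdistr finite_p_index_subgroups) auto
    also have "\<dots> = (\<Oplus>H\<in>?P. transfer S G \<phi> H (r \<otimes> x H))"
      using rc c by (intro finsum_cong') (auto simp: transfer_mult[OF _ _ r])
    also have "\<dots> \<in> ?B"
    proof (rule brauer_idealI, rule ballI)
      fix H assume H: "H \<in> ?P"
      have "r \<in> fixed_points S \<phi> H" using r subgroup.subset[OF c(1)[OF H]] by (auto simp: fixed_points_def)
      then show "r \<otimes> x H \<in> fixed_points S \<phi> H"
        using bspec[OF x H] subgroup.subset[OF c(1)[OF H]] fixed_closed(4) by blast
    qed
    finally show ?thesis .
  qed
  have inv: "y \<in> invariants_set" if y: "y \<in> ?B" for y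
  proof -
    obtain x where x: "\<forall>H\<in>?P. x H \<in> fixed_points S \<phi> H"
      and yx: "y = (\<Oplus>H\<in>?P. transfer S G \<phi> H (x H))" using y brauer_idealE by blast
    note c = brauer_transfer_closed[OF x]
    show ?thesis
      unfolding yx
    proof (rule fixedI)
      show "(\<Oplus>H\<in>?P. transfer S G \<phi> H (x H)) \<in> carrier S" using c by auto
      show "\<phi> g (\<Oplus>H\<in>?P. transfer S G \<phi> H (x H)) = (\<Oplus>H\<in>?P. transfer S G \<phi> H (x H))" if g: "g \<in> carrier G" for g
        using c fixedD(2)[OF c(3) g] g by (subst act_finsum) (auto intro!: finsum_cong')
    qed
  qed
  have add: "y \<oplus> z \<in> ?B" if y: "y \<in> ?B" and z: "z \<in> ?B" for y z
  proof -
    obtain x where x: "\<forall>H\<in>?P. x H \<in> fixed_points S \<phi> H"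
      and yx: "y = (\<Oplus>H\<in>?P. transfer S G \<phi> H (x H))" using y brauer_idealE by blast
    obtain x' where x': "\<forall>H\<in>?P. x' H \<in> fixed_points S \<phi> H"
      and zx: "z = (\<Oplus>H\<in>?P. transfer S G \<phi> H (x' H))" using z brauer_idealE by blast
    note c = brauer_transfer_closed[OF x] and c' = brauer_transfer_closed[OF x']
    have "y \<oplus> z = (\<Oplus>H\<in>?P. transfer S G \<phi> H (x H) \<oplus> transfer S G \<phi> H (x' H))"
      unfolding yx zx using c c' by (intro finsum_addf[symmetric]) auto
    also have "\<dots> = (\<Oplus>H\<in>?P. transfer S G \<phi> H (x H \<oplus> x' H))"
      using c c' by (intro finsum_cong') (auto simp: transfer_add)
    also have "\<dots> \<in> ?B"
    proof (rule brauer_idealI, rule ballI)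
      fix H assume H: "H \<in> ?P"
      show "x H \<oplus> x' H \<in> fixed_points S \<phi> H"
        using fixed_closed(3)[OF subgroup.subset[OF c(1)[OF H]]] x x' H by simp
    qed
    finally show ?thesis .
  qed
  have zero: "\<zero> \<in> ?B"
  proof -
    have "(\<Oplus>H\<in>?P. transfer S G \<phi> H \<zero>) \<in> ?B"
      using fixed_closed(1) subgroup.subset by (intro brauer_idealI) (force simp: p_index_subgroups_def)
    moreover have "(\<Oplus>H\<in>?P. transfer S G \<phi> H \<zero>) = \<zero>"
      by (intro add.finprod_one_eqI[folded finsum_def]) (auto simp: transfer_zero p_index_subgroups_def)
    ultimately show ?thesis by simp
  qed
  show ?thesis
    using inv by (intro inv_ring_idealI zero add mult) auto
qed

text \<open>Take zero for all other subgroups in the defining sum.\<close>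

lemma transfer_mem_brauer_ideal:
  assumes H: "H \<in> p_index_subgroups p G" and x: "x \<in> fixed_points S \<phi> H"
  shows "transfer S G \<phi> H x \<in> brauer_ideal p S G \<phi>"
proof -
  let ?P = "p_index_subgroups p G"
  define f where "f K = (if K = H then x else \<zero>)" for K
  have f: "\<forall>K\<in>?P. f K \<in> fixed_points S \<phi> K"
  proof
    fix K assume "K \<in> ?P"
    then have "K \<subseteq> carrier G" using subgroup.subset by (auto simp: p_index_subgroups_def)
    then show "f K \<in> fixed_points S \<phi> K" using x fixed_closed(1) by (simp add: f_def)
  qed
  note c = brauer_transfer_closed[OF f]
  have "(\<Oplus>K\<in>?P. transfer S G \<phi> K (f K)) = (\<Oplus>K\<in>?P. if H = K then transfer S G \<phi> K (f K) else \<zero>)"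
    using c(1) c(4)[OF H] by (intro finsum_cong') (auto simp: f_def transfer_zero)
  also have "\<dots> = transfer S G \<phi> H (f H)"
    using c by (intro finsum_singleton H finite_p_index_subgroups) auto
  finally show ?thesis using brauer_idealI[OF f] by (simp add: f_def)
qed

end

section \<open>Primes containing the Brauer ideal\<close>

locale modular_ring_action = finite_ring_action S G \<phi>
  for S :: "('s, 'n) ring_scheme" (structure) and G :: "('g, 'l) monoid_scheme" (structure)
    and \<phi> :: "'g \<Rightarrow> 's \<Rightarrow> 's" +
  fixes p :: nat
  assumes prime_p: "normalization_semidom_class.prime p"
    and char_p: "[p] \<cdot> \<one> = \<zero>"

context modular_ring_action
begin

lemma add_pow_char: "\<lbrakk>p dvd n; x \<in> carrier S\<rbrakk> \<Longrightarrow> [n] \<cdot> x = \<zero>"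
proof -
  assume "p dvd n" and x: "x \<in> carrier S"
  then obtain c where c: "n = p * c" by blast
  have "[p] \<cdot> x = ([p] \<cdot> \<one>) \<otimes> x" using x by (simp add: add_pow_ldistr)
  then have "[p] \<cdot> x = \<zero>" using x char_p by simp
  moreover have "[n] \<cdot> x = [c] \<cdot> ([p] \<cdot> x)" using x by (simp add: c add.nat_pow_pow mult.commute)
  ultimately show ?thesis by simp
qed

text \<open>An integer prime to \<open>p\<close> is a unit in characteristic \<open>p\<close>, by Bezout.\<close>

lemma add_pow_mem_imp:
  assumes Q: "primeideal Q S" and n: "\<not> p dvd n" and x: "x \<in> carrier S" and mem: "[n] \<cdot> x \<in> Q"
  shows "x \<in> Q"
proof -
  interpret Q: primeideal Q S by fact
  have "coprime n p" using n prime_p by (metis coprime_commute prime_imp_coprime)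
  moreover have "n \<noteq> 0" using n by (metis dvd_0_right)
  ultimately obtain u v where uv: "u * n = v * p + 1"
    using bezout_nat[of n p] by (auto simp: mult.commute)
  have "[u] \<cdot> ([n] \<cdot> x) \<in> Q"
  proof (induction u)
    case 0
    then show ?case using additive_subgroup.zero_closed[OF Q.additive_subgroup_axioms] by simp
  next
    case (Suc u)
    then show ?case using additive_subgroup.a_closed[OF Q.additive_subgroup_axioms _ mem] by simp
  qed
  moreover have "[u] \<cdot> ([n] \<cdot> x) = add_pow S (v * p + 1) x"
    using x uv by (simp add: add.nat_pow_pow mult.commute)
  moreover have "add_pow S (v * p + 1) x = add_pow S (v * p) x \<oplus> x"
    using x by simp
  moreover have "add_pow S (v * p) x = \<zero>" using add_pow_char x by simp
  ultimately show ?thesis using x by simp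
qed

text \<open>The transfers of norms from a Sylow \<open>p\<close>-subgroup \<open>H\<close> of the inertia group cannot all lie in \<open>Q\<close>,
since modulo \<open>Q\<close> they are combinations of characters in which the identity character to the power
\<open>|H|\<close> has the coefficient \<open>|D(Q):H|\<close> times a power of \<open>a\<close>. But if \<open>p\<close> divides \<open>|G:D(Q)|\<close>, they are
in the Brauer ideal.\<close>

theorem brauer_ideal_imp_inertia_index:
  assumes Q: "primeideal Q S" and brauer: "brauer_ideal p S G \<phi> \<subseteq> Q"
  shows "\<not> p dvd card (lcosets\<^bsub>G\<^esub> (inertia Q))"
proof
  assume dvd: "p dvd card (lcosets\<^bsub>G\<^esub> (inertia Q))"
  interpret Q: primeideal Q S by fact
  note Qc = prime_carrier[OF Q]
  let ?D = "inertia Q"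
  have D: "subgroup ?D G" using inertia_subgroup[OF Q.is_ideal] .
  obtain H n where H: "subgroup H G" "H \<subseteq> ?D" and cH: "card H = p ^ n" and idx: "\<not> p dvd card ?D div card H"
    using G.exists_sylow_subgroup[OF finite_group prime_p D] by blast
  let ?L = "lcosets\<^bsub>G\<^esub> H"
  have Hp: "H \<in> p_index_subgroups p G"
    using dvd H(1) G.card_lcosets_subgroup(1)[OF finite_group H(1) D H(2)]
    by (simp add: p_index_subgroups_def)
  have finH: "finite H" using finite_subset[OF subgroup.subset[OF H(1)] finite_group] .
  have finL: "finite ?L" using finite_group by (auto simp: LCOSETS_def)
  let ?q = "p ^ n"
  \<comment> \<open>The element \<open>a\<close> removes the summands \<open>g\<close> with \<open>g\<^sup>-\<^sup>1Q \<noteq> Q\<close> from all transfers below.\<close>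
  let ?F = "{J \<in> (\<lambda>g. \<phi> g ` Q) ` carrier G. J \<noteq> Q}"
  have F: "primeideal J S" if "J \<in> ?F" for J using that translate_prime Q by auto
  have "\<exists>a\<in>carrier S. a \<notin> Q \<and> (\<forall>J\<in>?F. a \<in> J)"
  proof (rule Q.exists_in_finite_intersection[OF _ _ oneideal])
    show "finite ?F" using finite_group by auto
    show "ideal J S \<and> \<not> J \<subseteq> Q" if J: "J \<in> ?F" for J
    proof -
      obtain g where g: "g \<in> carrier G" "J = \<phi> g ` Q" "J \<noteq> Q" using J by auto
      have "\<not> J \<subseteq> Q"
        using translates_incomparable[OF g(1) G.one_closed Qc] translate_id[OF Qc] g by auto
      then show ?thesis using F[OF J] primeideal.axioms(1) by blast
    qed
    show "\<not> carrier S \<subseteq> Q" using Q.I_notcarr Qc by blast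
  qed
  then obtain a where a: "a \<in> carrier S" "a \<notin> Q" "\<And>J. J \<in> ?F \<Longrightarrow> a \<in> J" by auto
  define \<gamma> where "\<gamma> C = (SOME g. g \<in> C)" for C :: "'g set"
  have \<gamma>: "\<gamma> C \<in> carrier G" if "C \<in> ?L" for C using G.lcoset_some_carrier(2)[OF H(1) that] by (simp add: \<gamma>_def)
  define \<tau> where "\<tau> C y = \<phi> (\<gamma> C) y [^] ?q" for C y
  have \<tau>c: "\<tau> C y \<in> carrier S" if "C \<in> ?L" "y \<in> carrier S" for C y using that \<gamma> by (simp add: \<tau>_def)
  \<comment> \<open>This combination of characters \<open>\<tau> C\<close> is congruent to the transfer of the norm of \<open>ab\<close>.\<close>
  have dep: "(\<Oplus>C\<in>?L. \<tau> C a \<otimes> \<tau> C b) \<in> Q" if b: "b \<in> carrier S" for b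
  proof -
    define x where "x = norm_over H (a \<otimes> b)"
    have ab: "a \<otimes> b \<in> carrier S" using a b by simp
    have xH: "x \<in> fixed_points S \<phi> H" unfolding x_def using norm_fixed[OF H(1) ab] .
    have xc: "x \<in> carrier S" using fixedD(1)[OF xH] .
    have T: "transfer S G \<phi> H x \<in> Q" using transfer_mem_brauer_ideal[OF Hp xH] brauer by blast
    have summand: "\<tau> C a \<otimes> \<tau> C b \<ominus> \<phi> (\<gamma> C) x \<in> Q" if C: "C \<in> ?L" for C
    proof -
      let ?g = "\<gamma> C"
      have g: "?g \<in> carrier G" using \<gamma>[OF C] .
      let ?J = "\<phi> (inv\<^bsub>G\<^esub> ?g) ` Q"
      have memJ: "y \<in> ?J \<longleftrightarrow> \<phi> ?g y \<in> Q" if "y \<in> carrier S" for y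
        using translate_mem[OF _ Qc that, of "inv\<^bsub>G\<^esub> ?g"] g by simp
      show ?thesis
      proof (cases "?J = Q")
        case False
        \<comment> \<open>Both terms vanish modulo \<open>Q\<close>, because \<open>a\<close> is in \<open>g\<^sup>-\<^sup>1Q\<close>.\<close>
        then have JF: "?J \<in> ?F" using g by auto
        interpret J: primeideal ?J S using F[OF JF] .
        have aJ: "a \<in> ?J" using a(3)[OF JF] .
        have "a \<otimes> b \<in> ?J" using J.I_r_closed[OF aJ b] .
        then have "x \<in> ?J" unfolding x_def by (rule norm_mem_ideal[OF J.is_ideal H(1)])
        then have 1: "\<phi> ?g x \<in> Q" using memJ xc by blast
        have "\<phi> ?g a \<in> Q" using memJ a(1) aJ by blast
        moreover have "\<tau> C a = \<phi> ?g a \<otimes> \<phi> ?g a [^] (?q - 1)"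
          using prime_p g a(1) nat_pow_Suc2[of "\<phi> ?g a" "?q - 1"] by (simp add: \<tau>_def prime_gt_0_nat)
        ultimately have "\<tau> C a \<in> Q" using Q.I_r_closed g a(1) by simp
        then have 2: "\<tau> C a \<otimes> \<tau> C b \<in> Q" using Q.I_r_closed \<tau>c[OF C b] by blast
        show ?thesis using 1 2 additive_subgroup.a_closed[OF Q.additive_subgroup_axioms 2, of "\<ominus> \<phi> ?g x"]
          by (simp add: minus_eq)
      next
        case True
        \<comment> \<open>\<open>H\<close> acts trivially modulo \<open>Q\<close>, so the norm is the \<open>|H|\<close>-th power of \<open>ab\<close>.\<close>
        have "(\<Otimes>h\<in>H. \<phi> ?g (a \<otimes> b)) \<ominus> (\<Otimes>h\<in>H. \<phi> ?g (\<phi> h (a \<otimes> b))) \<in> Q"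
        proof (rule finprod_diff_mem[OF Q.is_ideal])
          have Hc: "h \<in> carrier G" if "h \<in> H" for h using subgroup.mem_carrier[OF H(1) that] .
          show "(\<lambda>h. \<phi> ?g (a \<otimes> b)) \<in> H \<rightarrow> carrier S" "(\<lambda>h. \<phi> ?g (\<phi> h (a \<otimes> b))) \<in> H \<rightarrow> carrier S"
            using g ab Hc by auto
          show "\<phi> ?g (a \<otimes> b) \<ominus> \<phi> ?g (\<phi> h (a \<otimes> b)) \<in> Q" if h: "h \<in> H" for h
          proof -
            have "\<phi> h (a \<otimes> b) \<ominus> a \<otimes> b \<in> Q" using H(2) h ab by (auto simp: inertia_def)
            then have "a \<otimes> b \<ominus> \<phi> h (a \<otimes> b) \<in> ?J" using Q.diff_sym_mem ab Hc[OF h] True by simp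
            then have "\<phi> ?g (a \<otimes> b \<ominus> \<phi> h (a \<otimes> b)) \<in> Q" using memJ ab Hc[OF h] by simp
            then show ?thesis using act_minus[OF g ab] ab Hc[OF h] by simp
          qed
        qed
        moreover have "(\<Otimes>h\<in>H. \<phi> ?g (a \<otimes> b)) = \<tau> C a \<otimes> \<tau> C b"
          using g a(1) b ab cH by (simp add: finprod_const \<tau>_def act_mult nat_pow_distrib)
        moreover have "(\<Otimes>h\<in>H. \<phi> ?g (\<phi> h (a \<otimes> b))) = \<phi> ?g x"
          unfolding x_def norm_over_def
          using g ab subgroup.mem_carrier[OF H(1)] by (subst act_finprod) auto
        ultimately show ?thesis by simp
      qed
    qed
    have "(\<Oplus>C\<in>?L. \<tau> C a \<otimes> \<tau> C b) \<ominus> transfer S G \<phi> H x \<in> Q"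
      unfolding transfer_def \<gamma>_def[symmetric]
      using \<tau>c a(1) b \<gamma> xc summand by (intro Q.finsum_diff_mem) auto
    moreover have "(\<Oplus>C\<in>?L. \<tau> C a \<otimes> \<tau> C b) \<in> carrier S" using \<tau>c a(1) b by (intro finsum_closed) auto
    ultimately show ?thesis using Q.mem_diff_imp[OF _ T] by blast
  qed
  \<comment> \<open>The cosets whose character is \<open>y \<mapsto> y\<close> to the power \<open>|H|\<close> modulo \<open>Q\<close>; there are \<open>|D(Q):H|\<close> of them.\<close>
  let ?E = "{C \<in> ?L. \<gamma> C \<in> ?D}"
  have sum: "(\<Oplus>C\<in>?E. \<tau> C a) \<in> Q"
  proof (rule Q.equal_characters_coeff_sum[where B = "?L - ?E" and \<tau> = \<tau> and \<rho> = "\<lambda>y. y [^] ?q"])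
    have un: "?E \<union> (?L - ?E) = ?L" by blast
    show "finite (?L - ?E)" "finite ?E" using finL by auto
    show "?E \<inter> (?L - ?E) = {}" by blast
    show "\<tau> i y \<in> carrier S" if "i \<in> ?E \<union> (?L - ?E)" "y \<in> carrier S" for i y using that \<tau>c unfolding un by blast
    show "\<tau> i \<one> = \<one>" if "i \<in> ?E \<union> (?L - ?E)" for i using that \<gamma> unfolding un \<tau>_def by simp
    show "\<tau> i (x \<otimes> y) = \<tau> i x \<otimes> \<tau> i y" if "i \<in> ?E \<union> (?L - ?E)" "x \<in> carrier S" "y \<in> carrier S" for i x y
      using that \<gamma> unfolding un \<tau>_def by (simp add: act_mult nat_pow_distrib)
    show "(\<lambda>C. \<tau> C a) \<in> ?E \<union> (?L - ?E) \<rightarrow> carrier S" using \<tau>c a(1) by auto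
    show "(\<Oplus>i\<in>?E \<union> (?L - ?E). \<tau> i a \<otimes> \<tau> i y) \<in> Q" if "y \<in> carrier S" for y
      using dep[OF that] unfolding un .
    show "\<tau> i y \<ominus> y [^] ?q \<in> Q" if "i \<in> ?E" "y \<in> carrier S" for i y
      unfolding \<tau>_def using that \<gamma>
      by (intro pow_diff_mem[OF Q.is_ideal]) (auto simp: inertia_def)
    show "\<exists>y\<in>carrier S. y [^] ?q \<ominus> \<tau> j y \<notin> Q" if j: "j \<in> ?L - ?E" for j
    proof -
      have "\<gamma> j \<in> carrier G" "\<gamma> j \<notin> ?D" using j \<gamma> by auto
      then obtain y where y: "y \<in> carrier S" "\<phi> (\<gamma> j) y \<ominus> y \<notin> Q" by (auto simp: inertia_def)
      have c: "\<phi> (\<gamma> j) y \<in> carrier S" using y(1) \<open>\<gamma> j \<in> carrier G\<close> by simp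
      have "y [^] ?q \<ominus> \<tau> j y \<notin> Q"
        using Q.diff_frobenius_mem_imp[OF prime_p char_p y(1) c, of n] Q.diff_sym_mem[OF y(1) c] y(2)
        unfolding \<tau>_def by blast
      then show ?thesis using y(1) by blast
    qed
  qed auto
  have "(\<Oplus>C\<in>?E. a [^] ?q) \<ominus> (\<Oplus>C\<in>?E. \<tau> C a) \<in> Q"
  proof (rule Q.finsum_diff_mem)
    show "(\<lambda>C. a [^] ?q) \<in> ?E \<rightarrow> carrier S" "(\<lambda>C. \<tau> C a) \<in> ?E \<rightarrow> carrier S" using a(1) \<tau>c by auto
    show "a [^] ?q \<ominus> \<tau> C a \<in> Q" if "C \<in> ?E" for C
    proof -
      have g: "\<gamma> C \<in> carrier G" "\<phi> (\<gamma> C) a \<ominus> a \<in> Q" using that a(1) by (simp_all add: inertia_def)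
      then have "a \<ominus> \<phi> (\<gamma> C) a \<in> Q" using Q.diff_sym_mem[of "\<phi> (\<gamma> C) a" a] a(1) by simp
      then show ?thesis unfolding \<tau>_def using pow_diff_mem[OF Q.is_ideal a(1)] g a(1) by simp
    qed
  qed
  moreover have "(\<Oplus>C\<in>?E. a [^] ?q) \<in> carrier S" using a(1) by (intro finsum_closed) auto
  ultimately have A: "(\<Oplus>C\<in>?E. a [^] ?q) \<in> Q" using Q.mem_diff_imp[OF _ sum] by blast
  have B: "(\<Oplus>C\<in>?E. a [^] ?q) = add_pow S (card ?E) (a [^] ?q)"
    using add.finprod_const[of "a [^] ?q" ?E] a(1) by blast
  have "card ?E = card ?D div card H"
    using G.card_representatives_in[OF finite_group H(1) D H(2)] unfolding \<gamma>_def .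
  then have "add_pow S (card ?D div card H) (a [^] ?q) \<in> Q" using A unfolding B by (rule subst)
  then have "a [^] ?q \<in> Q" using add_pow_mem_imp[OF Q idx nat_pow_closed[OF a(1)]] by blast
  then show False using Q.pow_mem_imp a by blast
qed

end

section \<open>Linear functionals\<close>

text \<open>A subspace \<open>W \<supseteq> N\<close> that is maximal subject to \<open>x \<notin> W\<close> is a complement of the line spanned by \<open>x\<close>.
The functional reads off the coefficient of \<open>x\<close>.\<close>

lemma (in module) exists_functional:
  assumes fld: "field R" and N: "submodule N R M" and x: "x \<in> carrier M" "x \<notin> N"
  obtains f where "f \<in> carrier M \<rightarrow> carrier R"
    "\<And>y z. \<lbrakk>y \<in> carrier M; z \<in> carrier M\<rbrakk> \<Longrightarrow> f (y \<oplus>\<^bsub>M\<^esub> z) = f y \<oplus> f z"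
    "\<And>a y. \<lbrakk>a \<in> carrier R; y \<in> carrier M\<rbrakk> \<Longrightarrow> f (a \<odot>\<^bsub>M\<^esub> y) = a \<otimes> f y"
    "f x = \<one>" "\<And>y. y \<in> N \<Longrightarrow> f y = \<zero>"
proof -
  interpret k: field R by fact
  let ?C = "{W. submodule W R M \<and> N \<subseteq> W \<and> x \<notin> W}"
  have "\<exists>W\<in>?C. \<forall>Y\<in>?C. W \<subseteq> Y \<longrightarrow> Y = W"
  proof (rule subset_Zorn_nonempty)
    show "?C \<noteq> {}" using N x by auto
    fix \<C> assume ne: "\<C> \<noteq> {}" and ch: "subset.chain ?C \<C>"
    have C: "W \<in> ?C" if "W \<in> \<C>" for W using ch that by (auto simp: pred_on.chain_def)
    then have sub: "submodule W R M" if "W \<in> \<C>" for W using that by blast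
    have two: "\<exists>W\<in>\<C>. u \<in> W \<and> v \<in> W" if uv: "u \<in> \<Union>\<C>" "v \<in> \<Union>\<C>" for u v
    proof -
      obtain U V where UV: "U \<in> \<C>" "V \<in> \<C>" "u \<in> U" "v \<in> V" using uv by blast
      have "U \<subseteq> V \<or> V \<subseteq> U" using ch UV by (auto simp: pred_on.chain_def)
      then show ?thesis using UV by blast
    qed
    have "submodule (\<Union>\<C>) R M"
    proof (rule submoduleI)
      show "\<Union>\<C> \<subseteq> carrier M" using submoduleE(1)[OF sub] by (intro Union_least)
      show "\<zero>\<^bsub>M\<^esub> \<in> \<Union>\<C>" using ne subgroup.one_closed[OF submodule.axioms(1)[OF sub]] by auto
      show "\<ominus>\<^bsub>M\<^esub> a \<in> \<Union>\<C>" if "a \<in> \<Union>\<C>" for a using that submoduleE(3)[OF sub] by blast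
      show "a \<oplus>\<^bsub>M\<^esub> b \<in> \<Union>\<C>" if "a \<in> \<Union>\<C>" "b \<in> \<Union>\<C>" for a b
        using two[OF that] submoduleE(5)[OF sub] by blast
      show "a \<odot>\<^bsub>M\<^esub> v \<in> \<Union>\<C>" if "a \<in> carrier R" "v \<in> \<Union>\<C>" for a v
        using that submoduleE(4)[OF sub] by blast
    qed
    moreover have "N \<subseteq> \<Union>\<C>" using ne C by auto
    moreover have "x \<notin> \<Union>\<C>" using C by auto
    ultimately show "\<Union>\<C> \<in> ?C" by simp
  qed
  then obtain W where WC: "W \<in> ?C" and maxC: "\<forall>Y\<in>?C. W \<subseteq> Y \<longrightarrow> Y = W" by (elim bexE)
  have W: "submodule W R M" "N \<subseteq> W" "x \<notin> W" using WC by auto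
  have Wc: "w \<in> carrier M" if "w \<in> W" for w using submoduleE(1)[OF W(1)] that by blast
  note Wadd = submoduleE(5)[OF W(1)] and Wsmult = submoduleE(4)[OF W(1)] and Wminus = submoduleE(3)[OF W(1)]
  have W0: "\<zero>\<^bsub>M\<^esub> \<in> W" using subgroup.one_closed[OF submodule.axioms(1)[OF W(1)]] by simp
  define dec where "dec y c \<longleftrightarrow> c \<in> carrier R \<and> (\<exists>w\<in>W. y = w \<oplus>\<^bsub>M\<^esub> c \<odot>\<^bsub>M\<^esub> x)" for y c
  have ex: "\<exists>c. dec y c" if y: "y \<in> carrier M" for y
  proof (cases "y \<in> W")
    case True
    then have "dec y \<zero>" using y x by (auto simp: dec_def intro!: bexI[of _ y])
    then show ?thesis by blast
  next
    case False
    let ?Y = "{w \<oplus>\<^bsub>M\<^esub> c \<odot>\<^bsub>M\<^esub> y | w c. w \<in> W \<and> c \<in> carrier R}"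
    have "submodule ?Y R M"
    proof (rule submoduleI)
      show "?Y \<subseteq> carrier M" using y Wc by auto
      show "\<zero>\<^bsub>M\<^esub> \<in> ?Y"
      proof -
        have "\<zero>\<^bsub>M\<^esub> = \<zero>\<^bsub>M\<^esub> \<oplus>\<^bsub>M\<^esub> \<zero> \<odot>\<^bsub>M\<^esub> y" using y by simp
        then show ?thesis using W0 by blast
      qed
      show "\<ominus>\<^bsub>M\<^esub> a \<in> ?Y" if a: "a \<in> ?Y" for a
      proof -
        obtain w c where wc: "w \<in> W" "c \<in> carrier R" "a = w \<oplus>\<^bsub>M\<^esub> c \<odot>\<^bsub>M\<^esub> y" using a by blast
        have "\<ominus>\<^bsub>M\<^esub> a = (\<ominus>\<^bsub>M\<^esub> w) \<oplus>\<^bsub>M\<^esub> (\<ominus> c) \<odot>\<^bsub>M\<^esub> y"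
          using wc y Wc by (simp add: M.minus_add smult_l_minus)
        then show ?thesis using wc Wminus by blast
      qed
      show "a \<oplus>\<^bsub>M\<^esub> b \<in> ?Y" if a: "a \<in> ?Y" "b \<in> ?Y" for a b
      proof -
        obtain w c where wc: "w \<in> W" "c \<in> carrier R" "a = w \<oplus>\<^bsub>M\<^esub> c \<odot>\<^bsub>M\<^esub> y" using a by blast
        obtain w' c' where wc': "w' \<in> W" "c' \<in> carrier R" "b = w' \<oplus>\<^bsub>M\<^esub> c' \<odot>\<^bsub>M\<^esub> y" using a by blast
        have "a \<oplus>\<^bsub>M\<^esub> b = (w \<oplus>\<^bsub>M\<^esub> w') \<oplus>\<^bsub>M\<^esub> (c \<oplus> c') \<odot>\<^bsub>M\<^esub> y"
          using wc wc' y Wc by (simp add: smult_l_distr M.a_ac)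
        then show ?thesis using wc wc' Wadd by blast
      qed
      show "a \<odot>\<^bsub>M\<^esub> v \<in> ?Y" if a: "a \<in> carrier R" "v \<in> ?Y" for a v
      proof -
        obtain w c where wc: "w \<in> W" "c \<in> carrier R" "v = w \<oplus>\<^bsub>M\<^esub> c \<odot>\<^bsub>M\<^esub> y" using a by blast
        have "a \<odot>\<^bsub>M\<^esub> v = a \<odot>\<^bsub>M\<^esub> w \<oplus>\<^bsub>M\<^esub> (a \<otimes> c) \<odot>\<^bsub>M\<^esub> y"
          using wc y a Wc by (simp add: smult_r_distr smult_assoc1)
        then show ?thesis using wc a Wsmult by blast
      qed
    qed
    moreover have WY: "W \<subseteq> ?Y"
    proof
      fix w assume w: "w \<in> W"
      have "w = w \<oplus>\<^bsub>M\<^esub> \<zero> \<odot>\<^bsub>M\<^esub> y" using y Wc[OF w] by simp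
      then show "w \<in> ?Y" using w by blast
    qed
    moreover have "y \<in> ?Y"
    proof -
      have "y = \<zero>\<^bsub>M\<^esub> \<oplus>\<^bsub>M\<^esub> \<one> \<odot>\<^bsub>M\<^esub> y" using y by simp
      then show ?thesis using W0 by blast
    qed
    ultimately have "x \<in> ?Y" using maxC W False by blast
    then obtain w c where wc: "w \<in> W" "c \<in> carrier R" "x = w \<oplus>\<^bsub>M\<^esub> c \<odot>\<^bsub>M\<^esub> y" by blast
    have "c \<noteq> \<zero>" using wc W(3) y Wc by auto
    then have u: "inv c \<in> carrier R" "inv c \<otimes> c = \<one>" using wc by (auto simp: k.field_Units)
    have "inv c \<odot>\<^bsub>M\<^esub> x = inv c \<odot>\<^bsub>M\<^esub> w \<oplus>\<^bsub>M\<^esub> y"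
      using wc u y Wc[OF wc(1)] by (simp add: smult_r_distr flip: smult_assoc1)
    then have "y = (\<ominus>\<^bsub>M\<^esub> (inv c \<odot>\<^bsub>M\<^esub> w)) \<oplus>\<^bsub>M\<^esub> inv c \<odot>\<^bsub>M\<^esub> x"
      using u y Wc[OF wc(1)] x by (simp add: M.r_neg1)
    then have "dec y (inv c)" unfolding dec_def using u wc Wsmult Wminus by blast
    then show ?thesis by blast
  qed
  have uniq: "c = c'" if d: "dec y c" "dec y c'" for y c c'
  proof (rule ccontr)
    assume ne: "c \<noteq> c'"
    obtain w w' where w: "w \<in> W" "w' \<in> W" "y = w \<oplus>\<^bsub>M\<^esub> c \<odot>\<^bsub>M\<^esub> x" "y = w' \<oplus>\<^bsub>M\<^esub> c' \<odot>\<^bsub>M\<^esub> x"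
      and c: "c \<in> carrier R" "c' \<in> carrier R" using d by (auto simp: dec_def)
    have "c \<odot>\<^bsub>M\<^esub> x = (\<ominus>\<^bsub>M\<^esub> w \<oplus>\<^bsub>M\<^esub> w') \<oplus>\<^bsub>M\<^esub> c' \<odot>\<^bsub>M\<^esub> x"
    proof -
      have "c \<odot>\<^bsub>M\<^esub> x = \<ominus>\<^bsub>M\<^esub> w \<oplus>\<^bsub>M\<^esub> (w \<oplus>\<^bsub>M\<^esub> c \<odot>\<^bsub>M\<^esub> x)" using w Wc c x by (simp add: M.r_neg1)
      also have "\<dots> = \<ominus>\<^bsub>M\<^esub> w \<oplus>\<^bsub>M\<^esub> (w' \<oplus>\<^bsub>M\<^esub> c' \<odot>\<^bsub>M\<^esub> x)" using w by simp
      finally show ?thesis using w Wc c x by (simp add: M.a_assoc)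
    qed
    then have e: "(c \<ominus> c') \<odot>\<^bsub>M\<^esub> x = \<ominus>\<^bsub>M\<^esub> w \<oplus>\<^bsub>M\<^esub> w'"
      using w Wc c x by (simp add: R.minus_eq smult_l_distr smult_l_minus M.a_assoc M.r_neg)
    have nz: "c \<ominus> c' \<noteq> \<zero>" using ne c by simp
    then have u: "inv (c \<ominus> c') \<in> carrier R" "inv (c \<ominus> c') \<otimes> (c \<ominus> c') = \<one>"
      using c by (auto simp: k.field_Units)
    have "x = inv (c \<ominus> c') \<odot>\<^bsub>M\<^esub> ((c \<ominus> c') \<odot>\<^bsub>M\<^esub> x)" using u c x by (simp flip: smult_assoc1)
    also have "\<dots> \<in> W" unfolding e using u w by (intro Wsmult Wadd Wminus) auto
    finally show False using W(3) by blast
  qed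
  define f where "f y = (THE c. dec y c)" for y
  have f: "dec y (f y)" if "y \<in> carrier M" for y
    unfolding f_def using ex[OF that] uniq by (metis theI')
  have feq: "f y = c" if "dec y c" "y \<in> carrier M" for y c using uniq f that by blast
  show ?thesis
  proof (rule that)
    show "f \<in> carrier M \<rightarrow> carrier R" using f by (auto simp: dec_def)
    show "f (y \<oplus>\<^bsub>M\<^esub> z) = f y \<oplus> f z" if yz: "y \<in> carrier M" "z \<in> carrier M" for y z
    proof (rule feq)
      obtain w w' where w: "w \<in> W" "w' \<in> W" "y = w \<oplus>\<^bsub>M\<^esub> f y \<odot>\<^bsub>M\<^esub> x" "z = w' \<oplus>\<^bsub>M\<^esub> f z \<odot>\<^bsub>M\<^esub> x"
        and c: "f y \<in> carrier R" "f z \<in> carrier R" using f[OF yz(1)] f[OF yz(2)] unfolding dec_def by blast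
      have "(w \<oplus>\<^bsub>M\<^esub> f y \<odot>\<^bsub>M\<^esub> x) \<oplus>\<^bsub>M\<^esub> (w' \<oplus>\<^bsub>M\<^esub> f z \<odot>\<^bsub>M\<^esub> x) = (w \<oplus>\<^bsub>M\<^esub> w') \<oplus>\<^bsub>M\<^esub> (f y \<oplus> f z) \<odot>\<^bsub>M\<^esub> x"
        using w(1,2) c x Wc by (simp add: smult_l_distr M.a_ac)
      then have "y \<oplus>\<^bsub>M\<^esub> z = (w \<oplus>\<^bsub>M\<^esub> w') \<oplus>\<^bsub>M\<^esub> (f y \<oplus> f z) \<odot>\<^bsub>M\<^esub> x" using w by metis
      then show "dec (y \<oplus>\<^bsub>M\<^esub> z) (f y \<oplus> f z)" unfolding dec_def using c w Wadd by blast
    qed (use yz in simp)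
    show "f (a \<odot>\<^bsub>M\<^esub> y) = a \<otimes> f y" if a: "a \<in> carrier R" and y: "y \<in> carrier M" for a y
    proof (rule feq)
      obtain w where w: "w \<in> W" "y = w \<oplus>\<^bsub>M\<^esub> f y \<odot>\<^bsub>M\<^esub> x" and c: "f y \<in> carrier R"
        using f[OF y] unfolding dec_def by blast
      have "a \<odot>\<^bsub>M\<^esub> (w \<oplus>\<^bsub>M\<^esub> f y \<odot>\<^bsub>M\<^esub> x) = a \<odot>\<^bsub>M\<^esub> w \<oplus>\<^bsub>M\<^esub> (a \<otimes> f y) \<odot>\<^bsub>M\<^esub> x"
        using w(1) c x a Wc by (simp add: smult_r_distr smult_assoc1)
      then have "a \<odot>\<^bsub>M\<^esub> y = a \<odot>\<^bsub>M\<^esub> w \<oplus>\<^bsub>M\<^esub> (a \<otimes> f y) \<odot>\<^bsub>M\<^esub> x" using w by metis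
      then show "dec (a \<odot>\<^bsub>M\<^esub> y) (a \<otimes> f y)" unfolding dec_def using a c w Wsmult by blast
    qed (use a y in simp)
    show "f x = \<one>" using W0 x by (intro feq) (auto simp: dec_def intro!: bexI[of _ "\<zero>\<^bsub>M\<^esub>"])
    show "f y = \<zero>" if "y \<in> N" for y
      using that W(2) Wc[of y] x by (intro feq) (auto simp: dec_def intro!: bexI[of _ y])
  qed
qed

section \<open>Invariants without split injections\<close>

locale modular_algebra_action = modular_ring_action S G \<phi> p
  for S :: "('k, 's, 'n) module_scheme" (structure) and G :: "('g, 'l) monoid_scheme" (structure)
    and \<phi> :: "'g \<Rightarrow> 's \<Rightarrow> 's" and p :: nat +
  fixes k :: "('k, 'm) ring_scheme"
  assumes field_k: "field k" and algebra_S: "algebra k S"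
    and act_smult: "\<lbrakk>g \<in> carrier G; a \<in> carrier k; x \<in> carrier S\<rbrakk>
      \<Longrightarrow> \<phi> g (a \<odot>\<^bsub>S\<^esub> x) = a \<odot>\<^bsub>S\<^esub> \<phi> g x"
    and char_k: "add_pow k (n::nat) \<one>\<^bsub>k\<^esub> = \<zero>\<^bsub>k\<^esub> \<longleftrightarrow> p dvd n"

sublocale modular_algebra_action \<subseteq> k: field k
  by (rule field_k)

sublocale modular_algebra_action \<subseteq> A: algebra k S
  by (rule algebra_S)

lemma regular_module_simps [simp]:
  "carrier (regular_module k) = carrier k"
  "x \<oplus>\<^bsub>regular_module k\<^esub> y = x \<oplus>\<^bsub>k\<^esub> y"
  "a \<odot>\<^bsub>regular_module k\<^esub> x = a \<otimes>\<^bsub>k\<^esub> x"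
  by (simp_all add: regular_module_def)

context modular_algebra_action
begin

abbreviation functionals :: "('s \<Rightarrow> 'k) set"
  where "functionals \<equiv> kG_hom k G S \<phi> (regular_module k) trivial_action"

lemma functionalI:
  assumes "\<And>x. x \<in> carrier S \<Longrightarrow> r x \<in> carrier k"
    and "\<And>x y. \<lbrakk>x \<in> carrier S; y \<in> carrier S\<rbrakk> \<Longrightarrow> r (x \<oplus> y) = r x \<oplus>\<^bsub>k\<^esub> r y"
    and "\<And>a x. \<lbrakk>a \<in> carrier k; x \<in> carrier S\<rbrakk> \<Longrightarrow> r (a \<odot>\<^bsub>S\<^esub> x) = a \<otimes>\<^bsub>k\<^esub> r x"
    and "\<And>g x. \<lbrakk>g \<in> carrier G; x \<in> carrier S\<rbrakk> \<Longrightarrow> r (\<phi> g x) = r x"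
  shows "r \<in> functionals"
  using assms by (simp add: kG_hom_def)

lemma functionalD:
  assumes "r \<in> functionals"
  shows "x \<in> carrier S \<Longrightarrow> r x \<in> carrier k"
    and "\<lbrakk>x \<in> carrier S; y \<in> carrier S\<rbrakk> \<Longrightarrow> r (x \<oplus> y) = r x \<oplus>\<^bsub>k\<^esub> r y"
    and "\<lbrakk>a \<in> carrier k; x \<in> carrier S\<rbrakk> \<Longrightarrow> r (a \<odot>\<^bsub>S\<^esub> x) = a \<otimes>\<^bsub>k\<^esub> r x"
    and "\<lbrakk>g \<in> carrier G; x \<in> carrier S\<rbrakk> \<Longrightarrow> r (\<phi> g x) = r x"
  using assms by (auto simp: kG_hom_def)

lemma functional_zero: "r \<in> functionals \<Longrightarrow> r \<zero> = \<zero>\<^bsub>k\<^esub>"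
  using functionalD(3)[of r "\<zero>\<^bsub>k\<^esub>" \<zero>] functionalD(1)[of r \<zero>] by (simp add: A.smult_l_null)

lemma functional_finsum:
  assumes r: "r \<in> functionals" and f: "f \<in> A \<rightarrow> carrier S"
  shows "r (\<Oplus>i\<in>A. f i) = (\<Oplus>\<^bsub>k\<^esub>i\<in>A. r (f i))"
  using finprod_hom[OF a_comm_monoid k.a_comm_monoid, of f A r] f functionalD[OF r] functional_zero[OF r]
  by (simp add: finsum_def Pi_def)

text \<open>A retraction of \<open>h : k \<rightarrow> S\<close> is a \<open>G\<close>-invariant functional with value \<open>1\<close> at \<open>h(1)\<close>, and over a field a
functional with nonzero value can be rescaled to one. This description makes it evident that the
non-split invariants are closed under addition.\<close>

lemma nonsplit_ideal_iff:
  "x \<in> nonsplit_ideal k S G \<phi> \<longleftrightarrow> x \<in> invariants_set \<and> (\<forall>r\<in>functionals. r x = \<zero>\<^bsub>k\<^esub>)"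
proof
  assume "x \<in> nonsplit_ideal k S G \<phi>"
  then obtain h where x: "x = h \<one>\<^bsub>k\<^esub>" and h: "h \<in> kG_hom k G (regular_module k) trivial_action S \<phi>"
    and ns: "\<not> split_injective k G (regular_module k) trivial_action S \<phi> h"
    by (auto simp: nonsplit_ideal_def)
  have xS: "x \<in> carrier S" using h x by (auto simp: kG_hom_def)
  have "\<phi> g x = x" if "g \<in> carrier G" for g
    using h x that by (auto simp: kG_hom_def)
  then have inv: "x \<in> invariants_set" using xS by (simp add: fixed_points_def)
  have ha: "h a = a \<odot>\<^bsub>S\<^esub> x" if "a \<in> carrier k" for a
  proof -
    have "h (a \<otimes>\<^bsub>k\<^esub> b) = a \<odot>\<^bsub>S\<^esub> h b" if "a \<in> carrier k" "b \<in> carrier k" for a b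
      using h that by (simp add: kG_hom_def)
    from this[OF that k.one_closed] show ?thesis using that x by simp
  qed
  have "r x = \<zero>\<^bsub>k\<^esub>" if r: "r \<in> functionals" for r
  proof (rule ccontr)
    assume nz: "r x \<noteq> \<zero>\<^bsub>k\<^esub>"
    have rx: "r x \<in> carrier k" using functionalD(1)[OF r xS] .
    have u: "inv\<^bsub>k\<^esub> r x \<in> carrier k" "inv\<^bsub>k\<^esub> r x \<otimes>\<^bsub>k\<^esub> r x = \<one>\<^bsub>k\<^esub>"
      using nz rx by (auto simp: k.field_Units)
    let ?r = "\<lambda>y. inv\<^bsub>k\<^esub> r x \<otimes>\<^bsub>k\<^esub> r y"
    have "?r \<in> functionals"
      using functionalD[OF r] u by (intro functionalI) (auto simp: k.r_distr k.m_lcomm)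
    moreover have "?r (h a) = a" if "a \<in> carrier k" for a
    proof -
      have "?r (h a) = a \<otimes>\<^bsub>k\<^esub> (inv\<^bsub>k\<^esub> r x \<otimes>\<^bsub>k\<^esub> r x)"
        using ha[OF that] functionalD(3)[OF r that xS] u(1) rx that by (simp add: k.m_lcomm)
      then show ?thesis using u that by simp
    qed
    ultimately show False using ns h by (auto simp: split_injective_def)
  qed
  with inv show "x \<in> invariants_set \<and> (\<forall>r\<in>functionals. r x = \<zero>\<^bsub>k\<^esub>)" by blast
next
  assume x: "x \<in> invariants_set \<and> (\<forall>r\<in>functionals. r x = \<zero>\<^bsub>k\<^esub>)"
  then have xS: "x \<in> carrier S" using fixedD(1) by blast
  define h where "h a = a \<odot>\<^bsub>S\<^esub> x" for a
  have h: "h \<in> kG_hom k G (regular_module k) trivial_action S \<phi>"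
    using xS x fixedD(2) by (auto simp: kG_hom_def h_def A.smult_l_distr A.smult_assoc1 act_smult)
  have h1: "h \<one>\<^bsub>k\<^esub> = x" using xS by (simp add: h_def)
  have "\<not> split_injective k G (regular_module k) trivial_action S \<phi> h"
  proof
    assume "split_injective k G (regular_module k) trivial_action S \<phi> h"
    then obtain r where "r \<in> functionals" "r (h \<one>\<^bsub>k\<^esub>) = \<one>\<^bsub>k\<^esub>" by (auto simp: split_injective_def)
    moreover have "r (h \<one>\<^bsub>k\<^esub>) = \<zero>\<^bsub>k\<^esub>" using x h1 \<open>r \<in> functionals\<close> by blast
    ultimately show False by simp
  qed
  then show "x \<in> nonsplit_ideal k S G \<phi>" using h h1 unfolding nonsplit_ideal_def by blast
qed

lemma nonsplit_ideal_is_ideal: "ideal (nonsplit_ideal k S G \<phi>) inv_ring"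
proof -
  let ?J = "nonsplit_ideal k S G \<phi>"
  have mult: "s \<otimes> y \<in> ?J" if s: "s \<in> invariants_set" and y: "y \<in> ?J" for s y
    unfolding nonsplit_ideal_iff
  proof (intro conjI ballI)
    have yi: "y \<in> invariants_set" using y nonsplit_ideal_iff by blast
    note c = fixedD(1)[OF s] fixedD(1)[OF yi]
    show "s \<otimes> y \<in> invariants_set" using s yi fixed_closed(4) by blast
    fix r assume r: "r \<in> functionals"
    \<comment> \<open>A functional composed with multiplication by an invariant is again an invariant functional.\<close>
    have "(\<lambda>z. r (s \<otimes> z)) \<in> functionals"
    proof (rule functionalI)
      show "r (s \<otimes> z) \<in> carrier k" if "z \<in> carrier S" for z using that c functionalD(1)[OF r] by simp
      show "r (s \<otimes> (z \<oplus> z')) = r (s \<otimes> z) \<oplus>\<^bsub>k\<^esub> r (s \<otimes> z')" if "z \<in> carrier S" "z' \<in> carrier S" for z z'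
        using that c functionalD(2)[OF r] by (simp add: r_distr)
      show "r (s \<otimes> (a \<odot>\<^bsub>S\<^esub> z)) = a \<otimes>\<^bsub>k\<^esub> r (s \<otimes> z)" if "a \<in> carrier k" "z \<in> carrier S" for a z
      proof -
        have "s \<otimes> (a \<odot>\<^bsub>S\<^esub> z) = a \<odot>\<^bsub>S\<^esub> (s \<otimes> z)"
          using that c A.smult_assoc2[of a z s] by (simp add: m_comm)
        then show ?thesis using that c functionalD(3)[OF r] by simp
      qed
      show "r (s \<otimes> \<phi> g z) = r (s \<otimes> z)" if "g \<in> carrier G" "z \<in> carrier S" for g z
        using that c functionalD(4)[OF r, of g "s \<otimes> z"] fixedD(2)[OF s, of g] by (simp add: act_mult)
    qed
    then show "r (s \<otimes> y) = \<zero>\<^bsub>k\<^esub>"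
      using y[unfolded nonsplit_ideal_iff, THEN conjunct2, rule_format, of "\<lambda>z. r (s \<otimes> z)"] by simp
  qed
  have inv: "y \<in> invariants_set" if "y \<in> ?J" for y using that nonsplit_ideal_iff by blast
  have add: "y \<oplus> z \<in> ?J" if "y \<in> ?J" "z \<in> ?J" for y z
    unfolding nonsplit_ideal_iff
  proof (intro conjI ballI)
    show "y \<oplus> z \<in> invariants_set" using inv that fixed_closed(3) by blast
    show "r (y \<oplus> z) = \<zero>\<^bsub>k\<^esub>" if r: "r \<in> functionals" for r
      using functionalD(2)[OF r fixedD(1)[OF inv[OF \<open>y \<in> ?J\<close>]] fixedD(1)[OF inv[OF \<open>z \<in> ?J\<close>]]]
        nonsplit_ideal_iff[THEN iffD1, OF \<open>y \<in> ?J\<close>, THEN conjunct2, rule_format, OF r]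
        nonsplit_ideal_iff[THEN iffD1, OF \<open>z \<in> ?J\<close>, THEN conjunct2, rule_format, OF r]
      by simp
  qed
  have zero: "\<zero> \<in> ?J"
    using functional_zero fixed_closed(1) by (auto simp: nonsplit_ideal_iff)
  show ?thesis
    using inv by (intro inv_ring_idealI zero add mult) auto
qed

lemma k_add_pow_zero:
  assumes "p dvd n" "c \<in> carrier k"
  shows "add_pow k n c = \<zero>\<^bsub>k\<^esub>"
  using k.add_pow_ldistr[of "\<one>\<^bsub>k\<^esub>" c n] char_k[of n] assms by simp

text \<open>An invariant functional takes the same value on all \<open>|G:H|\<close> summands of a transfer.\<close>

lemma brauer_subset_nonsplit: "brauer_ideal p S G \<phi> \<subseteq> nonsplit_ideal k S G \<phi>"
proof
  fix y assume y: "y \<in> brauer_ideal p S G \<phi>"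
  let ?P = "p_index_subgroups p G"
  obtain x where x: "\<forall>H\<in>?P. x H \<in> fixed_points S \<phi> H"
    and yx: "y = (\<Oplus>H\<in>?P. transfer S G \<phi> H (x H))" using y brauer_idealE by blast
  note c = brauer_transfer_closed[OF x]
  have "r y = \<zero>\<^bsub>k\<^esub>" if r: "r \<in> functionals" for r
  proof -
    have tr: "r (transfer S G \<phi> H (x H)) = \<zero>\<^bsub>k\<^esub>" if H: "H \<in> ?P" for H
    proof -
      have s: "(SOME g. g \<in> C) \<in> carrier G" if "C \<in> lcosets\<^bsub>G\<^esub> H" for C
        using G.lcoset_some_carrier(2)[OF c(1)[OF H] that] .
      have rx: "r (x H) \<in> carrier k" using functionalD(1)[OF r c(2)[OF H]] .
      have "r (transfer S G \<phi> H (x H)) = (\<Oplus>\<^bsub>k\<^esub>C\<in>lcosets\<^bsub>G\<^esub> H. r (\<phi> (SOME g. g \<in> C) (x H)))"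
        unfolding transfer_def using s c(2)[OF H] by (intro functional_finsum[OF r]) auto
      also have "\<dots> = (\<Oplus>\<^bsub>k\<^esub>C\<in>lcosets\<^bsub>G\<^esub> H. r (x H))"
        using s c(2)[OF H] functionalD(4)[OF r] rx by (intro k.finsum_cong') auto
      also have "\<dots> = add_pow k (card (lcosets\<^bsub>G\<^esub> H)) (r (x H))"
        using k.add.finprod_const[OF rx] .
      also have "\<dots> = \<zero>\<^bsub>k\<^esub>" using H rx by (intro k_add_pow_zero) (auto simp: p_index_subgroups_def)
      finally show ?thesis .
    qed
    have "r y = (\<Oplus>\<^bsub>k\<^esub>H\<in>?P. r (transfer S G \<phi> H (x H)))"
      unfolding yx using c by (intro functional_finsum[OF r]) auto
    also have "\<dots> = \<zero>\<^bsub>k\<^esub>"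
      using tr by (intro k.add.finprod_one_eqI) auto
    finally show ?thesis .
  qed
  moreover have "y \<in> invariants_set"
    using y ideal.Icarr[OF brauer_ideal_is_ideal] by fastforce
  ultimately show "y \<in> nonsplit_ideal k S G \<phi>" by (simp add: nonsplit_ideal_iff)
qed

lemma ideal_submodule:
  assumes Q: "ideal Q S"
  shows "submodule Q k S"
proof -
  interpret Q: ideal Q S by fact
  show ?thesis
  proof (rule A.submoduleI)
    show "Q \<subseteq> carrier S" using Q.Icarr by blast
    show "\<zero> \<in> Q" using additive_subgroup.zero_closed[OF Q.additive_subgroup_axioms] .
    show "\<ominus> a \<in> Q" if "a \<in> Q" for a using that by simp
    show "a \<oplus> b \<in> Q" if "a \<in> Q" "b \<in> Q" for a b
      using additive_subgroup.a_closed[OF Q.additive_subgroup_axioms that] .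
    show "a \<odot>\<^bsub>S\<^esub> x \<in> Q" if "a \<in> carrier k" "x \<in> Q" for a x
      using A.smult_assoc2[of a \<one> x] that Q.Icarr[OF that(2)] Q.I_l_closed[OF that(2), of "a \<odot>\<^bsub>S\<^esub> \<one>"] by simp
  qed
qed

text \<open>An invariant outside \<open>Q\<close> is detected by a \<open>P\<close>-invariant functional that factors through \<open>S/Q\<close>. Summing
its translates over the cosets of \<open>P\<close> makes it \<open>G\<close>-invariant and multiplies its value by \<open>|G:P|\<close>.\<close>

theorem nonsplit_subset_prime:
  assumes Q: "primeideal Q S" and P: "subgroup P G" "P \<subseteq> inertia Q"
    and idx: "\<not> p dvd card (lcosets\<^bsub>G\<^esub> P)"
  shows "nonsplit_ideal k S G \<phi> \<subseteq> Q"
proof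
  fix x assume x: "x \<in> nonsplit_ideal k S G \<phi>"
  interpret Q: primeideal Q S by fact
  let ?L = "lcosets\<^bsub>G\<^esub> P"
  have xi: "x \<in> invariants_set" using x nonsplit_ideal_iff by blast
  have xS: "x \<in> carrier S" using fixedD(1)[OF xi] .
  show "x \<in> Q"
  proof (rule ccontr)
    assume xQ: "x \<notin> Q"
    obtain f where fc: "f \<in> carrier S \<rightarrow> carrier k"
      and fadd: "\<And>y z. \<lbrakk>y \<in> carrier S; z \<in> carrier S\<rbrakk> \<Longrightarrow> f (y \<oplus> z) = f y \<oplus>\<^bsub>k\<^esub> f z"
      and fsm: "\<And>a y. \<lbrakk>a \<in> carrier k; y \<in> carrier S\<rbrakk> \<Longrightarrow> f (a \<odot>\<^bsub>S\<^esub> y) = a \<otimes>\<^bsub>k\<^esub> f y"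
      and fx: "f x = \<one>\<^bsub>k\<^esub>" and fQ: "\<And>y. y \<in> Q \<Longrightarrow> f y = \<zero>\<^bsub>k\<^esub>"
      using A.exists_functional[OF field_k ideal_submodule[OF Q.is_ideal] xS xQ] by blast
    have fS: "f y \<in> carrier k" if "y \<in> carrier S" for y using fc that by blast
    have fP: "f (\<phi> h y) = f y" if h: "h \<in> P" and y: "y \<in> carrier S" for h y
    proof -
      have hc: "h \<in> carrier G" using subgroup.mem_carrier[OF P(1) h] .
      have d: "\<phi> h y \<ominus> y \<in> Q" using P(2) h y by (auto simp: inertia_def)
      have "\<phi> h y = (\<phi> h y \<ominus> y) \<oplus> y" using hc y by (simp add: minus_eq a_assoc l_neg)
      then have "f (\<phi> h y) = f (\<phi> h y \<ominus> y) \<oplus>\<^bsub>k\<^esub> f y" using fadd[of "\<phi> h y \<ominus> y" y] hc y by simp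
      then show ?thesis using fQ[OF d] fS[OF y] by simp
    qed
    \<comment> \<open>The inverse makes the summand depend on the left coset \<open>gP\<close> only.\<close>
    define r where "r y = (\<Oplus>\<^bsub>k\<^esub>C\<in>?L. f (\<phi> (inv\<^bsub>G\<^esub> (SOME g. g \<in> C)) y))" for y
    have s: "inv\<^bsub>G\<^esub> (SOME g. g \<in> C) \<in> carrier G" "(SOME g. g \<in> C) \<in> carrier G" if "C \<in> ?L" for C
      using G.lcoset_some_carrier(2)[OF P(1) that] by simp_all
    have tc: "(\<lambda>C. f (\<phi> (inv\<^bsub>G\<^esub> (SOME g. g \<in> C)) y)) \<in> ?L \<rightarrow> carrier k" if "y \<in> carrier S" for y
      using that s fS by auto
    have finL: "finite ?L" using finite_group by (auto simp: LCOSETS_def)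
    have "r \<in> functionals"
    proof (rule functionalI)
      show "r y \<in> carrier k" if "y \<in> carrier S" for y unfolding r_def using tc[OF that] by (rule k.finsum_closed)
      show "r (y \<oplus> z) = r y \<oplus>\<^bsub>k\<^esub> r z" if yz: "y \<in> carrier S" "z \<in> carrier S" for y z
      proof -
        have "r (y \<oplus> z) = (\<Oplus>\<^bsub>k\<^esub>C\<in>?L. f (\<phi> (inv\<^bsub>G\<^esub> (SOME g. g \<in> C)) y) \<oplus>\<^bsub>k\<^esub> f (\<phi> (inv\<^bsub>G\<^esub> (SOME g. g \<in> C)) z))"
          unfolding r_def using yz s fS by (intro k.finsum_cong') (auto simp: act_add fadd)
        then show ?thesis unfolding r_def using k.finsum_addf[OF tc[OF yz(1)] tc[OF yz(2)]] by simp
      qed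
      show "r (a \<odot>\<^bsub>S\<^esub> y) = a \<otimes>\<^bsub>k\<^esub> r y" if ay: "a \<in> carrier k" "y \<in> carrier S" for a y
      proof -
        have "r (a \<odot>\<^bsub>S\<^esub> y) = (\<Oplus>\<^bsub>k\<^esub>C\<in>?L. a \<otimes>\<^bsub>k\<^esub> f (\<phi> (inv\<^bsub>G\<^esub> (SOME g. g \<in> C)) y))"
          unfolding r_def using ay s fS by (intro k.finsum_cong') (auto simp: act_smult fsm)
        then show ?thesis unfolding r_def using k.finsum_rdistr[OF finL ay(1) tc[OF ay(2)]] by simp
      qed
      show "r (\<phi> u y) = r y" if u: "u \<in> carrier G" and y: "y \<in> carrier S" for u y
      proof -
        define F where "F g = f (\<phi> (inv\<^bsub>G\<^esub> g) y)" for g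
        have F1: "F (g \<otimes>\<^bsub>G\<^esub> h) = F g" if "g \<in> carrier G" "h \<in> P" for g h
        proof -
          have hc: "h \<in> carrier G" using subgroup.mem_carrier[OF P(1) that(2)] .
          have "F (g \<otimes>\<^bsub>G\<^esub> h) = f (\<phi> (inv\<^bsub>G\<^esub> h) (\<phi> (inv\<^bsub>G\<^esub> g) y))"
            using that hc y by (simp add: F_def G.inv_mult_group act_comp)
          then show ?thesis
            using fP[OF subgroup.m_inv_closed[OF P(1) that(2)]] that y by (simp add: F_def)
        qed
        have F2: "F \<in> carrier G \<rightarrow> carrier k" using fS y by (auto simp: F_def)
        have "r (\<phi> u y) = (\<Oplus>\<^bsub>k\<^esub>C\<in>?L. F (inv\<^bsub>G\<^esub> u \<otimes>\<^bsub>G\<^esub> (SOME g. g \<in> C)))"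
          unfolding r_def F_def using u y s fS
          by (intro k.finsum_cong') (auto simp: G.inv_mult_group act_comp)
        also have "\<dots> = (\<Oplus>\<^bsub>k\<^esub>C\<in>?L. F (SOME g. g \<in> C))"
          using k.add.finprod_lcosets_translate[OF G.is_group P(1), of "inv\<^bsub>G\<^esub> u" F] u F1 F2
          by (simp add: finsum_def)
        finally show ?thesis by (simp add: r_def F_def)
      qed
    qed
    then have "r x = \<zero>\<^bsub>k\<^esub>" using x nonsplit_ideal_iff by blast
    moreover have "r x = (\<Oplus>\<^bsub>k\<^esub>C\<in>?L. \<one>\<^bsub>k\<^esub>)"
      unfolding r_def using s fixedD(2)[OF xi] fx by (intro k.finsum_cong') auto
    moreover have "(\<Oplus>\<^bsub>k\<^esub>C\<in>?L. \<one>\<^bsub>k\<^esub>) = add_pow k (card ?L) \<one>\<^bsub>k\<^esub>"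
      using k.add.finprod_const[OF k.one_closed] .
    ultimately show False using char_k[of "card ?L"] idx by simp
  qed
qed

end

section \<open>Primes of a quotient ring\<close>

context cring
begin

lemma coset_eq_iff:
  "\<lbrakk>ideal I R; a \<in> carrier R; b \<in> carrier R\<rbrakk> \<Longrightarrow> I +> a = I +> b \<longleftrightarrow> a \<ominus> b \<in> I"
  using quotient_eq_iff_same_a_r_cos by blast

lemma coset_mem_image_iff:
  assumes I: "ideal I R" and q: "ideal q R" "I \<subseteq> q" and x: "x \<in> carrier R"
  shows "I +> x \<in> (+>) I ` q \<longleftrightarrow> x \<in> q"
proof
  interpret q: ideal q R by fact
  assume "I +> x \<in> (+>) I ` q"
  then obtain y where y: "y \<in> q" "I +> x = I +> y" by auto
  then have "x \<ominus> y \<in> q" using coset_eq_iff[OF I x q.Icarr[OF y(1)]] q by blast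
  then show "x \<in> q" using q.mem_diff_imp x y by blast
qed blast

lemma quot_carrierE:
  assumes "X' \<in> carrier (R Quot I)"
  obtains x where "x \<in> carrier R" "X' = I +> x"
  using assms by (auto simp: FactRing_def A_RCOSETS_def RCOSETS_def a_r_coset_def)

lemma quotient_prime:
  assumes I: "ideal I R" and q: "primeideal q R" "I \<subseteq> q"
  shows "primeideal ((+>) I ` q) (R Quot I)"
proof -
  interpret I: ideal I R by fact
  interpret q: primeideal q R by fact
  interpret h: ring_hom_ring R "R Quot I" "(+>) I" by (rule I.rcos_ring_hom_ring)
  note mem = coset_mem_image_iff[OF I q.is_ideal q(2)]
  show ?thesis
  proof (rule primeidealI)
    show "ideal ((+>) I ` q) (R Quot I)" using ring_ideal_imp_quot_ideal[OF I q.is_ideal] .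
    show "cring (R Quot I)" using I.quotient_is_cring is_cring by blast
    show "carrier (R Quot I) \<noteq> (+>) I ` q"
      using mem[OF one_closed] h.hom_closed[OF one_closed] q.one_imp_carrier q.I_notcarr by auto
    fix a b assume ab: "a \<in> carrier (R Quot I)" "b \<in> carrier (R Quot I)"
      "a \<otimes>\<^bsub>R Quot I\<^esub> b \<in> (+>) I ` q"
    obtain x y where x: "x \<in> carrier R" "a = I +> x" and y: "y \<in> carrier R" "b = I +> y"
      using ab quot_carrierE by metis
    have "I +> (x \<otimes> y) \<in> (+>) I ` q" using ab(3) x y by simp
    then have "x \<otimes> y \<in> q" by (rule iffD1[OF mem[OF m_closed[OF x(1) y(1)]]])
    then show "a \<in> (+>) I ` q \<or> b \<in> (+>) I ` q" using q.I_prime x y by auto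
  qed
qed

lemma prime_of_quotient:
  assumes I: "ideal I R" and J: "primeideal J (R Quot I)"
  obtains q where "primeideal q R" "I \<subseteq> q" "J = (+>) I ` q"
proof -
  interpret I: ideal I R by fact
  interpret J: primeideal J "R Quot I" by fact
  interpret h: ring_hom_ring R "R Quot I" "(+>) I" by (rule I.rcos_ring_hom_ring)
  let ?q = "{x \<in> carrier R. I +> x \<in> J}"
  have Jc: "J \<subseteq> carrier (R Quot I)" using J.Icarr by blast
  have "primeideal ?q R"
  proof (rule primeidealI)
    show "ideal ?q R" using h.ideal_vimage[OF J.is_ideal] .
    show "cring R" by (rule is_cring)
    show "carrier R \<noteq> ?q"
    proof
      assume "carrier R = ?q"
      then have "I +> \<one> \<in> J" using one_closed by blast
      then show False using J.one_imp_carrier J.I_notcarr by simp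
    qed
    show "x \<in> ?q \<or> y \<in> ?q" if "x \<in> carrier R" "y \<in> carrier R" "x \<otimes> y \<in> ?q" for x y
      using that J.I_prime[of "I +> x" "I +> y"] h.hom_closed by auto
  qed
  moreover have "I \<subseteq> ?q"
  proof
    fix x assume x: "x \<in> I"
    have "\<zero>\<^bsub>R Quot I\<^esub> \<in> J" using additive_subgroup.zero_closed[OF J.additive_subgroup_axioms] .
    moreover have "I +> x = I" by (rule a_rcos_zero[OF I x])
    moreover have "\<zero>\<^bsub>R Quot I\<^esub> = I" unfolding FactRing_def by simp
    ultimately have "I +> x \<in> J" by (simp only:)
    then show "x \<in> ?q" using I.Icarr[OF x] by blast
  qed
  moreover have "J = (+>) I ` ?q"
  proof
    show "J \<subseteq> (+>) I ` ?q"
    proof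
      fix Y assume Y: "Y \<in> J"
      then obtain x where "x \<in> carrier R" "Y = I +> x" using Jc quot_carrierE by blast
      then show "Y \<in> (+>) I ` ?q" using Y by auto
    qed
  qed auto
  ultimately show ?thesis using that by blast
qed

end

section \<open>Zariski topology and chains of primes\<close>

lemma quotient_maps_homeomorphic:
  assumes f: "quotient_map T Y f" and g: "quotient_map T Z g"
    and eq: "\<And>x y. \<lbrakk>x \<in> topspace T; y \<in> topspace T\<rbrakk> \<Longrightarrow> f x = f y \<longleftrightarrow> g x = g y"
  shows "Y homeomorphic_space Z"
proof -
  obtain u where u: "continuous_map Y Z u" "\<And>x. x \<in> topspace T \<Longrightarrow> u (f x) = g x"
    using quotient_map_lift_exists[OF f quotient_imp_continuous_map[OF g]] eq by metis
  obtain v where v: "continuous_map Z Y v" "\<And>x. x \<in> topspace T \<Longrightarrow> v (g x) = f x"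
    using quotient_map_lift_exists[OF g quotient_imp_continuous_map[OF f]] eq by metis
  have "v (u y) = y" if "y \<in> topspace Y" for y
    using that u(2) v(2) unfolding quotient_imp_surjective_map[OF f, symmetric] by auto
  moreover have "u (v z) = z" if "z \<in> topspace Z" for z
    using that u(2) v(2) unfolding quotient_imp_surjective_map[OF g, symmetric] by auto
  ultimately have "homeomorphic_maps Y Z u v"
    unfolding homeomorphic_maps_def using u(1) v(1) by blast
  then show ?thesis unfolding homeomorphic_space_def by blast
qed

lemma topspace_zariski: "topspace (zariski R) = prime_spectrum R"
proof -
  have "prime_spectrum R = {J \<in> prime_spectrum R. \<not> carrier R \<subseteq> J}"
  proof -
    have "\<not> carrier R \<subseteq> J" if "primeideal J R" for J
    proof -
      interpret primeideal J R by fact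
      show ?thesis using I_notcarr Icarr by blast
    qed
    then show ?thesis by (auto simp: prime_spectrum_def)
  qed
  then have "openin (zariski R) (prime_spectrum R)" unfolding openin_zariski by blast
  moreover have "topspace (zariski R) \<subseteq> prime_spectrum R"
    using openin_topspace[of "zariski R"] unfolding openin_zariski by blast
  ultimately show ?thesis using openin_subset by blast
qed

lemma closedin_zariski:
  "closedin (zariski R) C \<longleftrightarrow> (\<exists>A\<subseteq>carrier R. C = {J \<in> prime_spectrum R. A \<subseteq> J})"
proof
  assume "closedin (zariski R) C"
  then obtain A where A: "A \<subseteq> carrier R" "prime_spectrum R - C = {J \<in> prime_spectrum R. \<not> A \<subseteq> J}"
    and C: "C \<subseteq> prime_spectrum R"
    by (auto simp: closedin_def topspace_zariski openin_zariski)
  then have "C = {J \<in> prime_spectrum R. A \<subseteq> J}" by blast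
  then show "\<exists>A\<subseteq>carrier R. C = {J \<in> prime_spectrum R. A \<subseteq> J}" using A by blast
next
  assume "\<exists>A\<subseteq>carrier R. C = {J \<in> prime_spectrum R. A \<subseteq> J}"
  then obtain A where A: "A \<subseteq> carrier R" "C = {J \<in> prime_spectrum R. A \<subseteq> J}" by blast
  then have "prime_spectrum R - C = {J \<in> prime_spectrum R. \<not> A \<subseteq> J}" by blast
  then show "closedin (zariski R) C"
    using A by (auto simp: closedin_def topspace_zariski openin_zariski)
qed

definition chain_of_length :: "'a set set \<Rightarrow> nat \<Rightarrow> (nat \<Rightarrow> 'a set) \<Rightarrow> bool"
  where "chain_of_length \<C> n c \<longleftrightarrow> (\<forall>i\<le>n. c i \<in> \<C>) \<and> (\<forall>i<n. c i \<subset> c (Suc i))"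

lemma chain_dim_cong:
  assumes "\<And>n. (\<exists>c. chain_of_length \<C> n c) \<longleftrightarrow> (\<exists>c. chain_of_length \<D> n c)"
  shows "chain_dim \<C> = chain_dim \<D>"
  using assms by (simp add: chain_dim_def chain_of_length_def)

lemma chain_of_length_image:
  assumes "chain_of_length \<C> n c" and "\<And>J. J \<in> \<C> \<Longrightarrow> f J \<in> \<D>"
    and "\<And>J K. \<lbrakk>J \<in> \<C>; K \<in> \<C>; J \<subset> K\<rbrakk> \<Longrightarrow> f J \<subset> f K"
  shows "chain_of_length \<D> n (\<lambda>i. f (c i))"
  using assms by (simp add: chain_of_length_def)

lemma chain_of_length_antitone_image:
  assumes c: "chain_of_length \<C> n c" and f: "\<And>J. J \<in> \<C> \<Longrightarrow> f J \<in> \<D>"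
    and anti: "\<And>J K. \<lbrakk>J \<in> \<C>; K \<in> \<C>; J \<subset> K\<rbrakk> \<Longrightarrow> f K \<subset> f J"
  shows "chain_of_length \<D> n (\<lambda>i. f (c (n - i)))"
  unfolding chain_of_length_def
proof (intro conjI allI impI)
  show "f (c (n - i)) \<in> \<D>" for i using c f by (simp add: chain_of_length_def)
  show "f (c (n - i)) \<subset> f (c (n - Suc i))" if "i < n" for i
  proof -
    have "n - i = Suc (n - Suc i)" using that by simp
    then have "c (n - Suc i) \<subset> c (n - i)" using c that by (simp add: chain_of_length_def)
    then show ?thesis using c anti by (simp add: chain_of_length_def)
  qed
qed

section \<open>The fixed spectrum\<close>

context finite_ring_action
begin

text \<open>If \<open>gs - s \<in> Q\<close> for all \<open>s\<close>, then \<open>g\<close> maps \<open>Q\<close> onto itself.\<close>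

lemma fixed_primes_iff:
  assumes P: "P \<subseteq> carrier G"
  shows "Q \<in> fixed_primes S \<phi> P \<longleftrightarrow> primeideal Q S \<and> P \<subseteq> inertia Q"
proof -
  have "(\<forall>g\<in>P. \<forall>s\<in>carrier S. Q +> \<phi> g s = Q +> s) \<longleftrightarrow> P \<subseteq> inertia Q" if Q: "primeideal Q S"
    using P coset_eq_iff[OF primeideal.axioms(1)[OF Q]] by (auto simp: inertia_def subset_iff)
  moreover have "\<phi> g ` Q = Q" if "primeideal Q S" "P \<subseteq> inertia Q" "g \<in> P" for g
    using that inertia_translate[of g Q] primeideal.axioms(1) by blast
  ultimately show ?thesis unfolding fixed_primes_def prime_spectrum_def by blast
qed

lemma inertia_mono: "Q \<subseteq> Q' \<Longrightarrow> inertia Q \<subseteq> inertia Q'"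
  by (auto simp: inertia_def)

lemma inertia_Inter: "(\<And>Q. Q \<in> C \<Longrightarrow> P \<subseteq> inertia Q) \<Longrightarrow> P \<subseteq> carrier G \<Longrightarrow> P \<subseteq> inertia (\<Inter>C)"
  by (fastforce simp: inertia_def)

lemma topspace_fixed_spectrum: "topspace (fixed_spectrum S \<phi> P) = fixed_primes S \<phi> P"
  by (auto simp: fixed_spectrum_def topspace_zariski fixed_primes_def)

lemma closedin_fixed_spectrum:
  "closedin (fixed_spectrum S \<phi> P) C \<longleftrightarrow> (\<exists>A\<subseteq>carrier S. C = {Q \<in> fixed_primes S \<phi> P. A \<subseteq> Q})"
proof -
  have "{J \<in> prime_spectrum S. A \<subseteq> J} \<inter> fixed_primes S \<phi> P = {Q \<in> fixed_primes S \<phi> P. A \<subseteq> Q}" for A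
    by (auto simp: fixed_primes_def)
  then show ?thesis
    unfolding fixed_spectrum_def closedin_subtopology closedin_zariski by metis
qed

lemma closed_fixed_eq:
  assumes "closedin (fixed_spectrum S \<phi> P) C"
  shows "C = {Q \<in> fixed_primes S \<phi> P. \<Inter>C \<subseteq> Q}"
  using assms unfolding closedin_fixed_spectrum by blast

lemma fixed_primes_prime: "Q \<in> fixed_primes S \<phi> P \<Longrightarrow> primeideal Q S"
  by (simp add: fixed_primes_def prime_spectrum_def)

lemma prime_subset_closed: "Q \<in> fixed_primes S \<phi> P \<Longrightarrow> closedin (fixed_spectrum S \<phi> P) {Q' \<in> fixed_primes S \<phi> P. Q \<subseteq> Q'}"
  unfolding closedin_fixed_spectrum using prime_carrier[OF fixed_primes_prime] by blast

lemma closure_of_point_irreducible: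
  assumes Q: "Q \<in> fixed_primes S \<phi> P"
  shows "irreducible_closedin (fixed_spectrum S \<phi> P) {Q' \<in> fixed_primes S \<phi> P. Q \<subseteq> Q'}"
  unfolding irreducible_closedin_def
proof (intro conjI allI impI)
  let ?V = "{Q' \<in> fixed_primes S \<phi> P. Q \<subseteq> Q'}"
  show "closedin (fixed_spectrum S \<phi> P) ?V" using prime_subset_closed[OF Q] .
  have QV: "Q \<in> ?V" using Q by blast
  then show "?V \<noteq> {}" by blast
  have all: "?V \<subseteq> A" if "closedin (fixed_spectrum S \<phi> P) A" "Q \<in> A" for A
    using that unfolding closedin_fixed_spectrum by blast
  show "?V = A \<or> ?V = B"
    if AB: "closedin (fixed_spectrum S \<phi> P) A \<and> closedin (fixed_spectrum S \<phi> P) B \<and> ?V = A \<union> B" for A B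
  proof -
    have "Q \<in> A \<or> Q \<in> B" using AB QV by auto
    then have "?V \<subseteq> A \<or> ?V \<subseteq> B" using all AB by meson
    then show ?thesis using AB by auto
  qed
qed

text \<open>The intersection of the members of an irreducible closed set \<open>C\<close> is prime: if it contains \<open>ab\<close>, then
\<open>C\<close> is the union of the closed subsets of primes containing \<open>a\<close> and of primes containing \<open>b\<close>.\<close>

lemma generic_point:
  assumes P: "P \<subseteq> carrier G" and C: "irreducible_closedin (fixed_spectrum S \<phi> P) C"
  shows "\<Inter>C \<in> fixed_primes S \<phi> P"
proof -
  have cl: "closedin (fixed_spectrum S \<phi> P) C" and ne: "C \<noteq> {}"
    and irr: "\<And>A B. \<lbrakk>closedin (fixed_spectrum S \<phi> P) A; closedin (fixed_spectrum S \<phi> P) B; C = A \<union> B\<rbrakk> \<Longrightarrow> C = A \<or> C = B"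
    using C by (auto simp: irreducible_closedin_def)
  from cl[unfolded closedin_fixed_spectrum]
  obtain A where A: "A \<subseteq> carrier S" "C = {Q \<in> fixed_primes S \<phi> P. A \<subseteq> Q}" by blast
  have pr: "primeideal Q S" "P \<subseteq> inertia Q" if "Q \<in> C" for Q
    using that fixed_primes_iff[OF P] A(2) by auto
  have id: "ideal (\<Inter>C) S" using i_Intersect[OF primeideal.axioms(1)[OF pr(1)] ne] .
  obtain Q0 where Q0: "Q0 \<in> C" using ne by blast
  have "primeideal (\<Inter>C) S"
  proof (rule primeidealI[OF id is_cring])
    show "carrier S \<noteq> \<Inter>C"
      using primeideal.I_notcarr[OF pr(1)[OF Q0]] prime_carrier[OF pr(1)[OF Q0]] Q0 by blast
    fix a b assume ab: "a \<in> carrier S" "b \<in> carrier S" "a \<otimes> b \<in> \<Inter>C"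
    have cla: "closedin (fixed_spectrum S \<phi> P) {Q \<in> C. x \<in> Q}" if "x \<in> carrier S" for x
      unfolding closedin_fixed_spectrum A(2) using that A(1) by (intro exI[of _ "insert x A"]) auto
    have "C = {Q \<in> C. a \<in> Q} \<union> {Q \<in> C. b \<in> Q}"
      using ab primeideal.I_prime[OF pr(1)] by blast
    then have "C = {Q \<in> C. a \<in> Q} \<or> C = {Q \<in> C. b \<in> Q}" using irr[OF cla[OF ab(1)] cla[OF ab(2)]] by blast
    then show "a \<in> \<Inter>C \<or> b \<in> \<Inter>C" by blast
  qed
  then show ?thesis using inertia_Inter[OF pr(2) P] fixed_primes_iff[OF P] by blast
qed

text \<open>Closed irreducible sets and their generic points correspond under an order-reversing bijection.\<close>

lemma topological_dim_fixed_spectrum: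
  assumes P: "P \<subseteq> carrier G"
  shows "topological_dim (fixed_spectrum S \<phi> P) = chain_dim (fixed_primes S \<phi> P)"
  unfolding topological_dim_def
proof (rule chain_dim_cong)
  let ?T = "fixed_spectrum S \<phi> P" and ?F = "fixed_primes S \<phi> P"
  let ?V = "\<lambda>Q. {Q' \<in> ?F. Q \<subseteq> Q'}"
  fix n
  show "(\<exists>c. chain_of_length {C. irreducible_closedin ?T C} n c) \<longleftrightarrow> (\<exists>c. chain_of_length ?F n c)"
  proof
    assume "\<exists>c. chain_of_length {C. irreducible_closedin ?T C} n c"
    then obtain c where c: "chain_of_length {C. irreducible_closedin ?T C} n c" by blast
    have "chain_of_length ?F n (\<lambda>i. \<Inter>(c (n - i)))"
    proof (rule chain_of_length_antitone_image[OF c])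
      show "\<Inter>C \<in> ?F" if "C \<in> {C. irreducible_closedin ?T C}" for C using that generic_point[OF P] by blast
      show "\<Inter>K \<subset> \<Inter>J" if "J \<in> {C. irreducible_closedin ?T C}" "K \<in> {C. irreducible_closedin ?T C}" "J \<subset> K" for J K
      proof -
        have "J = {Q \<in> ?F. \<Inter>J \<subseteq> Q}" "K = {Q \<in> ?F. \<Inter>K \<subseteq> Q}"
          using that closed_fixed_eq by (simp_all add: irreducible_closedin_def)
        then have "\<Inter>J \<noteq> \<Inter>K" using that(3) by auto
        moreover have "\<Inter>K \<subseteq> \<Inter>J" using that(3) by blast
        ultimately show ?thesis by blast
      qed
    qed
    then show "\<exists>c. chain_of_length ?F n c" by blast
  next
    assume "\<exists>c. chain_of_length ?F n c"
    then obtain c where c: "chain_of_length ?F n c" by blast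
    have "chain_of_length {C. irreducible_closedin ?T C} n (\<lambda>i. ?V (c (n - i)))"
    proof (rule chain_of_length_antitone_image[OF c])
      show "?V J \<in> {C. irreducible_closedin ?T C}" if "J \<in> ?F" for J
        using closure_of_point_irreducible[OF that] by blast
      show "?V K \<subset> ?V J" if "J \<in> ?F" "K \<in> ?F" "J \<subset> K" for J K
      proof -
        have "J \<in> ?V J" "J \<notin> ?V K" using that by auto
        moreover have "?V K \<subseteq> ?V J" using that(3) by auto
        ultimately show ?thesis by blast
      qed
    qed
    then show "\<exists>c. chain_of_length {C. irreducible_closedin ?T C} n c" by blast
  qed
qed

end

section \<open>Quotients of the invariant ring\<close>

text \<open>The two conditions on \<open>I\<close> say that the closed set of \<open>Spec(S\<^sup>G)\<close> defined by \<open>I\<close> is the image of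
\<open>Spec(S)\<^sup>P\<close>. The homeomorphism and the dimension formula follow from this alone, so that the
Brauer quotient and the quotient by the non-split invariants are treated at once.\<close>

locale fixed_spectrum_quotient = finite_ring_action S G \<phi>
  for S :: "('s, 'n) ring_scheme" (structure) and G :: "('g, 'l) monoid_scheme" (structure)
    and \<phi> :: "'g \<Rightarrow> 's \<Rightarrow> 's" +
  fixes P :: "'g set" and I :: "'s set"
  assumes P_carrier: "P \<subseteq> carrier G"
    and I_ideal: "ideal I (invariant_ring S \<phi> (carrier G))"
    and I_below: "Q \<in> fixed_primes S \<phi> P \<Longrightarrow> I \<subseteq> Q"
    and I_above: "\<lbrakk>primeideal Q S; I \<subseteq> Q\<rbrakk> \<Longrightarrow> \<exists>g\<in>carrier G. \<phi> g ` Q \<in> fixed_primes S \<phi> P"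

context fixed_spectrum_quotient
begin

abbreviation quot_map :: "'s \<Rightarrow> 's set"
  where "quot_map x \<equiv> I +>\<^bsub>inv_ring\<^esub> x"

definition contract :: "'s set \<Rightarrow> 's set set"
  where "contract Q = quot_map ` (Q \<inter> invariants_set)"

lemma I_carrier: "I \<subseteq> invariants_set"
  using ideal.Icarr[OF I_ideal] by fastforce

lemma contract_mem:
  assumes Q: "Q \<in> fixed_primes S \<phi> P" and x: "x \<in> invariants_set"
  shows "quot_map x \<in> contract Q \<longleftrightarrow> x \<in> Q"
proof -
  have "ideal (Q \<inter> invariants_set) inv_ring"
    using contraction_prime[OF fixed_primes_prime[OF Q]] primeideal.axioms(1) by blast
  then show ?thesis
    using cring.coset_mem_image_iff[OF inv_ring_cring I_ideal, of "Q \<inter> invariants_set" x] I_below[OF Q] I_carrier x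
    unfolding contract_def by simp
qed

lemma contract_prime:
  assumes Q: "Q \<in> fixed_primes S \<phi> P"
  shows "primeideal (contract Q) (inv_ring Quot I)"
  unfolding contract_def
  using cring.quotient_prime[OF inv_ring_cring I_ideal contraction_prime[OF fixed_primes_prime[OF Q]]]
    I_below[OF Q] I_carrier by simp

lemma contract_subset_iff:
  assumes Q: "Q \<in> fixed_primes S \<phi> P" and Q': "Q' \<in> fixed_primes S \<phi> P"
  shows "contract Q \<subseteq> contract Q' \<longleftrightarrow> Q \<inter> invariants_set \<subseteq> Q'"
proof
  assume sub: "contract Q \<subseteq> contract Q'"
  show "Q \<inter> invariants_set \<subseteq> Q'"
  proof
    fix x assume x: "x \<in> Q \<inter> invariants_set"
    then have "quot_map x \<in> contract Q" by (auto simp: contract_def)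
    then show "x \<in> Q'" using sub contract_mem[OF Q'] x by blast
  qed
qed (auto simp: contract_def)

text \<open>The prime found over \<open>J\<close> stays in the fixed spectrum because inertia groups grow with the ideal. With
\<open>A\<close> prime this is going up; with \<open>A\<close> the intersection of a closed set of primes it shows that
contraction is a closed map.\<close>

lemma going_up:
  assumes J: "primeideal J (inv_ring Quot I)" and A: "ideal A S" "P \<subseteq> inertia A"
    and sub: "quot_map ` (A \<inter> invariants_set) \<subseteq> J"
  obtains Q where "Q \<in> fixed_primes S \<phi> P" "A \<subseteq> Q" "contract Q = J"
proof -
  obtain q where q: "primeideal q inv_ring" "I \<subseteq> q" "J = quot_map ` q"
    using cring.prime_of_quotient[OF inv_ring_cring I_ideal J] .
  have "A \<inter> invariants_set \<subseteq> q"
  proof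
    fix x assume x: "x \<in> A \<inter> invariants_set"
    then have "quot_map x \<in> quot_map ` q" using sub q(3) by blast
    then show "x \<in> q"
      using cring.coset_mem_image_iff[OF inv_ring_cring I_ideal primeideal.axioms(1)[OF q(1)] q(2), of x] x by simp
  qed
  then obtain Q where Q: "primeideal Q S" "A \<subseteq> Q" "Q \<inter> invariants_set = q"
    using exists_prime_over[OF q(1) A(1)] by blast
  have "P \<subseteq> inertia Q" using A(2) inertia_mono[OF Q(2)] by blast
  then have "Q \<in> fixed_primes S \<phi> P" using Q fixed_primes_iff[OF P_carrier] by blast
  then show ?thesis using that Q q(3) by (simp add: contract_def)
qed

lemma contract_surj:
  assumes J: "primeideal J (inv_ring Quot I)"
  obtains Q where "Q \<in> fixed_primes S \<phi> P" "contract Q = J"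
proof -
  obtain q where q: "primeideal q inv_ring" "I \<subseteq> q" "J = quot_map ` q"
    using cring.prime_of_quotient[OF inv_ring_cring I_ideal J] .
  have "\<zero> \<in> q" using additive_subgroup.zero_closed[OF ideal.axioms(1)[OF primeideal.axioms(1)[OF q(1)]]] by simp
  then obtain Q where Q: "primeideal Q S" "Q \<inter> invariants_set = q"
    using exists_prime_over[OF q(1) zeroideal] by blast
  then obtain g where g: "g \<in> carrier G" "\<phi> g ` Q \<in> fixed_primes S \<phi> P"
    using I_above q(2) by blast
  have "contract (\<phi> g ` Q) = J"
    using translate_contraction[OF g(1) prime_carrier[OF Q(1)]] Q(2) q(3) by (simp add: contract_def)
  then show ?thesis using that g(2) by blast
qed

lemma contract_quotient_map:
  "quotient_map (fixed_spectrum S \<phi> P) (zariski (inv_ring Quot I)) contract"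
proof (rule continuous_closed_imp_quotient_map)
  let ?T = "fixed_spectrum S \<phi> P" and ?Z = "zariski (inv_ring Quot I)" and ?F = "fixed_primes S \<phi> P"
  have maps: "contract Q \<in> prime_spectrum (inv_ring Quot I)" if "Q \<in> ?F" for Q
    using contract_prime[OF that] by (simp add: prime_spectrum_def)
  show "contract ` topspace ?T = topspace ?Z"
    unfolding topspace_fixed_spectrum topspace_zariski
  proof
    show "contract ` ?F \<subseteq> prime_spectrum (inv_ring Quot I)" using maps by blast
    show "prime_spectrum (inv_ring Quot I) \<subseteq> contract ` ?F"
    proof
      fix J assume "J \<in> prime_spectrum (inv_ring Quot I)"
      then have "primeideal J (inv_ring Quot I)" by (simp add: prime_spectrum_def)
      then show "J \<in> contract ` ?F" by (metis contract_surj image_eqI)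
    qed
  qed
  show "continuous_map ?T ?Z contract"
    unfolding continuous_map_closedin topspace_fixed_spectrum topspace_zariski
  proof (intro conjI allI impI)
    show "contract \<in> ?F \<rightarrow> prime_spectrum (inv_ring Quot I)" using maps by blast
    fix C assume "closedin ?Z C"
    then obtain A where A: "A \<subseteq> carrier (inv_ring Quot I)" "C = {J \<in> prime_spectrum (inv_ring Quot I). A \<subseteq> J}"
      by (auto simp: closedin_zariski)
    let ?B = "{x \<in> invariants_set. quot_map x \<in> A}"
    have "A \<subseteq> contract Q \<longleftrightarrow> ?B \<subseteq> Q" if Q: "Q \<in> ?F" for Q
    proof
      assume "A \<subseteq> contract Q"
      then show "?B \<subseteq> Q" using contract_mem[OF Q] by blast
    next
      assume B: "?B \<subseteq> Q"
      show "A \<subseteq> contract Q"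
      proof
        fix Y assume Y: "Y \<in> A"
        then obtain x where x: "x \<in> carrier inv_ring" "Y = quot_map x"
          using A(1) cring.quot_carrierE[OF inv_ring_cring] by blast
        then have "x \<in> Q" using B Y by auto
        then show "Y \<in> contract Q" using x by (auto simp: contract_def)
      qed
    qed
    then have "{Q \<in> ?F. contract Q \<in> C} = {Q \<in> ?F. ?B \<subseteq> Q}" using A(2) maps by blast
    moreover have "?B \<subseteq> carrier S" by (auto simp: fixed_points_def)
    ultimately show "closedin ?T {Q \<in> ?F. contract Q \<in> C}"
      unfolding closedin_fixed_spectrum by blast
  qed
  show "closed_map ?T ?Z contract"
    unfolding closed_map_def
  proof (intro allI impI)
    fix C assume C: "closedin ?T C"
    show "closedin ?Z (contract ` C)"
    proof (cases "C = {}")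
      case True
      then show ?thesis by simp
    next
      case False
      have Ceq: "C = {Q \<in> ?F. \<Inter>C \<subseteq> Q}" using closed_fixed_eq[OF C] .
      then have CF: "C \<subseteq> ?F" by blast
      then have pr: "primeideal Q S" "P \<subseteq> inertia Q" if "Q \<in> C" for Q
        using that fixed_primes_iff[OF P_carrier] by auto
      have id: "ideal (\<Inter>C) S" using i_Intersect[OF primeideal.axioms(1)[OF pr(1)] False] .
      have Pin: "P \<subseteq> inertia (\<Inter>C)" using inertia_Inter[OF pr(2) P_carrier] .
      let ?A = "quot_map ` (\<Inter>C \<inter> invariants_set)"
      have "contract ` C = {J \<in> prime_spectrum (inv_ring Quot I). ?A \<subseteq> J}"
      proof
        show "contract ` C \<subseteq> {J \<in> prime_spectrum (inv_ring Quot I). ?A \<subseteq> J}"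
          using CF maps by (auto simp: contract_def)
        show "{J \<in> prime_spectrum (inv_ring Quot I). ?A \<subseteq> J} \<subseteq> contract ` C"
        proof
          fix J assume "J \<in> {J \<in> prime_spectrum (inv_ring Quot I). ?A \<subseteq> J}"
          then have J: "primeideal J (inv_ring Quot I)" "?A \<subseteq> J" by (auto simp: prime_spectrum_def)
          obtain Q where Q: "Q \<in> ?F" "\<Inter>C \<subseteq> Q" "contract Q = J" using going_up[OF J(1) id Pin J(2)] .
          then have "Q \<in> C" using Ceq by blast
          then show "J \<in> contract ` C" using Q(3) by blast
        qed
      qed
      moreover have "?A \<subseteq> carrier (inv_ring Quot I)"
        using ring_hom_closed[OF ideal.rcos_ring_hom[OF I_ideal]] by auto
      ultimately show ?thesis unfolding closedin_zariski by blast
    qed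
  qed
qed

text \<open>Primes of \<open>S\<close> over the same prime of invariants are conjugate, hence incomparable.\<close>

lemma contract_strict_mono:
  assumes Q: "Q \<in> fixed_primes S \<phi> P" and Q': "Q' \<in> fixed_primes S \<phi> P" and sub: "Q \<subset> Q'"
  shows "contract Q \<subset> contract Q'"
proof -
  have "contract Q \<subseteq> contract Q'" using contract_subset_iff[OF Q Q'] sub by blast
  moreover have "\<not> contract Q' \<subseteq> contract Q"
    using contraction_incomparable[OF fixed_primes_prime[OF Q] fixed_primes_prime[OF Q']] sub
      contract_subset_iff[OF Q' Q] by blast
  ultimately show ?thesis by blast
qed

lemma lift_chain:
  assumes "chain_of_length (prime_spectrum (inv_ring Quot I)) n c"
  shows "\<exists>d. chain_of_length (fixed_primes S \<phi> P) n d \<and> (\<forall>i\<le>n. contract (d i) = c i)"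
  using assms
proof (induction n)
  case 0
  then have "primeideal (c 0) (inv_ring Quot I)" by (simp add: chain_of_length_def prime_spectrum_def)
  then obtain Q where "Q \<in> fixed_primes S \<phi> P" "contract Q = c 0" using contract_surj by blast
  then show ?case by (intro exI[of _ "\<lambda>_. Q"]) (simp add: chain_of_length_def)
next
  case (Suc n)
  then have "chain_of_length (prime_spectrum (inv_ring Quot I)) n c" by (simp add: chain_of_length_def)
  with Suc.IH obtain d where d: "chain_of_length (fixed_primes S \<phi> P) n d" "\<forall>i\<le>n. contract (d i) = c i" by blast
  have dn: "d n \<in> fixed_primes S \<phi> P" using d(1) by (simp add: chain_of_length_def)
  have J: "primeideal (c (Suc n)) (inv_ring Quot I)" and lt: "c n \<subset> c (Suc n)"
    using Suc.prems by (auto simp: chain_of_length_def prime_spectrum_def)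
  have "quot_map ` (d n \<inter> invariants_set) \<subseteq> c (Suc n)"
    using d(2) lt unfolding contract_def by auto
  then obtain Q where Q: "Q \<in> fixed_primes S \<phi> P" "d n \<subseteq> Q" "contract Q = c (Suc n)"
    using going_up[OF J] dn fixed_primes_iff[OF P_carrier] primeideal.axioms(1) by metis
  have "d n \<noteq> Q" using Q(3) d(2) lt by auto
  then have "chain_of_length (fixed_primes S \<phi> P) (Suc n) (d(Suc n := Q))"
    using d(1) Q by (auto simp: chain_of_length_def less_Suc_eq le_Suc_eq)
  moreover have "\<forall>i\<le>Suc n. contract ((d(Suc n := Q)) i) = c i" using d(2) Q(3) by (simp add: le_Suc_eq)
  ultimately show ?case by blast
qed

theorem krull_dim_quotient:
  "krull_dim (inv_ring Quot I) = topological_dim (fixed_spectrum S \<phi> P)"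
proof -
  have "chain_dim (prime_spectrum (inv_ring Quot I)) = chain_dim (fixed_primes S \<phi> P)"
  proof (rule chain_dim_cong)
    fix n
    show "(\<exists>c. chain_of_length (prime_spectrum (inv_ring Quot I)) n c) \<longleftrightarrow> (\<exists>c. chain_of_length (fixed_primes S \<phi> P) n c)"
    proof
      assume "\<exists>c. chain_of_length (fixed_primes S \<phi> P) n c"
      then obtain c where "chain_of_length (fixed_primes S \<phi> P) n c" by blast
      then have "chain_of_length (prime_spectrum (inv_ring Quot I)) n (\<lambda>i. contract (c i))"
        by (rule chain_of_length_image[OF _ _ contract_strict_mono]) (simp add: prime_spectrum_def contract_prime)
      then show "\<exists>c. chain_of_length (prime_spectrum (inv_ring Quot I)) n c" by blast
    qed (use lift_chain in blast)
  qed
  then show ?thesis unfolding krull_dim_def topological_dim_fixed_spectrum[OF P_carrier] .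
qed

end

section \<open>Orbits of the normaliser\<close>

lemma (in group) normalizerI:
  assumes fin: "finite (carrier G)" and P: "subgroup P G" and n: "n \<in> carrier G"
    and sub: "\<And>h. h \<in> P \<Longrightarrow> inv n \<otimes> h \<otimes> n \<in> P"
  shows "n \<in> normalizer G P"
proof -
  have Pc: "P \<subseteq> carrier G" using subgroup.subset[OF P] .
  have finP: "finite P" using finite_subset[OF Pc fin] .
  have conj: "n <# P #> inv n = (\<lambda>h. n \<otimes> h \<otimes> inv n) ` P"
    by (auto simp: l_coset_def r_coset_def)
  have "P \<subseteq> (\<lambda>h. n \<otimes> h \<otimes> inv n) ` P"
  proof
    fix h assume h: "h \<in> P"
    have "h \<in> carrier G" using Pc h by blast
    then have "h = n \<otimes> (inv n \<otimes> h \<otimes> n) \<otimes> inv n" using conjugation_is_surj[OF n] by simp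
    then show "h \<in> (\<lambda>h. n \<otimes> h \<otimes> inv n) ` P" using sub[OF h] by blast
  qed
  moreover have "card ((\<lambda>h. n \<otimes> h \<otimes> inv n) ` P) \<le> card P" using card_image_le[OF finP] .
  ultimately have "P = (\<lambda>h. n \<otimes> h \<otimes> inv n) ` P"
    using finP by (intro card_seteq) auto
  then show ?thesis
    using conj n Pc by (simp add: normalizer_def stabilizer_def)
qed

context finite_ring_action
begin

text \<open>Let \<open>Q = gQ'\<close>. Both \<open>P\<close> and \<open>gPg\<^sup>-\<^sup>1\<close> are Sylow subgroups of the inertia group of \<open>Q\<close>, so
\<open>d\<^sup>-\<^sup>1Pd = gPg\<^sup>-\<^sup>1\<close> for some \<open>d\<close> in it. Then \<open>dg\<close> normalises \<open>P\<close>, and \<open>dgQ' = dQ = Q\<close>.\<close>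

lemma normalizer_conjugates_fixed_primes:
  assumes p: "normalization_semidom_class.prime p" and P: "subgroup P G" and cP: "card P = p ^ m"
    and idx: "\<not> p dvd card (lcosets\<^bsub>G\<^esub> P)"
    and Q: "Q \<in> fixed_primes S \<phi> P" and Q': "Q' \<in> fixed_primes S \<phi> P"
    and eq: "Q \<inter> invariants_set = Q' \<inter> invariants_set"
  shows "\<exists>n\<in>normalizer G P. Q = \<phi> n ` Q'"
proof -
  have Pc: "P \<subseteq> carrier G" using subgroup.subset[OF P] .
  have Qp: "primeideal Q S" "P \<subseteq> inertia Q" and Qp': "primeideal Q' S" "P \<subseteq> inertia Q'"
    using Q Q' fixed_primes_iff[OF Pc] by auto
  obtain g where g: "g \<in> carrier G" "Q = \<phi> g ` Q'"
    using same_contraction_imp_conjugate[OF Qp(1) Qp'(1) eq] by blast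
  let ?D = "inertia Q" let ?GD = "G\<lparr>carrier := inertia Q\<rparr>"
  have D: "subgroup ?D G" using inertia_subgroup[OF primeideal.axioms(1)[OF Qp(1)]] .
  interpret D: group ?GD using subgroup.subgroup_is_group[OF D G.is_group] .
  have Dc: "?D \<subseteq> carrier G" by (rule inertia_carrier)
  have finD: "finite ?D" using finite_subset[OF Dc finite_group] .
  define P' where "P' = g <#\<^bsub>G\<^esub> P #>\<^bsub>G\<^esub> inv\<^bsub>G\<^esub> g"
  have P'_eq: "P' = (\<lambda>h. g \<otimes>\<^bsub>G\<^esub> h \<otimes>\<^bsub>G\<^esub> inv\<^bsub>G\<^esub> g) ` P"
    by (auto simp: P'_def l_coset_def r_coset_def)
  have P': "subgroup P' G"
    using G.subgroup_conjugation_is_surj1[OF _ P, of "inv\<^bsub>G\<^esub> g"] g(1) by (simp add: P'_def)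
  have cP': "card P' = card P"
    unfolding P'_eq using g(1) Pc by (intro card_image inj_onI) (auto simp: subset_iff)
  have P'D: "P' \<subseteq> ?D"
  proof
    fix x assume "x \<in> P'"
    then obtain h where h: "h \<in> P" "x = g \<otimes>\<^bsub>G\<^esub> h \<otimes>\<^bsub>G\<^esub> inv\<^bsub>G\<^esub> g" unfolding P'_eq by blast
    have hc: "h \<in> carrier G" using Pc h by blast
    have "inv\<^bsub>G\<^esub> g \<otimes>\<^bsub>G\<^esub> x \<otimes>\<^bsub>G\<^esub> g = h" using g(1) hc h(2) by (simp add: G.m_assoc G.inv_solve_left')
    then have "x \<in> inertia (\<phi> g ` Q')"
      using inertia_of_translate[OF g(1) prime_carrier[OF Qp'(1)], of x] g(1) hc h Qp'(2) by auto
    then show "x \<in> ?D" using g(2) by simp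
  qed
  have posP: "card P > 0" using subgroup.finite_imp_card_positive[OF P finite_group] .
  have idx': "\<not> p dvd card ?D div card P"
    using idx G.card_lcosets_subgroup(1)[OF finite_group P D Qp(2)] by auto
  have "card (lcosets\<^bsub>?GD\<^esub> P') * card P' = card ?D"
    using D.l_lagrange[OF _ G.subgroup_incl[OF P' D P'D]] finD by (simp add: order_def)
  then have "card (lcosets\<^bsub>?GD\<^esub> P') = card ?D div card P" using cP' posP by (metis nonzero_mult_div_cancel_right not_gr0)
  then obtain d where d: "d \<in> ?D" "\<forall>h\<in>P. inv\<^bsub>?GD\<^esub> d \<otimes>\<^bsub>G\<^esub> h \<otimes>\<^bsub>G\<^esub> d \<in> P'"
    using D.p_subgroup_conjugate_into[OF _ p G.subgroup_incl[OF P D Qp(2)] cP G.subgroup_incl[OF P' D P'D]] idx' finD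
    by auto
  have dc: "d \<in> carrier G" using d(1) Dc by blast
  have invd: "inv\<^bsub>?GD\<^esub> d = inv\<^bsub>G\<^esub> d" using G.m_inv_consistent[OF D d(1)] .
  let ?n = "d \<otimes>\<^bsub>G\<^esub> g"
  have "?n \<in> normalizer G P"
  proof (rule G.normalizerI[OF finite_group P])
    show "?n \<in> carrier G" using dc g by simp
    fix h assume h: "h \<in> P"
    have hc: "h \<in> carrier G" using Pc h by blast
    have "inv\<^bsub>G\<^esub> d \<otimes>\<^bsub>G\<^esub> h \<otimes>\<^bsub>G\<^esub> d \<in> P'" using d(2) h invd by simp
    then obtain h' where h': "h' \<in> P" "inv\<^bsub>G\<^esub> d \<otimes>\<^bsub>G\<^esub> h \<otimes>\<^bsub>G\<^esub> d = g \<otimes>\<^bsub>G\<^esub> h' \<otimes>\<^bsub>G\<^esub> inv\<^bsub>G\<^esub> g"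
      unfolding P'_eq by blast
    have hc': "h' \<in> carrier G" using Pc h' by blast
    have "inv\<^bsub>G\<^esub> ?n \<otimes>\<^bsub>G\<^esub> h \<otimes>\<^bsub>G\<^esub> ?n = inv\<^bsub>G\<^esub> g \<otimes>\<^bsub>G\<^esub> (inv\<^bsub>G\<^esub> d \<otimes>\<^bsub>G\<^esub> h \<otimes>\<^bsub>G\<^esub> d) \<otimes>\<^bsub>G\<^esub> g"
      using dc g(1) hc by (simp add: G.inv_mult_group G.m_assoc)
    also have "\<dots> = h'"
      unfolding h'(2) using g(1) hc' by (simp add: G.m_assoc G.inv_solve_left')
    finally show "inv\<^bsub>G\<^esub> ?n \<otimes>\<^bsub>G\<^esub> h \<otimes>\<^bsub>G\<^esub> ?n \<in> P" using h'(1) by simp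
  qed
  moreover have "\<phi> ?n ` Q' = Q"
    using translate_comp[OF dc g(1) prime_carrier[OF Qp'(1)]] g(2)
      inertia_translate[OF d(1) primeideal.axioms(1)[OF Qp(1)]] by simp
  ultimately show ?thesis by blast
qed

lemma orbit_eq_iff_same_contraction:
  assumes p: "normalization_semidom_class.prime p" and P: "subgroup P G" and cP: "card P = p ^ m"
    and idx: "\<not> p dvd card (lcosets\<^bsub>G\<^esub> P)"
    and Q: "Q \<in> fixed_primes S \<phi> P" and Q': "Q' \<in> fixed_primes S \<phi> P"
  shows "orbit (G\<lparr>carrier := normalizer G P\<rparr>) (\<lambda>g J. \<phi> g ` J) Q =
      orbit (G\<lparr>carrier := normalizer G P\<rparr>) (\<lambda>g J. \<phi> g ` J) Q'
    \<longleftrightarrow> Q \<inter> invariants_set = Q' \<inter> invariants_set"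
proof -
  let ?N = "normalizer G P"
  have N: "subgroup ?N G" using G.normalizer_imp_subgroup[OF subgroup.subset[OF P]] .
  have Nc: "n \<in> carrier G" if "n \<in> ?N" for n using subgroup.mem_carrier[OF N that] .
  have c: "Q \<subseteq> carrier S" "Q' \<subseteq> carrier S" using Q Q' prime_carrier fixed_primes_prime by blast+
  let ?o = "\<lambda>J. {\<phi> n ` J | n. n \<in> ?N}"
  have sub: "?o J \<subseteq> ?o J'" if J: "J' \<subseteq> carrier S" "J = \<phi> n ` J'" "n \<in> ?N" for J J' n
  proof
    fix K assume "K \<in> ?o J"
    then obtain n' where n': "n' \<in> ?N" "K = \<phi> n' ` J" by blast
    then have "K = \<phi> (n' \<otimes>\<^bsub>G\<^esub> n) ` J'" using translate_comp[OF Nc Nc J(1)] J by simp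
    then show "K \<in> ?o J'" using subgroup.m_closed[OF N n'(1) J(3)] by blast
  qed
  have "?o Q = ?o Q' \<longleftrightarrow> Q \<inter> invariants_set = Q' \<inter> invariants_set"
  proof
    assume "?o Q = ?o Q'"
    moreover have "Q \<in> ?o Q" using translate_id[OF c(1)] subgroup.one_closed[OF N] by blast
    ultimately have "Q \<in> ?o Q'" by simp
    then obtain n where n: "n \<in> ?N" "Q = \<phi> n ` Q'" by auto
    show "Q \<inter> invariants_set = Q' \<inter> invariants_set"
      using translate_contraction[OF Nc[OF n(1)] c(2)] n(2) by simp
  next
    assume eq: "Q \<inter> invariants_set = Q' \<inter> invariants_set"
    obtain n where n: "n \<in> ?N" "Q = \<phi> n ` Q'"
      using normalizer_conjugates_fixed_primes[OF p P cP idx Q Q' eq] by blast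
    obtain n' where n': "n' \<in> ?N" "Q' = \<phi> n' ` Q"
      using normalizer_conjugates_fixed_primes[OF p P cP idx Q' Q eq[symmetric]] by blast
    show "?o Q = ?o Q'" using sub[OF c(2) n(2,1)] sub[OF c(1) n'(2,1)] by blast
  qed
  then show ?thesis by (simp add: orbit_def)
qed

end

section \<open>Spectra of the two quotients\<close>

lemma (in fixed_spectrum_quotient) spectrum_homeomorphic:
  assumes p: "normalization_semidom_class.prime p" and P: "subgroup P G" and cP: "card P = p ^ m"
    and idx: "\<not> p dvd card (lcosets\<^bsub>G\<^esub> P)"
  shows "zariski (inv_ring Quot I) homeomorphic_space fixed_spectrum_mod_normalizer S G \<phi> P"
  unfolding fixed_spectrum_mod_normalizer_def
proof (rule quotient_maps_homeomorphic[OF contract_quotient_map quotient_map_orbit_space])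
  fix Q Q' assume "Q \<in> topspace (fixed_spectrum S \<phi> P)" "Q' \<in> topspace (fixed_spectrum S \<phi> P)"
  then have Q: "Q \<in> fixed_primes S \<phi> P" "Q' \<in> fixed_primes S \<phi> P" by (simp_all add: topspace_fixed_spectrum)
  have "contract Q = contract Q' \<longleftrightarrow> Q \<inter> invariants_set = Q' \<inter> invariants_set"
    using contract_subset_iff[OF Q] contract_subset_iff[OF Q(2,1)] by blast
  then show "contract Q = contract Q' \<longleftrightarrow>
    orbit (G\<lparr>carrier := normalizer G P\<rparr>) (\<lambda>g J. \<phi> g ` J) Q =
    orbit (G\<lparr>carrier := normalizer G P\<rparr>) (\<lambda>g J. \<phi> g ` J) Q'"
    using orbit_eq_iff_same_contraction[OF p P cP idx Q] by simp
qed

text \<open>Any ideal between the Brauer ideal and the ideal of non-split invariants defines the image of the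
fixed spectrum.\<close>

lemma (in modular_algebra_action) fixed_spectrum_quotientI:
  assumes P: "subgroup P G" and cP: "card P = p ^ m" and idx: "\<not> p dvd card (lcosets\<^bsub>G\<^esub> P)"
    and I: "ideal I inv_ring" "brauer_ideal p S G \<phi> \<subseteq> I" "I \<subseteq> nonsplit_ideal k S G \<phi>"
  shows "fixed_spectrum_quotient S G \<phi> P I"
proof (intro fixed_spectrum_quotient.intro fixed_spectrum_quotient_axioms.intro finite_ring_action_axioms)
  show Pc: "P \<subseteq> carrier G" using subgroup.subset[OF P] .
  show "ideal I inv_ring" by (rule I(1))
  show "I \<subseteq> Q" if "Q \<in> fixed_primes S \<phi> P" for Q
    using that fixed_primes_iff[OF Pc] nonsplit_subset_prime[OF _ P _ idx] I(3) by blast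
  show "\<exists>g\<in>carrier G. \<phi> g ` Q \<in> fixed_primes S \<phi> P" if Q: "primeideal Q S" "I \<subseteq> Q" for Q
  proof -
    have "\<not> p dvd card (lcosets\<^bsub>G\<^esub> (inertia Q))"
      using brauer_ideal_imp_inertia_index[OF Q(1)] I(2) Q(2) by blast
    then obtain g where g: "g \<in> carrier G" "\<forall>h\<in>P. inv\<^bsub>G\<^esub> g \<otimes>\<^bsub>G\<^esub> h \<otimes>\<^bsub>G\<^esub> g \<in> inertia Q"
      using G.p_subgroup_conjugate_into[OF finite_group prime_p P cP inertia_subgroup[OF primeideal.axioms(1)[OF Q(1)]]]
      by blast
    have "P \<subseteq> inertia (\<phi> g ` Q)"
      using inertia_of_translate[OF g(1) prime_carrier[OF Q(1)]] g(2) Pc by blast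
    then show ?thesis using fixed_primes_iff[OF Pc] translate_prime[OF g(1) Q(1)] g(1) by blast
  qed
qed

lemma (in cring) ring_char_dvd_iff:
  assumes "ring_char R = p" "p \<noteq> 0"
  shows "add_pow R (n::nat) \<one> = \<zero> \<longleftrightarrow> p dvd n"
proof -
  let ?Z = "\<lambda>n::nat. 0 < n \<and> add_pow R n \<one> = \<zero>"
  have ex: "\<exists>n. ?Z n" and p: "p = (LEAST n. ?Z n)"
    using assms by (auto simp: ring_char_def split: if_splits)
  have Zp: "?Z p" unfolding p using ex by (rule LeastI_ex)
  have mult: "add_pow R (p * c) \<one> = \<zero>" for c
    using Zp by (simp flip: add.nat_pow_pow)
  have "add_pow R n \<one> = add_pow R (n mod p) \<one>"
  proof -
    have "add_pow R n \<one> = add_pow R (p * (n div p) + n mod p) \<one>" by simp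
    also have "\<dots> = add_pow R (p * (n div p)) \<one> \<oplus> add_pow R (n mod p) \<one>"
      by (simp only: add.nat_pow_mult one_closed)
    finally show ?thesis using mult by simp
  qed
  moreover have "\<not> ?Z (n mod p)"
    using not_less_Least[of "n mod p" ?Z] assms(2) p by (metis mod_less_divisor not_gr0)
  ultimately show ?thesis by (auto simp: dvd_eq_mod_eq_0)
qed

theorem theorem1p2:
  fixes k :: "('k, 'm) ring_scheme" and S :: "('k, 's, 'n) module_scheme"
    and gr :: "int \<Rightarrow> 's set" and G :: "('g, 'l) monoid_scheme"
    and \<phi> :: "'g \<Rightarrow> 's \<Rightarrow> 's" and p :: nat and P :: "'g set"
  assumes "algebraically_closed k"
    and "normalization_semidom_class.prime p" and "ring_char k = p"
    and "noetherian_ring S"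
    and "finite (carrier G)"
    and "graded_algebra_action k S gr G \<phi>"
    and "sylow_subgroup p P G"
  shows "zariski (trivial_summand_ring k S G \<phi>) homeomorphic_space
           fixed_spectrum_mod_normalizer S G \<phi> P \<and>
         zariski (brauer_quotient p S G \<phi>) homeomorphic_space
           fixed_spectrum_mod_normalizer S G \<phi> P \<and>
         krull_dim (trivial_summand_ring k S G \<phi>) = topological_dim (fixed_spectrum S \<phi> P) \<and>
         krull_dim (brauer_quotient p S G \<phi>) = topological_dim (fixed_spectrum S \<phi> P)"
proof -
  interpret gaa: graded_algebra_action k S gr G \<phi> by fact
  have alg: "algebra k S" by (rule gaa.algebra_axioms)
  have fld: "field k" using assms(1) by (simp add: algebraically_closed_def)
  have p: "normalization_semidom_class.prime p" by fact
  have p0: "p \<noteq> 0" using p by (metis not_prime_0)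
  have cS: "cring S" using alg by (rule algebra.M_cring)
  have one_S: "\<one>\<^bsub>S\<^esub> \<in> carrier S" using cring.cring_simprules(6)[OF cS] .
  have one_k: "\<one>\<^bsub>k\<^esub> \<in> carrier k" using cring.cring_simprules(6)[OF algebra.R_cring[OF alg]] .
  have char_k: "add_pow k n \<one>\<^bsub>k\<^esub> = \<zero>\<^bsub>k\<^esub> \<longleftrightarrow> p dvd n" for n :: nat
    using cring.ring_char_dvd_iff[OF algebra.R_cring[OF alg] assms(3) p0] .
  interpret fra: finite_ring_action S G \<phi>
    using cS gaa.group_action_axioms assms(5) gaa.act_ring_hom
    by (simp add: finite_ring_action_def finite_ring_action_axioms_def)
  \<comment> \<open>\<open>S\<close> inherits its characteristic from \<open>k\<close> through the scalar action.\<close>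
  have scal: "add_pow S n \<one>\<^bsub>S\<^esub> = add_pow k n \<one>\<^bsub>k\<^esub> \<odot>\<^bsub>S\<^esub> \<one>\<^bsub>S\<^esub>" for n :: nat
  proof (induction n)
    case 0
    then show ?case using module.smult_l_null[OF algebra.module[OF alg], of "\<one>\<^bsub>S\<^esub>"] one_S by simp
  next
    case (Suc n)
    then show ?case
      using module.smult_l_distr[OF algebra.module[OF alg], of "add_pow k n \<one>\<^bsub>k\<^esub>" "\<one>\<^bsub>k\<^esub>" "\<one>\<^bsub>S\<^esub>"]
        module.smult_one[OF algebra.module[OF alg], of "\<one>\<^bsub>S\<^esub>"] one_S by simp
  qed
  have char_S: "add_pow S p \<one>\<^bsub>S\<^esub> = \<zero>\<^bsub>S\<^esub>"
    using scal[of p] char_k[of p] module.smult_l_null[OF algebra.module[OF alg], of "\<one>\<^bsub>S\<^esub>"] one_S by simp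
  interpret mra: modular_ring_action S G \<phi> p
    using p char_S by unfold_locales
  interpret maa: modular_algebra_action S G \<phi> p k
    using fld alg gaa.act_smult char_k
    by (intro modular_algebra_action.intro modular_algebra_action_axioms.intro mra.modular_ring_action_axioms)
  have P: "subgroup P G" and cP: "card P = p ^ multiplicity p (order G)"
    using assms(7) by (simp_all add: sylow_subgroup_def)
  have idx: "\<not> p dvd card (lcosets\<^bsub>G\<^esub> P)"
  proof
    assume "p dvd card (lcosets\<^bsub>G\<^esub> P)"
    then have "p ^ Suc (multiplicity p (order G)) dvd order G"
      using fra.G.l_lagrange[OF assms(5) P] cP by (metis dvd_refl mult_dvd_mono power_Suc)
    moreover have "order G \<noteq> 0" using fra.G.order_gt_0_iff_finite assms(5) by simp
    moreover have "\<not> is_unit p" using p by auto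
    ultimately show False by (metis multiplicity_geI not_less_eq_eq order_refl)
  qed
  interpret J: fixed_spectrum_quotient S G \<phi> P "nonsplit_ideal k S G \<phi>"
    by (rule maa.fixed_spectrum_quotientI[OF P cP idx maa.nonsplit_ideal_is_ideal maa.brauer_subset_nonsplit order_refl])
  interpret B: fixed_spectrum_quotient S G \<phi> P "brauer_ideal p S G \<phi>"
    by (rule maa.fixed_spectrum_quotientI[OF P cP idx fra.brauer_ideal_is_ideal order_refl maa.brauer_subset_nonsplit])
  show ?thesis
    unfolding trivial_summand_ring_def brauer_quotient_def
    using J.spectrum_homeomorphic[OF p P cP idx] B.spectrum_homeomorphic[OF p P cP idx]
      J.krull_dim_quotient B.krull_dim_quotient by blast
qed

end
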